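(* The $n$-tuple of controls $(\mathbf{\Pi}^*,\mathbf{C}^* ):=\{((\Pi^{*,1}(t),C^{*,1}(t,X^{*,1}_t)),\dots,(\Pi^{*,n}(t),C^{*,n}(t,X^{*,n}_t))),\ 0\le t\le T\}$ is an $\epsilon_n$-Nash equilibrium of the $n$-agent game with exponential utilities, with $\epsilon_n=O(n^{-1/2})$. That is, there is a sequence $\epsilon_n=O(n^{-1/2})$ such that for every $i\in\{1,\dots,n\}$ and every admissible control $(\Pi^i,C^i)$ of agent $i$, $$J_i\big((\Pi^i,C^i),(\mathbf{\Pi}^*,\mathbf{C}^* )^{-i}\big)\le J_i(\mathbf{\Pi}^*,\mathbf{C}^* )+\epsilon_n.$$
   Context: Data. Fix $T,x_0,z_0,\delta>0$ and types $o_k=(\mu_k,\sigma_k,\beta_k,\theta_k)$, $k=1,\dots,K$, with $\mu_k,\sigma_k,\beta_k>0$, $\theta_k\in(0,1]$. Let $(\alpha(i))_{i\ge1}$ be a sequence in $\{1,\dots,K\}$ ($\alpha(i)$ is the class of agent $i$), $F_n(\{k\})=\frac1n\sum_{i=1}^n1_{\{\alpha(i)=k\}}$, and let $F$ be a probability distribution on $\{1,\dots,K\}$ with $F_n(\{k\})\to F(\{k\})$ for every $k$; assume moreover $\sup_{1\le k\le K}|F_n(\{k\})-F(\{k\})|=O(n^{-1/2})$. $W^1,W^2,\dots$ are independent Brownian motions on a filtered probability space satisfying the usual conditions. Game. Agent $i\in\{1,\dots,n\}$ has wealth $dX^i_t=\Pi^i_t\mu_{\alpha(i)}dt+\Pi^i_t\sigma_{\alpha(i)}dW^i_t-C^i_tdt$,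 $X^i_0=x_0$, habit process $Z^i_t=e^{-\delta t}(z_0+\int_0^t\delta e^{\delta s}C^i_sds)$, utility $U_{\alpha(i)}(y)=-\exp\{-y/\beta_{\alpha(i)}\}$, and objective $$J_i(\mathbf{\Pi},\mathbf{C})=\mathbb{E}\Big[\int_0^TU_{\alpha(i)}\big(C^i_t-\theta_{\alpha(i)}\overline{Z}^n_t\big)dt+U_{\alpha(i)}\big(X^i_T-\theta_{\alpha(i)}\overline{X}^n_T\big)\Big],\quad\overline{Z}^n_t=\frac1n\sum_{j=1}^nZ^j_t,\ \ \overline{X}^n_T=\frac1n\sum_{j=1}^nX^j_T.$$ $(\mathbf{\Pi},\mathbf{C})^{-i}$ denotes the controls of all agents except $i$. Mean field fixed point. For $\overline{Z}\in C([0,T];\mathbb{R})$, $\overline{X}_T\in\mathbb{R}$ and a class $k$ let $$\hat\Pi^k(t)=\beta_k\frac{\mu_k}{\sigma_k^2}(T+1-t),$$ $$\hat C^k(t,x)=\frac{x-\theta_k\overline{X}_T}{T+1-t}+\theta_k\overline{Z}_t-\frac{\theta_k}{T+1-t}\int_t^T\overline{Z}_sds+\frac14\beta_k\Big(\frac{\mu_k}{\sigma_k}\Big)^2\Big((T+1-t)-\frac{1}{T+1-t}\Big),$$ and let $\hat X^k$ solve $d\hat X^k_t=\hat\Pi^k(t)\mu_kdt+\hat\Pi^k(t)\sigma_kdW_t-\hat C^k(t,\hat X^k_t)dt$, $\hat X^k_0=x_0$, with $W$ a Brownian motion. $(\overline{Z},\overline{X}_T)$ is the fixed point of $$d\overline{Z}_t=-\delta\Big\{\overline{Z}_t-\sum_{k=1}^KF(\{k\})\mathbb{E}[\hat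 C^k(t,\hat X^k_t)]\Big\}dt,\ \ \overline{Z}_0=z_0,\qquad\overline{X}_T=\sum_{k=1}^KF(\{k\})\mathbb{E}[\hat X^k_T].$$ Candidate strategies. With this $(\overline{Z},\overline{X}_T)$, $\Pi^{*,i}(t):=\hat\Pi^{\alpha(i)}(t)$, $C^{*,i}(t,x):=\hat C^{\alpha(i)}(t,x)$; $X^{*,i}$ is the corresponding wealth process of agent $i$ (driven by $W^i$, $X^{*,i}_0=x_0$); $Z^{*,i}_t=e^{-\delta t}(z_0+\int_0^t\delta e^{\delta s}C^{*,i}(s,X^{*,i}_s)ds)$; $\overline{Z}^{*,n}_t=\frac1n\sum_{i=1}^nZ^{*,i}_t$, $\overline{X}^{*,n}_T=\frac1n\sum_{i=1}^nX^{*,i}_T$. Admissible controls of agent $i$: progressively measurable $(\Pi^i,C^i)$ with $\mathbb{E}\int_0^T[(\Pi^i_s)^2+(C^i_s)^2]ds<\infty$ and, for a fixed constant $M<\infty$ independent of $n$ (for which the candidate controls above satisfy these bounds), $$\mathbb{E}\Big[\int_0^T|U_{\alpha(i)}(C^i_t-\theta_{\alpha(i)}\overline{Z}^{*,n}_t)|^2dt+|U_{\alpha(i)}(X^i_T-\theta_{\alpha(i)}\overline{X}^{*,n}_T)|^2\Big]<M,\qquad\mathbb{E}\Big[\int_0^T|U_{\alpha(i)}(C^i_t)|^2dt+|U_{\alpha(i)}(X^i_T)|^2\Big]<M.$$ *)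

theory Defs
  imports "HOL-Probability.Probability" "HOL-Library.Landau_Symbols"
begin

section \<open>Stochastic calculus on a filtered probability space\<close>

text \<open>
  Time runs over \<open>[0,T]\<close>. The filtration is indexed by all reals to fit the library locale
  \<open>filtration\<close>; nothing below looks at it outside \<open>[0,T]\<close>.
\<close>

locale usual_filtered_prob_space = prob_space P + filtration "space P" \<F>
  for P :: "'a measure" and \<F> :: "real \<Rightarrow> 'a measure" and T :: real +
  assumes filtration_subalgebra: "\<And>t. t \<in> {0..T} \<Longrightarrow> sets (\<F> t) \<subseteq> sets P"
    and complete: "\<And>A N. N \<in> null_sets P \<Longrightarrow> A \<subseteq> N \<Longrightarrow> A \<in> sets (\<F> 0)"
    and right_continuous: "\<And>t. t \<in> {0..<T} \<Longrightarrow> sets (\<F> t) = (\<Inter>s\<in>{t<..T}. sets (\<F> s))"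

definition adapted :: "(real \<Rightarrow> 'a measure) \<Rightarrow> real \<Rightarrow> (real \<Rightarrow> 'a \<Rightarrow> real) \<Rightarrow> bool" where
  "adapted \<F> T X \<longleftrightarrow> (\<forall>t\<in>{0..T}. X t \<in> borel_measurable (\<F> t))"

definition continuous_paths :: "'a measure \<Rightarrow> real \<Rightarrow> (real \<Rightarrow> 'a \<Rightarrow> real) \<Rightarrow> bool" where
  "continuous_paths P T X \<longleftrightarrow> (\<forall>\<omega>\<in>space P. continuous_on {0..T} (\<lambda>t. X t \<omega>))"

definition progressive :: "(real \<Rightarrow> 'a measure) \<Rightarrow> real \<Rightarrow> (real \<Rightarrow> 'a \<Rightarrow> real) \<Rightarrow> bool" where
  "progressive \<F> T H \<longleftrightarrow>
     (\<forall>t\<in>{0..T}. (\<lambda>(s, \<omega>). H s \<omega>) \<in> borel_measurable (restrict_space borel {0..t} \<Otimes>\<^sub>M \<F> t))"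

definition square_integrable :: "'a measure \<Rightarrow> real \<Rightarrow> (real \<Rightarrow> 'a \<Rightarrow> real) \<Rightarrow> bool" where
  "square_integrable P T H \<longleftrightarrow>
     (\<integral>\<^sup>+\<omega>. (\<integral>\<^sup>+s\<in>{0..T}. ennreal ((H s \<omega>)\<^sup>2) \<partial>lborel) \<partial>P) < \<infinity>"

definition brownian_motion ::
  "'a measure \<Rightarrow> (real \<Rightarrow> 'a measure) \<Rightarrow> real \<Rightarrow> (real \<Rightarrow> 'a \<Rightarrow> real) \<Rightarrow> bool" where
  "brownian_motion P \<F> T W \<longleftrightarrow>
     adapted \<F> T W \<and> continuous_paths P T W \<and> (AE \<omega> in P. W 0 \<omega> = 0) \<and>
     (\<forall>s t. 0 \<le> s \<and> s < t \<and> t \<le> T \<longrightarrow>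
        distributed P lborel (\<lambda>\<omega>. W t \<omega> - W s \<omega>) (normal_density 0 (sqrt (t - s))) \<and>
        prob_space.indep_set P (sets (\<F> s))
          (sets (vimage_algebra (space P) (\<lambda>\<omega>. W t \<omega> - W s \<omega>) borel)))"

text \<open>
  The family is independent as a family of processes, i.e. of random elements of
  the product space of functions on \<open>[0,T]\<close>.
\<close>

definition independent_processes ::
  "'a measure \<Rightarrow> real \<Rightarrow> (nat \<Rightarrow> real \<Rightarrow> 'a \<Rightarrow> real) \<Rightarrow> nat set \<Rightarrow> bool" where
  "independent_processes P T W I \<longleftrightarrow>
     prob_space.indep_vars P (\<lambda>_. PiM {0..T} (\<lambda>_. borel)) (\<lambda>i \<omega>. \<lambda>t\<in>{0..T}. W i t \<omega>) I"

text \<open>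
  Elementary integrands \<open>\<Sum>j<m. \<xi>\<^sub>j 1\<^bsub>(\<tau>\<^sub>j, \<tau>\<^sub>j\<^sub>+\<^sub>1]\<^esub>\<close> with deterministic partition points
  and bounded, \<open>\<F> (\<tau> j)\<close>-measurable coefficients.
\<close>

definition elementary_data ::
  "'a measure \<Rightarrow> (real \<Rightarrow> 'a measure) \<Rightarrow> real \<Rightarrow> nat \<Rightarrow> (nat \<Rightarrow> real) \<Rightarrow> (nat \<Rightarrow> 'a \<Rightarrow> real) \<Rightarrow> bool" where
  "elementary_data P \<F> T m \<tau> \<xi> \<longleftrightarrow>
     (\<forall>j\<le>m. \<tau> j \<in> {0..T}) \<and> (\<forall>j<m. \<tau> j \<le> \<tau> (Suc j)) \<and>
     (\<forall>j<m. \<xi> j \<in> borel_measurable (\<F> (\<tau> j)) \<and> (\<exists>c. \<forall>\<omega>\<in>space P. \<bar>\<xi> j \<omega>\<bar> \<le> c))"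

definition elementary_process ::
  "nat \<Rightarrow> (nat \<Rightarrow> real) \<Rightarrow> (nat \<Rightarrow> 'a \<Rightarrow> real) \<Rightarrow> real \<Rightarrow> 'a \<Rightarrow> real" where
  "elementary_process m \<tau> \<xi> t \<omega> = (\<Sum>j<m. \<xi> j \<omega> * indicator {\<tau> j<..\<tau> (Suc j)} t)"

definition elementary_integral ::
  "(real \<Rightarrow> 'a \<Rightarrow> real) \<Rightarrow> nat \<Rightarrow> (nat \<Rightarrow> real) \<Rightarrow> (nat \<Rightarrow> 'a \<Rightarrow> real) \<Rightarrow> real \<Rightarrow> 'a \<Rightarrow> real" where
  "elementary_integral W m \<tau> \<xi> t \<omega> =
     (\<Sum>j<m. \<xi> j \<omega> * (W (min (\<tau> (Suc j)) t) \<omega> - W (min (\<tau> j) t) \<omega>))"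

text \<open>
  \<open>ito_integral P \<F> T W H I\<close>: the process \<open>I\<close> is (a continuous version of) the Ito integral
  \<open>\<integral>\<^sub>0 H dW\<close> of a progressively measurable, square integrable integrand, i.e. the \<open>L\<^sup>2\<close>-limit of the
  integrals of elementary processes converging to \<open>H\<close> in \<open>L\<^sup>2(P \<otimes> dt)\<close>. It is a relation because
  \<open>I\<close> is determined only up to indistinguishability.
\<close>

definition ito_integral ::
  "'a measure \<Rightarrow> (real \<Rightarrow> 'a measure) \<Rightarrow> real \<Rightarrow> (real \<Rightarrow> 'a \<Rightarrow> real) \<Rightarrow>
   (real \<Rightarrow> 'a \<Rightarrow> real) \<Rightarrow> (real \<Rightarrow> 'a \<Rightarrow> real) \<Rightarrow> bool" where
  "ito_integral P \<F> T W H I \<longleftrightarrow>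
     progressive \<F> T H \<and> square_integrable P T H \<and> adapted \<F> T I \<and> continuous_paths P T I \<and>
     (\<exists>m \<tau> \<xi>.
        (\<forall>l. elementary_data P \<F> T (m l) (\<tau> l) (\<xi> l)) \<and>
        (\<lambda>l. \<integral>\<^sup>+\<omega>. (\<integral>\<^sup>+s\<in>{0..T}.
            ennreal ((elementary_process (m l) (\<tau> l) (\<xi> l) s \<omega> - H s \<omega>)\<^sup>2) \<partial>lborel) \<partial>P) \<longlonglongrightarrow> 0 \<and>
        (\<forall>t\<in>{0..T}. (\<lambda>l. \<integral>\<^sup>+\<omega>.
            ennreal ((elementary_integral W (m l) (\<tau> l) (\<xi> l) t \<omega> - I t \<omega>)\<^sup>2) \<partial>P) \<longlonglongrightarrow> 0))"


section \<open>The game\<close>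

record agent_type =
  mu :: real
  sigma :: real
  beta :: real
  theta :: real

definition utility :: "real \<Rightarrow> real \<Rightarrow> real" where
  "utility b y = - exp (- y / b)"

definition pop_mean :: "nat \<Rightarrow> (nat \<Rightarrow> real) \<Rightarrow> real" where
  "pop_mean n y = (\<Sum>j=1..n. y j) / real n"

text \<open>\<open>dX = \<pi> \<mu> dt + \<pi> \<sigma> dW - C dt\<close>, \<open>X\<^sub>0 = x0\<close>, in integrated form.\<close>

definition wealth_process ::
  "'a measure \<Rightarrow> (real \<Rightarrow> 'a measure) \<Rightarrow> real \<Rightarrow> real \<Rightarrow> agent_type \<Rightarrow> (real \<Rightarrow> 'a \<Rightarrow> real) \<Rightarrow>
   (real \<Rightarrow> 'a \<Rightarrow> real) \<Rightarrow> (real \<Rightarrow> 'a \<Rightarrow> real) \<Rightarrow> (real \<Rightarrow> 'a \<Rightarrow> real) \<Rightarrow> bool" where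
  "wealth_process P \<F> T x0 a W \<pi> C X \<longleftrightarrow>
     adapted \<F> T X \<and> continuous_paths P T X \<and>
     (\<exists>I. ito_integral P \<F> T W (\<lambda>t \<omega>. \<pi> t \<omega> * sigma a) I \<and>
       (AE \<omega> in P. \<forall>t\<in>{0..T}.
          X t \<omega> = x0 + (LINT s:{0..t}|lborel. \<pi> s \<omega> * mu a) + I t \<omega> - (LINT s:{0..t}|lborel. C s \<omega>)))"

definition habit :: "real \<Rightarrow> real \<Rightarrow> (real \<Rightarrow> 'a \<Rightarrow> real) \<Rightarrow> real \<Rightarrow> 'a \<Rightarrow> real" where
  "habit \<delta> z0 C t \<omega> = exp (- \<delta> * t) * (z0 + (LINT s:{0..t}|lborel. \<delta> * exp (\<delta> * s) * C s \<omega>))"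

definition mean_habit ::
  "real \<Rightarrow> real \<Rightarrow> nat \<Rightarrow> (nat \<Rightarrow> real \<Rightarrow> 'a \<Rightarrow> real) \<Rightarrow> real \<Rightarrow> 'a \<Rightarrow> real" where
  "mean_habit \<delta> z0 n C t \<omega> = pop_mean n (\<lambda>j. habit \<delta> z0 (C j) t \<omega>)"

text \<open>
  The objective \<open>J\<^sub>i\<close> as a functional of the consumption processes \<open>C\<close> and wealth processes \<open>X\<close> of all
  agents (the investments enter only through \<open>X\<close>). The utility is negative, so the expectation always
  exists in \<open>[-\<infinity>, 0]\<close>; admissibility does not exclude the value \<open>-\<infinity>\<close>, hence the extended reals and
  the Lebesgue integral of the negated utilities (the Bochner integral would return \<open>0\<close> instead).
\<close>

definition objective ::
  "'a measure \<Rightarrow> real \<Rightarrow> real \<Rightarrow> real \<Rightarrow> (nat \<Rightarrow> agent_type) \<Rightarrow> nat \<Rightarrow> nat \<Rightarrow>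
   (nat \<Rightarrow> real \<Rightarrow> 'a \<Rightarrow> real) \<Rightarrow> (nat \<Rightarrow> real \<Rightarrow> 'a \<Rightarrow> real) \<Rightarrow> ereal" where
  "objective P T \<delta> z0 ag n i C X =
     - enn2ereal (\<integral>\<^sup>+\<omega>.
         ((\<integral>\<^sup>+t\<in>{0..T}. ennreal (- utility (beta (ag i))
              (C i t \<omega> - theta (ag i) * mean_habit \<delta> z0 n C t \<omega>)) \<partial>lborel)
          + ennreal (- utility (beta (ag i))
              (X i T \<omega> - theta (ag i) * pop_mean n (\<lambda>j. X j T \<omega>)))) \<partial>P)"

text \<open>
  The two moment bounds required of the consumption \<open>C\<close> and wealth \<open>X\<close> of an agent of type \<open>a\<close>,
  relative to a reference profile \<open>Cs\<close>, \<open>Xs\<close> (the candidate strategies).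
\<close>

definition utility_bounds ::
  "'a measure \<Rightarrow> real \<Rightarrow> real \<Rightarrow> real \<Rightarrow> real \<Rightarrow> agent_type \<Rightarrow> nat \<Rightarrow>
   (nat \<Rightarrow> real \<Rightarrow> 'a \<Rightarrow> real) \<Rightarrow> (nat \<Rightarrow> real \<Rightarrow> 'a \<Rightarrow> real) \<Rightarrow>
   (real \<Rightarrow> 'a \<Rightarrow> real) \<Rightarrow> (real \<Rightarrow> 'a \<Rightarrow> real) \<Rightarrow> bool" where
  "utility_bounds P T \<delta> z0 M a n Cs Xs C X \<longleftrightarrow>
     (\<integral>\<^sup>+\<omega>.
        ((\<integral>\<^sup>+t\<in>{0..T}. ennreal (\<bar>utility (beta a) (C t \<omega> - theta a * mean_habit \<delta> z0 n Cs t \<omega>)\<bar>\<^sup>2) \<partial>lborel)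
         + ennreal (\<bar>utility (beta a) (X T \<omega> - theta a * pop_mean n (\<lambda>j. Xs j T \<omega>))\<bar>\<^sup>2)) \<partial>P)
       < ennreal M \<and>
     (\<integral>\<^sup>+\<omega>.
        ((\<integral>\<^sup>+t\<in>{0..T}. ennreal (\<bar>utility (beta a) (C t \<omega>)\<bar>\<^sup>2) \<partial>lborel)
         + ennreal (\<bar>utility (beta a) (X T \<omega>)\<bar>\<^sup>2)) \<partial>P)
       < ennreal M"

definition admissible ::
  "'a measure \<Rightarrow> (real \<Rightarrow> 'a measure) \<Rightarrow> real \<Rightarrow> real \<Rightarrow> real \<Rightarrow> real \<Rightarrow> real \<Rightarrow> agent_type \<Rightarrow>
   (real \<Rightarrow> 'a \<Rightarrow> real) \<Rightarrow> nat \<Rightarrow> (nat \<Rightarrow> real \<Rightarrow> 'a \<Rightarrow> real) \<Rightarrow> (nat \<Rightarrow> real \<Rightarrow> 'a \<Rightarrow> real) \<Rightarrow>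
   (real \<Rightarrow> 'a \<Rightarrow> real) \<Rightarrow> (real \<Rightarrow> 'a \<Rightarrow> real) \<Rightarrow> (real \<Rightarrow> 'a \<Rightarrow> real) \<Rightarrow> bool" where
  "admissible P \<F> T x0 z0 \<delta> M a W n Cs Xs \<pi> C X \<longleftrightarrow>
     progressive \<F> T \<pi> \<and> progressive \<F> T C \<and> square_integrable P T \<pi> \<and> square_integrable P T C \<and>
     wealth_process P \<F> T x0 a W \<pi> C X \<and>
     utility_bounds P T \<delta> z0 M a n Cs Xs C X"

text \<open>
  \<open>(\<pi>, C)\<close> with wealth processes \<open>X\<close> is an \<open>\<epsilon>\<close>-Nash equilibrium of the \<open>n\<close>-agent game. A deviation of
  agent \<open>i\<close> leaves the other agents' controls, and hence their wealth, unchanged as processes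
  (open loop). The candidate profile is also the reference profile in the admissibility bounds.
\<close>

definition eps_nash_equilibrium ::
  "'a measure \<Rightarrow> (real \<Rightarrow> 'a measure) \<Rightarrow> real \<Rightarrow> real \<Rightarrow> real \<Rightarrow> real \<Rightarrow> real \<Rightarrow> (nat \<Rightarrow> agent_type) \<Rightarrow>
   (nat \<Rightarrow> real \<Rightarrow> 'a \<Rightarrow> real) \<Rightarrow> nat \<Rightarrow> (nat \<Rightarrow> real \<Rightarrow> 'a \<Rightarrow> real) \<Rightarrow> (nat \<Rightarrow> real \<Rightarrow> 'a \<Rightarrow> real) \<Rightarrow>
   (nat \<Rightarrow> real \<Rightarrow> 'a \<Rightarrow> real) \<Rightarrow> real \<Rightarrow> bool" where
  "eps_nash_equilibrium P \<F> T x0 z0 \<delta> M ag W n \<pi> C X \<epsilon> \<longleftrightarrow>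
     (\<forall>j\<in>{1..n}. wealth_process P \<F> T x0 (ag j) (W j) (\<pi> j) (C j) (X j)) \<and>
     (\<forall>i\<in>{1..n}. \<forall>\<pi>' C' X'.
        admissible P \<F> T x0 z0 \<delta> M (ag i) (W i) n C X \<pi>' C' X' \<longrightarrow>
        objective P T \<delta> z0 ag n i (C(i := C')) (X(i := X'))
          \<le> objective P T \<delta> z0 ag n i C X + ereal \<epsilon>)"


section \<open>Mean field fixed point and candidate strategies\<close>

definition class_freq :: "(nat \<Rightarrow> nat) \<Rightarrow> nat \<Rightarrow> nat \<Rightarrow> real" where
  "class_freq \<alpha> n k = pop_mean n (\<lambda>i. of_bool (\<alpha> i = k))"

definition feedback_pi :: "real \<Rightarrow> agent_type \<Rightarrow> real \<Rightarrow> real" where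
  "feedback_pi T a t = beta a * (mu a / (sigma a)\<^sup>2) * (T + 1 - t)"

definition feedback_C :: "real \<Rightarrow> agent_type \<Rightarrow> (real \<Rightarrow> real) \<Rightarrow> real \<Rightarrow> real \<Rightarrow> real \<Rightarrow> real" where
  "feedback_C T a Zb XbT t x =
     (x - theta a * XbT) / (T + 1 - t) + theta a * Zb t
     - theta a / (T + 1 - t) * (LINT s:{t..T}|lborel. Zb s)
     + 1 / 4 * beta a * (mu a / sigma a)\<^sup>2 * ((T + 1 - t) - 1 / (T + 1 - t))"

text \<open>\<open>X\<close> solves the wealth equation with the feedback strategies, driven by \<open>W\<close>.\<close>

definition feedback_wealth ::
  "'a measure \<Rightarrow> (real \<Rightarrow> 'a measure) \<Rightarrow> real \<Rightarrow> real \<Rightarrow> agent_type \<Rightarrow> (real \<Rightarrow> real) \<Rightarrow> real \<Rightarrow>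
   (real \<Rightarrow> 'a \<Rightarrow> real) \<Rightarrow> (real \<Rightarrow> 'a \<Rightarrow> real) \<Rightarrow> bool" where
  "feedback_wealth P \<F> T x0 a Zb XbT W X \<longleftrightarrow>
     wealth_process P \<F> T x0 a W (\<lambda>t \<omega>. feedback_pi T a t) (\<lambda>t \<omega>. feedback_C T a Zb XbT t (X t \<omega>)) X"

definition mean_field_fixed_point ::
  "'a measure \<Rightarrow> (real \<Rightarrow> 'a measure) \<Rightarrow> real \<Rightarrow> real \<Rightarrow> real \<Rightarrow> real \<Rightarrow> nat \<Rightarrow> (nat \<Rightarrow> agent_type) \<Rightarrow>
   nat pmf \<Rightarrow> (real \<Rightarrow> 'a \<Rightarrow> real) \<Rightarrow> (real \<Rightarrow> real) \<Rightarrow> real \<Rightarrow> bool" where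
  "mean_field_fixed_point P \<F> T x0 z0 \<delta> K ty F W Zb XbT \<longleftrightarrow>
     continuous_on {0..T} Zb \<and>
     (\<exists>Xh. (\<forall>k\<in>{1..K}. feedback_wealth P \<F> T x0 (ty k) Zb XbT W (Xh k)) \<and>
        (\<forall>t\<in>{0..T}. (Zb has_real_derivative
            - \<delta> * (Zb t - (\<Sum>k=1..K. pmf F k * (\<integral>\<omega>. feedback_C T (ty k) Zb XbT t (Xh k t \<omega>) \<partial>P))))
            (at t within {0..T})) \<and>
        Zb 0 = z0 \<and>
        XbT = (\<Sum>k=1..K. pmf F k * (\<integral>\<omega>. Xh k T \<omega> \<partial>P)))"

definition candidate_pi ::
  "real \<Rightarrow> (nat \<Rightarrow> agent_type) \<Rightarrow> nat \<Rightarrow> real \<Rightarrow> 'a \<Rightarrow> real" where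
  "candidate_pi T ag i t \<omega> = feedback_pi T (ag i) t"

definition candidate_C ::
  "real \<Rightarrow> (nat \<Rightarrow> agent_type) \<Rightarrow> (real \<Rightarrow> real) \<Rightarrow> real \<Rightarrow> (nat \<Rightarrow> real \<Rightarrow> 'a \<Rightarrow> real) \<Rightarrow>
   nat \<Rightarrow> real \<Rightarrow> 'a \<Rightarrow> real" where
  "candidate_C T ag Zb XbT X i t \<omega> = feedback_C T (ag i) Zb XbT t (X i t \<omega>)"

end

theory Submission
  imports Defs
begin

text \<open>
  Along the candidate, marginal utility is a martingale, and this martingale prices every wealth
  process. By convexity of the exponential this alone makes the candidate optimal against the mean
  field, and the rest is an estimate of how far the \<open>n\<close>-agent game is from the mean field.

  In detail, let \<open>\<lambda> = \<mu> / \<sigma>\<close> and \<open>Y\<^sub>t = exp (- \<lambda> W\<^sub>t - \<lambda>\<^sup>2 t / 2)\<close>. The wealth equation under the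
  feedback strategies is linear and can be solved path by path: consumption minus \<open>\<theta>\<close> times the
  mean field habit is the affine function \<open>G\<^sub>t = G\<^sub>0 + \<beta> \<lambda>\<^sup>2 t / 2 + \<beta> \<lambda> W\<^sub>t\<close> of Brownian motion,
  and terminal wealth minus \<open>\<theta>\<close> times the mean field wealth is \<open>G\<^sub>T\<close> (\<open>feedback_wealth_excess\<close>). So the
  marginal utilities \<open>exp (- G\<^sub>t / \<beta>)\<close> and \<open>exp (- G\<^sub>T / \<beta>)\<close> are the same multiple of \<open>Y\<^sub>t\<close> and \<open>Y\<^sub>T\<close>.
  On the other hand \<open>E [Y\<^sub>T X\<^sub>T] + E \<integral> Y\<^sub>t C\<^sub>t dt = x\<^sub>0 E Y\<^sub>T\<close> for every wealth process \<open>X\<close> with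
  consumption \<open>C\<close> (\<open>wealth_duality\<close>). Hence the first order term in the tangent inequality for the
  cost vanishes for every deviation.

  The Ito integral enters through two facts only: the integral of \<open>c (T + 1 - t)\<close> is given by
  integration by parts (\<open>ito_integral_remaining_time\<close>), and gains from trade are orthogonal to \<open>Y\<^sub>T\<close>
  (\<open>ito_integral_duality\<close>). Both are Gaussian computations for elementary integrands, followed by a
  passage to the limit in \<open>L\<^sup>2\<close>.

  In the \<open>n\<close>-agent game the tangent inequality has two error terms
  (\<open>exponential_cost_perturbation\<close>, \<open>deviation_bound\<close>). The distance of the empirical averages
  from the mean field costs at most a constant times its \<open>L\<^sup>2\<close> norm. The influence of the deviating
  agent on the averages has weight \<open>1 / n\<close>; only low consumption and low wealth of that agent can
  help it, and since \<open>- x \<le> \<beta> exp (- x / \<beta>)\<close> these are bounded in \<open>L\<^sup>2\<close> by the moment bounds in the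
  definition of admissibility, uniformly over all deviations. Finally, consumption and wealth of
  the candidates are affine in their Brownian motions, so the empirical averages differ from the
  mean field by the error of the class frequencies and by an average of \<open>n\<close> uncorrelated variables;
  both are of order \<open>n\<close> to the power \<open>-1/2\<close> (\<open>mean_deviations\<close>).
\<close>

section \<open>Square integrable functions\<close>

text \<open>
  Membership is kept apart from the norm, since the Bochner integral, and with it \<open>L2norm\<close>, is \<open>0\<close>
  for a square that is not integrable.
\<close>

definition in_L2 :: "'b measure \<Rightarrow> ('b \<Rightarrow> real) \<Rightarrow> bool" where
  "in_L2 M f \<longleftrightarrow> f \<in> borel_measurable M \<and> integrable M (\<lambda>x. (f x)\<^sup>2)"

definition L2norm :: "'b measure \<Rightarrow> ('b \<Rightarrow> real) \<Rightarrow> real" where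
  "L2norm M f = sqrt (\<integral>x. (f x)\<^sup>2 \<partial>M)"

lemma in_L2D:
  assumes "in_L2 M f"
  shows "f \<in> borel_measurable M" "integrable M (\<lambda>x. (f x)\<^sup>2)"
  using assms by (auto simp: in_L2_def)

lemma L2norm_nonneg [simp]: "0 \<le> L2norm M f"
  by (simp add: L2norm_def)

lemma L2norm_power2: "(L2norm M f)\<^sup>2 = (\<integral>x. (f x)\<^sup>2 \<partial>M)"
  by (simp add: L2norm_def)

lemma abs_mult_le_squares: "\<bar>a * b\<bar> \<le> a\<^sup>2 + (b\<^sup>2 :: real)"
proof -
  have "2 * \<bar>a * b\<bar> \<le> a\<^sup>2 + b\<^sup>2"
    using zero_le_power2[of "\<bar>a\<bar> - \<bar>b\<bar>"] by (simp add: power2_diff abs_mult)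
  then show ?thesis
    using abs_ge_zero[of "a * b"] by linarith
qed

lemma in_L2_mult:
  assumes "in_L2 M f" "in_L2 M g"
  shows "integrable M (\<lambda>x. f x * g x)"
proof (rule Bochner_Integration.integrable_bound)
  show "integrable M (\<lambda>x. (f x)\<^sup>2 + (g x)\<^sup>2)"
    using assms by (auto dest: in_L2D)
  show "(\<lambda>x. f x * g x) \<in> borel_measurable M"
    using assms by (auto simp: in_L2_def)
  show "AE x in M. norm (f x * g x) \<le> norm ((f x)\<^sup>2 + (g x)\<^sup>2)"
    using abs_mult_le_squares by simp
qed

lemma in_L2_bound:
  assumes "in_L2 M g" "f \<in> borel_measurable M" "AE x in M. \<bar>f x\<bar> \<le> g x"
  shows "in_L2 M f" "L2norm M f \<le> L2norm M g"
proof -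
  have le: "AE x in M. (f x)\<^sup>2 \<le> (g x)\<^sup>2"
    using assms(3) by eventually_elim (metis abs_ge_zero power2_abs power_mono)
  have g: "integrable M (\<lambda>x. (g x)\<^sup>2)"
    using assms(1) by (rule in_L2D)
  have f: "integrable M (\<lambda>x. (f x)\<^sup>2)"
    by (rule Bochner_Integration.integrable_bound[OF g]) (use assms(2) le in auto)
  then show "in_L2 M f"
    using assms(2) by (simp add: in_L2_def)
  show "L2norm M f \<le> L2norm M g"
    unfolding L2norm_def by (intro real_sqrt_le_mono integral_mono_AE f g le)
qed

lemma in_L2_cmult:
  assumes "in_L2 M f"
  shows "in_L2 M (\<lambda>x. c * f x)" "L2norm M (\<lambda>x. c * f x) = \<bar>c\<bar> * L2norm M f"
  using assms by (auto simp: in_L2_def L2norm_def power_mult_distrib real_sqrt_mult)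

lemma in_L2_abs:
  assumes "in_L2 M f"
  shows "in_L2 M (\<lambda>x. \<bar>f x\<bar>)" "L2norm M (\<lambda>x. \<bar>f x\<bar>) = L2norm M f"
  using assms by (auto simp: in_L2_def L2norm_def)

lemma Cauchy_Schwarz_L2norm:
  assumes "in_L2 M f" "in_L2 M g"
  shows "\<bar>\<integral>x. f x * g x \<partial>M\<bar> \<le> L2norm M f * L2norm M g"
proof -
  note meas = in_L2D(1)[OF assms(1)] in_L2D(1)[OF assms(2)]
  note [measurable] = meas
  have int: "integrable M (\<lambda>x. \<bar>f x\<bar> * \<bar>g x\<bar>)"
    using in_L2_mult[OF assms] by (simp add: abs_mult[symmetric])
  have "ennreal ((\<integral>x. \<bar>f x\<bar> * \<bar>g x\<bar> \<partial>M)\<^sup>2) = (\<integral>\<^sup>+x. ennreal \<bar>f x\<bar> * ennreal \<bar>g x\<bar> \<partial>M)\<^sup>2"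
    using nn_integral_eq_integral[OF int] by (simp add: ennreal_mult ennreal_power)
  also have "\<dots> \<le> (\<integral>\<^sup>+x. (ennreal \<bar>f x\<bar>)\<^sup>2 \<partial>M) * (\<integral>\<^sup>+x. (ennreal \<bar>g x\<bar>)\<^sup>2 \<partial>M)"
    by (rule Cauchy_Schwarz_nn_integral) auto
  also have "\<dots> = ennreal (\<integral>x. (f x)\<^sup>2 \<partial>M) * ennreal (\<integral>x. (g x)\<^sup>2 \<partial>M)"
    using nn_integral_eq_integral[OF in_L2D(2)[OF assms(1)]]
      nn_integral_eq_integral[OF in_L2D(2)[OF assms(2)]]
    by (simp add: ennreal_power)
  also have "\<dots> = ennreal ((L2norm M f * L2norm M g)\<^sup>2)"
    by (simp add: ennreal_mult power_mult_distrib L2norm_power2)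
  finally have "(\<integral>x. \<bar>f x\<bar> * \<bar>g x\<bar> \<partial>M)\<^sup>2 \<le> (L2norm M f * L2norm M g)\<^sup>2"
    by simp
  then have "(\<integral>x. \<bar>f x\<bar> * \<bar>g x\<bar> \<partial>M) \<le> L2norm M f * L2norm M g"
    by (rule power2_le_imp_le) simp
  moreover have "\<bar>\<integral>x. f x * g x \<partial>M\<bar> \<le> (\<integral>x. \<bar>f x\<bar> * \<bar>g x\<bar> \<partial>M)"
    using integral_abs_bound[of M "\<lambda>x. f x * g x"] by (simp add: abs_mult)
  ultimately show ?thesis by simp
qed

lemma in_L2_add:
  assumes "in_L2 M f" "in_L2 M g"
  shows "in_L2 M (\<lambda>x. f x + g x)"
    "L2norm M (\<lambda>x. f x + g x) \<le> L2norm M f + L2norm M g"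
proof -
  note f = in_L2D[OF assms(1)] and g = in_L2D[OF assms(2)]
  note fg = in_L2_mult[OF assms]
  have eq: "(f x + g x)\<^sup>2 = (f x)\<^sup>2 + (g x)\<^sup>2 + 2 * (f x * g x)" for x
    by (simp add: power2_sum)
  show "in_L2 M (\<lambda>x. f x + g x)"
    unfolding in_L2_def eq using f g fg by auto
  have "(L2norm M (\<lambda>x. f x + g x))\<^sup>2 =
      (L2norm M f)\<^sup>2 + (L2norm M g)\<^sup>2 + 2 * (\<integral>x. f x * g x \<partial>M)"
    unfolding L2norm_power2 eq using f g fg by simp
  also have "\<dots> \<le> (L2norm M f + L2norm M g)\<^sup>2"
    using Cauchy_Schwarz_L2norm[OF assms] by (simp add: power2_sum)
  finally show "L2norm M (\<lambda>x. f x + g x) \<le> L2norm M f + L2norm M g"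
    by (rule power2_le_imp_le) simp
qed

lemma in_L2_diff:
  assumes "in_L2 M f" "in_L2 M g"
  shows "in_L2 M (\<lambda>x. f x - g x)"
  using in_L2_add(1)[OF assms(1) in_L2_cmult(1)[OF assms(2), of "-1"]]
  by simp

lemma in_L2_sum:
  assumes "\<And>i. i \<in> A \<Longrightarrow> in_L2 M (f i)"
  shows "in_L2 M (\<lambda>x. \<Sum>i\<in>A. f i x)"
  using assms
proof (induction A rule: infinite_finite_induct)
  case (insert i A)
  then show ?case using in_L2_add(1)[of M "f i"] by simp
qed (simp_all add: in_L2_def)

lemma in_L2_AE_cong:
  assumes "in_L2 M f" "g \<in> borel_measurable M" "AE x in M. g x = f x"
  shows "in_L2 M g" "L2norm M g = L2norm M f"
proof -
  have 1: "integrable M (\<lambda>x. (g x)\<^sup>2) \<longleftrightarrow> integrable M (\<lambda>x. (f x)\<^sup>2)"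
    by (rule integrable_cong_AE) (use assms in \<open>auto dest: in_L2D\<close>)
  have 2: "(\<integral>x. (g x)\<^sup>2 \<partial>M) = (\<integral>x. (f x)\<^sup>2 \<partial>M)"
    by (rule integral_cong_AE) (use assms in \<open>auto dest: in_L2D\<close>)
  show "in_L2 M g" "L2norm M g = L2norm M f"
    using 1 2 assms by (auto simp: in_L2_def L2norm_def)
qed

lemma in_L2_const:
  assumes "finite_measure M"
  shows "in_L2 M (\<lambda>_. c)" "L2norm M (\<lambda>_. c) = \<bar>c\<bar> * sqrt (measure M (space M))"
proof -
  interpret finite_measure M by fact
  show "in_L2 M (\<lambda>_. c)" "L2norm M (\<lambda>_. c) = \<bar>c\<bar> * sqrt (measure M (space M))"
    by (auto simp: in_L2_def L2norm_def real_sqrt_mult)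
qed

lemma in_L2_imp_integrable:
  assumes "finite_measure M" "in_L2 M f"
  shows "integrable M f"
  using in_L2_mult[OF assms(2) in_L2_const(1)[OF assms(1), of 1]] by simp

lemma in_L2I_nn_integral:
  assumes "f \<in> borel_measurable M" "(\<integral>\<^sup>+x. ennreal ((f x)\<^sup>2) \<partial>M) \<le> ennreal B" "0 \<le> B"
  shows "in_L2 M f" "L2norm M f \<le> sqrt B"
proof -
  have i: "integrable M (\<lambda>x. (f x)\<^sup>2)"
    by (rule integrableI_bounded) (use assms in \<open>auto simp: less_top[symmetric] top_unique\<close>)
  then show "in_L2 M f"
    using assms(1) by (simp add: in_L2_def)
  have "(\<integral>x. (f x)\<^sup>2 \<partial>M) \<le> B"
    using assms(2,3) nn_integral_eq_integral[OF i] by simp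
  then show "L2norm M f \<le> sqrt B"
    by (simp add: L2norm_def)
qed

lemma nn_integral_L2norm:
  assumes "in_L2 M f"
  shows "(\<integral>\<^sup>+x. ennreal ((f x)\<^sup>2) \<partial>M) = ennreal ((L2norm M f)\<^sup>2)"
  unfolding L2norm_power2
  by (rule nn_integral_eq_integral) (use assms in \<open>auto dest: in_L2D\<close>)

lemma exp_ge_tangent: "exp a \<ge> exp b + exp b * (a - b)" for a b :: real
proof -
  have "exp b * (1 + (a - b)) \<le> exp b * exp (a - b)"
    by (intro mult_left_mono exp_ge_add_one_self) auto
  then show ?thesis by (simp add: algebra_simps exp_diff)
qed

text \<open>
  Here \<open>g\<close> is the candidate measured against the mean field, \<open>d\<close> the deviation of the average from the
  mean field, \<open>c\<close> the change of control, and \<open>\<eta> m\<close> bounds what this change takes off the average. The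
  exponential lies above its tangents: the tangent at \<open>g - \<theta> d\<close> compares the average with the mean
  field for the candidate, the tangent at \<open>g\<close> compares the candidate with the deviation. The term
  linear in \<open>c\<close> is kept exact, because it cancels between running and terminal cost; the others are
  estimated by Cauchy-Schwarz. An upper bound for \<open>y\<close> suffices because the cost is decreasing.
\<close>

lemma exponential_cost_perturbation:
  fixes g c d m y :: "'b \<Rightarrow> real"
  assumes pos: "\<beta> > 0" "\<theta> \<ge> 0" "\<eta> \<ge> 0"
    and g: "in_L2 M (\<lambda>x. exp (- g x / \<beta>))"
    and gd: "in_L2 M (\<lambda>x. exp (- (g x - \<theta> * d x) / \<beta>))"
    and c: "in_L2 M c" and d: "in_L2 M d"
    and m: "in_L2 M m"
    and y: "integrable M (\<lambda>x. exp (- y x / \<beta>))"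
    and le: "AE x in M. y x \<le> g x + c x - \<theta> * d x + \<theta> * \<eta> * m x"
    and fin: "finite_measure M"
  shows "(\<integral>x. exp (- (g x - \<theta> * d x) / \<beta>) \<partial>M) \<le>
      (\<integral>x. exp (- y x / \<beta>) \<partial>M) + (1 / \<beta>) * (\<integral>x. exp (- g x / \<beta>) * c x \<partial>M)
      + \<theta> / \<beta> * (L2norm M (\<lambda>x. exp (- (g x - \<theta> * d x) / \<beta>)) + L2norm M (\<lambda>x. exp (- g x / \<beta>))) * L2norm M d
      + \<theta> * \<eta> / \<beta> * L2norm M (\<lambda>x. exp (- g x / \<beta>)) * L2norm M m"
proof -
  let ?u = "\<lambda>x. exp (- g x / \<beta>)" and ?v = "\<lambda>x. exp (- (g x - \<theta> * d x) / \<beta>)"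
  have point: "?v x \<le> exp (- y x / \<beta>) + (1 / \<beta>) * (?u x * c x)
      + \<theta> / \<beta> * (?v x * \<bar>d x\<bar>) + \<theta> / \<beta> * (?u x * \<bar>d x\<bar>) + \<theta> * \<eta> / \<beta> * (?u x * m x)"
    if "y x \<le> g x + c x - \<theta> * d x + \<theta> * \<eta> * m x" for x
  proof -
    have "?u x \<ge> ?v x + ?v x * (- \<theta> / \<beta> * d x)"
      using exp_ge_tangent[of "- (g x - \<theta> * d x) / \<beta>" "- g x / \<beta>"] pos by (simp add: field_simps)
    moreover have "?v x * (\<theta> / \<beta> * d x) \<le> ?v x * (\<theta> / \<beta> * \<bar>d x\<bar>)"
      using pos by (intro mult_left_mono) auto
    ultimately have 1: "?v x \<le> ?u x + \<theta> / \<beta> * (?v x * \<bar>d x\<bar>)"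
      by (simp add: algebra_simps)
    have "exp (- y x / \<beta>) \<ge> ?u x + ?u x * ((g x - y x) / \<beta>)"
      using exp_ge_tangent[of "- g x / \<beta>" "- y x / \<beta>"] pos by (simp add: diff_divide_distrib)
    moreover have "?u x * ((y x - g x) / \<beta>) \<le> ?u x * ((c x + \<theta> * \<bar>d x\<bar> + \<theta> * \<eta> * m x) / \<beta>)"
    proof -
      have "\<theta> * (- d x) \<le> \<theta> * \<bar>d x\<bar>" using pos by (intro mult_left_mono) auto
      then show ?thesis using that pos by (intro mult_left_mono divide_right_mono) auto
    qed
    ultimately have 2: "?u x \<le> exp (- y x / \<beta>) + ?u x * ((c x + \<theta> * \<bar>d x\<bar> + \<theta> * \<eta> * m x) / \<beta>)"
      by (simp add: algebra_simps diff_divide_distrib)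
    have "?u x * ((c x + \<theta> * \<bar>d x\<bar> + \<theta> * \<eta> * m x) / \<beta>) = 
      (1 / \<beta>) * (?u x * c x) + \<theta> / \<beta> * (?u x * \<bar>d x\<bar>) + \<theta> * \<eta> / \<beta> * (?u x * m x)"
      using pos by (simp add: field_simps)
    with 1 2 show ?thesis by linarith
  qed
  note ad = in_L2_abs[OF d]
  note ints = y in_L2_mult[OF g c] in_L2_mult[OF gd ad(1)]
    in_L2_mult[OF g ad(1)] in_L2_mult[OF g m]
    in_L2_imp_integrable[OF fin gd]
  have "(\<integral>x. ?v x \<partial>M) \<le> (\<integral>x. exp (- y x / \<beta>) + (1 / \<beta>) * (?u x * c x)
      + \<theta> / \<beta> * (?v x * \<bar>d x\<bar>) + \<theta> / \<beta> * (?u x * \<bar>d x\<bar>) + \<theta> * \<eta> / \<beta> * (?u x * m x) \<partial>M)"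
    using le by (intro integral_mono_AE) (use ints point in \<open>auto simp: eventually_mono\<close>)
  also have "\<dots> = (\<integral>x. exp (- y x / \<beta>) \<partial>M) + (1 / \<beta>) * (\<integral>x. ?u x * c x \<partial>M)
      + \<theta> / \<beta> * (\<integral>x. ?v x * \<bar>d x\<bar> \<partial>M) + \<theta> / \<beta> * (\<integral>x. ?u x * \<bar>d x\<bar> \<partial>M)
      + \<theta> * \<eta> / \<beta> * (\<integral>x. ?u x * m x \<partial>M)"
    using ints by simp
  also have "\<dots> \<le> (\<integral>x. exp (- y x / \<beta>) \<partial>M) + (1 / \<beta>) * (\<integral>x. ?u x * c x \<partial>M)
      + \<theta> / \<beta> * (L2norm M ?v * L2norm M d) + \<theta> / \<beta> * (L2norm M ?u * L2norm M d)
      + \<theta> * \<eta> / \<beta> * (L2norm M ?u * L2norm M m)"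
  proof -
    have "(\<integral>x. ?v x * \<bar>d x\<bar> \<partial>M) \<le> L2norm M ?v * L2norm M d"
      "(\<integral>x. ?u x * \<bar>d x\<bar> \<partial>M) \<le> L2norm M ?u * L2norm M d"
      "(\<integral>x. ?u x * m x \<partial>M) \<le> L2norm M ?u * L2norm M m"
      using Cauchy_Schwarz_L2norm[OF gd ad(1)] Cauchy_Schwarz_L2norm[OF g ad(1)]
        Cauchy_Schwarz_L2norm[OF g m] ad(2) by auto
    then show ?thesis
      using pos by (intro add_mono mult_left_mono) auto
  qed
  finally show ?thesis by (simp add: algebra_simps)
qed

section \<open>Gaussian increments of Brownian motion\<close>

text \<open>
  Completing the square: an exponential factor only shifts the mean, so exponential moments of a
  Gaussian reduce to its ordinary moments.
\<close>

lemma normal_density_exp_tilt: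
  assumes "\<sigma> > 0"
  shows "normal_density 0 \<sigma> x * exp (c * x) = exp (c\<^sup>2 * \<sigma>\<^sup>2 / 2) * normal_density (c * \<sigma>\<^sup>2) \<sigma> x"
proof -
  have "- (x - 0)\<^sup>2 / (2 * \<sigma>\<^sup>2) + c * x = c\<^sup>2 * \<sigma>\<^sup>2 / 2 + - (x - c * \<sigma>\<^sup>2)\<^sup>2 / (2 * \<sigma>\<^sup>2)"
    using assms by (simp add: field_simps power2_eq_square)
  then have "exp (- (x - 0)\<^sup>2 / (2 * \<sigma>\<^sup>2)) * exp (c * x) =
      exp (c\<^sup>2 * \<sigma>\<^sup>2 / 2) * exp (- (x - c * \<sigma>\<^sup>2)\<^sup>2 / (2 * \<sigma>\<^sup>2))"
    by (simp only: exp_add[symmetric])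
  then show ?thesis
    by (simp add: normal_density_def)
qed

context usual_filtered_prob_space
begin

lemma F_measurable_P:
  assumes "X \<in> borel_measurable (\<F> t)" "t \<in> {0..T}"
  shows "X \<in> borel_measurable P"
  by (rule measurable_mono[THEN subsetD, OF _ _ _ _ assms(1)])
    (use assms(2) filtration_subalgebra space_F in auto)

lemma F_measurable_mono:
  assumes "X \<in> borel_measurable (\<F> s)" "s \<le> t"
  shows "X \<in> borel_measurable (\<F> t)"
  by (rule measurable_mono[THEN subsetD, OF _ _ _ _ assms(1)])
    (use assms(2) sets_F_mono[of s t] space_F in auto)

end

locale brownian = usual_filtered_prob_space P \<F> T
  for P :: "'a measure" and \<F> T +
  fixes W :: "real \<Rightarrow> 'a \<Rightarrow> real"
  assumes T_pos: "T > 0" and brownian: "brownian_motion P \<F> T W"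
begin

lemma W_F_measurable: "0 \<le> t \<Longrightarrow> t \<le> T \<Longrightarrow> W t \<in> borel_measurable (\<F> t)"
  using brownian by (auto simp: brownian_motion_def adapted_def)

lemma W_measurable: "0 \<le> t \<Longrightarrow> t \<le> T \<Longrightarrow> W t \<in> borel_measurable P"
  using F_measurable_P W_F_measurable by auto

lemma W_0: "AE \<omega> in P. W 0 \<omega> = 0"
  using brownian by (auto simp: brownian_motion_def)

lemma increment_F_measurable:
  assumes "0 \<le> a" "a \<le> b" "b \<le> T"
  shows "(\<lambda>\<omega>. W b \<omega> - W a \<omega>) \<in> borel_measurable (\<F> b)"
  using F_measurable_mono[OF W_F_measurable[of a], of b] W_F_measurable[of b] assms by simp

lemma increment_measurable:
  assumes "0 \<le> a" "a \<le> b" "b \<le> T"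
  shows "(\<lambda>\<omega>. W b \<omega> - W a \<omega>) \<in> borel_measurable P"
  using F_measurable_P[OF increment_F_measurable[OF assms]] assms by auto

text \<open>
  The case \<open>a = b\<close> is part of the statement, so that partition points may coincide; it is treated
  separately, because a degenerate increment has no normal density.
\<close>

lemma increment_exp_moments:
  assumes "0 \<le> a" "a \<le> b" "b \<le> T"
  shows "integrable P (\<lambda>\<omega>. exp (c * (W b \<omega> - W a \<omega>)))"
    and "(\<integral>\<omega>. exp (c * (W b \<omega> - W a \<omega>)) \<partial>P) = exp (c\<^sup>2 * (b - a) / 2)"
    and "integrable P (\<lambda>\<omega>. (W b \<omega> - W a \<omega>) * exp (c * (W b \<omega> - W a \<omega>)))"
    and "(\<integral>\<omega>. (W b \<omega> - W a \<omega>) * exp (c * (W b \<omega> - W a \<omega>)) \<partial>P) = c * (b - a) * exp (c\<^sup>2 * (b - a) / 2)"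
    and "integrable P (\<lambda>\<omega>. (W b \<omega> - W a \<omega>)\<^sup>2)"
    and "(\<integral>\<omega>. (W b \<omega> - W a \<omega>)\<^sup>2 \<partial>P) = b - a"
proof -
  have "integrable P (\<lambda>\<omega>. exp (c * (W b \<omega> - W a \<omega>))) \<and>
    (\<integral>\<omega>. exp (c * (W b \<omega> - W a \<omega>)) \<partial>P) = exp (c\<^sup>2 * (b - a) / 2) \<and>
    integrable P (\<lambda>\<omega>. (W b \<omega> - W a \<omega>) * exp (c * (W b \<omega> - W a \<omega>))) \<and>
    (\<integral>\<omega>. (W b \<omega> - W a \<omega>) * exp (c * (W b \<omega> - W a \<omega>)) \<partial>P) = c * (b - a) * exp (c\<^sup>2 * (b - a) / 2) \<and>
    integrable P (\<lambda>\<omega>. (W b \<omega> - W a \<omega>)\<^sup>2) \<and> (\<integral>\<omega>. (W b \<omega> - W a \<omega>)\<^sup>2 \<partial>P) = b - a"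
  proof (cases "a = b")
    case False
    define \<sigma> where "\<sigma> = sqrt (b - a)"
    have \<sigma>: "\<sigma> > 0" "\<sigma>\<^sup>2 = b - a" using False assms by (auto simp: \<sigma>_def)
    have D: "distributed P lborel (\<lambda>\<omega>. W b \<omega> - W a \<omega>) (normal_density 0 \<sigma>)"
      using brownian False assms by (auto simp: brownian_motion_def \<sigma>_def)
    note dI = distributed_integrable[OF D] and dE = distributed_integral[OF D]
    have 1: "normal_density 0 \<sigma> x * (x * exp (c * x)) =
        exp (c\<^sup>2 * \<sigma>\<^sup>2 / 2) * (normal_density (c * \<sigma>\<^sup>2) \<sigma> x * x)" for x
      using normal_density_exp_tilt[OF \<sigma>(1), of x c] by (simp add: algebra_simps)
    show ?thesis
      using dI[of "\<lambda>x. exp (c * x)"] dE[of "\<lambda>x. exp (c * x)"]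
        dI[of "\<lambda>x. x * exp (c * x)"] dE[of "\<lambda>x. x * exp (c * x)"]
        dI[of "\<lambda>x. x\<^sup>2"] dE[of "\<lambda>x. x\<^sup>2"] \<sigma>
        integral_normal_moment_nz_1[OF \<sigma>(1), of "c * \<sigma>\<^sup>2"]
        integrable_normal_moment_nz_1[OF \<sigma>(1), of "c * \<sigma>\<^sup>2"]
        integrable_normal_moment[OF \<sigma>(1), of 0 2] integral_normal_moment_even[OF \<sigma>(1), of 0 1]
      by (simp add: normal_density_exp_tilt[OF \<sigma>(1)] 1, simp add: mult_ac)
  qed (simp add: prob_space)
  then show "integrable P (\<lambda>\<omega>. exp (c * (W b \<omega> - W a \<omega>)))"
    "(\<integral>\<omega>. exp (c * (W b \<omega> - W a \<omega>)) \<partial>P) = exp (c\<^sup>2 * (b - a) / 2)"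
    "integrable P (\<lambda>\<omega>. (W b \<omega> - W a \<omega>) * exp (c * (W b \<omega> - W a \<omega>)))"
    "(\<integral>\<omega>. (W b \<omega> - W a \<omega>) * exp (c * (W b \<omega> - W a \<omega>)) \<partial>P) = c * (b - a) * exp (c\<^sup>2 * (b - a) / 2)"
    "integrable P (\<lambda>\<omega>. (W b \<omega> - W a \<omega>)\<^sup>2)" "(\<integral>\<omega>. (W b \<omega> - W a \<omega>)\<^sup>2 \<partial>P) = b - a"
    by blast+
qed

lemma increment_moments:
  assumes "0 \<le> a" "a \<le> b" "b \<le> T"
  shows "in_L2 P (\<lambda>\<omega>. W b \<omega> - W a \<omega>)"
    and "integrable P (\<lambda>\<omega>. W b \<omega> - W a \<omega>)" and "(\<integral>\<omega>. W b \<omega> - W a \<omega> \<partial>P) = 0"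
  using increment_exp_moments(3,4)[OF assms, of 0] increment_exp_moments(5)[OF assms]
    increment_measurable[OF assms] by (auto simp: in_L2_def)

text \<open>
  The form in which independence of the increments from the past is used below: events are replaced
  by random variables, and again the increment may be degenerate.
\<close>

lemma increment_indep_product:
  fixes \<xi> :: "'a \<Rightarrow> real" and \<phi> :: "real \<Rightarrow> real"
  assumes ab: "0 \<le> a" "a \<le> b" "b \<le> T"
    and \<xi>: "\<xi> \<in> borel_measurable (\<F> a)" "integrable P \<xi>"
    and \<phi>: "\<phi> \<in> borel_measurable borel" "integrable P (\<lambda>\<omega>. \<phi> (W b \<omega> - W a \<omega>))"
  shows "integrable P (\<lambda>\<omega>. \<xi> \<omega> * \<phi> (W b \<omega> - W a \<omega>))"
    and "(\<integral>\<omega>. \<xi> \<omega> * \<phi> (W b \<omega> - W a \<omega>) \<partial>P) = (\<integral>\<omega>. \<xi> \<omega> \<partial>P) * (\<integral>\<omega>. \<phi> (W b \<omega> - W a \<omega>) \<partial>P)"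
proof -
  have "integrable P (\<lambda>\<omega>. \<xi> \<omega> * \<phi> (W b \<omega> - W a \<omega>)) \<and>
    (\<integral>\<omega>. \<xi> \<omega> * \<phi> (W b \<omega> - W a \<omega>) \<partial>P) = (\<integral>\<omega>. \<xi> \<omega> \<partial>P) * (\<integral>\<omega>. \<phi> (W b \<omega> - W a \<omega>) \<partial>P)"
  proof (cases "a = b")
    case True
    then show ?thesis using \<xi> by (simp add: prob_space)
  next
    case False
    let ?D = "\<lambda>\<omega>. W b \<omega> - W a \<omega>"
    have ind: "indep_set (sets (\<F> a)) (sets (vimage_algebra (space P) ?D borel))"
      using brownian False ab by (auto simp: brownian_motion_def)
    have rv: "\<xi> \<in> borel_measurable P" "?D \<in> borel_measurable P"
      using F_measurable_P[OF \<xi>(1)] increment_measurable[OF ab] ab by auto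
    have "indep_var borel \<xi> borel ?D"
      unfolding indep_var_eq
    proof (intro conjI rv indep_set_sigma_sets)
      show "indep_set {\<xi> -` A \<inter> space P |A. A \<in> sets borel} {?D -` A \<inter> space P |A. A \<in> sets borel}"
        unfolding indep_set_def
      proof (rule indep_sets_mono_sets[OF ind[unfolded indep_set_def]])
        fix i :: bool
        have "\<xi> -` A \<inter> space P \<in> sets (\<F> a)" if "A \<in> sets borel" for A
          using measurable_sets[OF \<xi>(1) that] by (simp add: space_F)
        moreover have "?D -` A \<inter> space P \<in> sets (vimage_algebra (space P) ?D borel)" if "A \<in> sets borel" for A
          using that by (rule in_vimage_algebra)
        ultimately show "case_bool {\<xi> -` A \<inter> space P |A. A \<in> sets borel} {?D -` A \<inter> space P |A. A \<in> sets borel} i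
            \<subseteq> case_bool (sets (\<F> a)) (sets (vimage_algebra (space P) ?D borel)) i"
          by (auto split: bool.split)
      qed
      have "Int_stable {f -` A \<inter> space P |A. A \<in> sets borel}" for f :: "'a \<Rightarrow> real"
      proof (rule Int_stableI)
        fix X Y assume "X \<in> {f -` A \<inter> space P |A. A \<in> sets borel}" "Y \<in> {f -` A \<inter> space P |A. A \<in> sets borel}"
        then obtain A B where "A \<in> sets borel" "B \<in> sets borel" "X = f -` A \<inter> space P" "Y = f -` B \<inter> space P"
          by auto
        then show "X \<inter> Y \<in> {f -` A \<inter> space P |A. A \<in> sets borel}"
          by (intro CollectI exI[of _ "A \<inter> B"]) auto
      qed
      then show "Int_stable {\<xi> -` A \<inter> space P |A. A \<in> sets borel}"
        "Int_stable {?D -` A \<inter> space P |A. A \<in> sets borel}" by auto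
    qed
    from indep_var_compose[OF this measurable_ident_sets[OF refl] \<phi>(1)]
    have "indep_var borel \<xi> borel (\<lambda>\<omega>. \<phi> (?D \<omega>))"
      by (simp add: comp_def)
    from indep_var_lebesgue_integral[OF this \<xi>(2) \<phi>(2)] indep_var_integrable[OF this \<xi>(2) \<phi>(2)]
    show ?thesis by simp
  qed
  then show "integrable P (\<lambda>\<omega>. \<xi> \<omega> * \<phi> (W b \<omega> - W a \<omega>))"
    "(\<integral>\<omega>. \<xi> \<omega> * \<phi> (W b \<omega> - W a \<omega>) \<partial>P) = (\<integral>\<omega>. \<xi> \<omega> \<partial>P) * (\<integral>\<omega>. \<phi> (W b \<omega> - W a \<omega>) \<partial>P)"
    by blast+
qed

lemma in_L2_bounded_mult:
  assumes "\<xi> \<in> borel_measurable P" "\<forall>\<omega>\<in>space P. \<bar>\<xi> \<omega>\<bar> \<le> c" "in_L2 P X"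
  shows "in_L2 P (\<lambda>\<omega>. \<xi> \<omega> * X \<omega>)"
proof (rule in_L2_bound(1))
  show "in_L2 P (\<lambda>\<omega>. c * \<bar>X \<omega>\<bar>)"
    by (rule in_L2_cmult(1)[OF in_L2_abs(1)[OF assms(3)]])
  show "(\<lambda>\<omega>. \<xi> \<omega> * X \<omega>) \<in> borel_measurable P"
    using assms by (auto simp: in_L2_def)
  show "AE \<omega> in P. \<bar>\<xi> \<omega> * X \<omega>\<bar> \<le> c * \<bar>X \<omega>\<bar>"
    using assms(2) by (intro AE_I2) (auto simp: abs_mult intro!: mult_right_mono)
qed

lemma W_square_integrable:
  assumes "0 \<le> t" "t \<le> T"
  shows "in_L2 P (W t)" "(\<integral>\<omega>. W t \<omega> \<partial>P) = 0" "(\<integral>\<omega>. (W t \<omega>)\<^sup>2 \<partial>P) = t"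
proof -
  have ae: "AE \<omega> in P. W t \<omega> = W t \<omega> - W 0 \<omega>" using W_0 by auto
  note inc = increment_moments[of 0 t] increment_exp_moments[of 0 t]
  show "in_L2 P (W t)"
    using in_L2_AE_cong(1)[OF inc(1) W_measurable[of t] ae] assms by simp
  show "(\<integral>\<omega>. W t \<omega> \<partial>P) = 0"
    using integral_cong_AE[OF _ _ ae] inc(3) assms W_measurable[of t] increment_measurable[of 0 t] by auto
  show "(\<integral>\<omega>. (W t \<omega>)\<^sup>2 \<partial>P) = t"
    using in_L2_AE_cong(2)[OF inc(1) W_measurable[of t] ae] inc(9) assms
    by (simp add: L2norm_def)
qed

subsection \<open>Correlation of weighted increments\<close>

text \<open>
  Cut both increments at \<open>c\<close> and at the smaller right end point. Of the resulting products only the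
  square over the overlap has a nonzero mean; in each of the others the latest increment is centred
  and independent of everything else.
\<close>

lemma weighted_increments_correlation_ordered:
  assumes ab: "0 \<le> a" "a \<le> b" "b \<le> T" and cd: "c \<le> d" "d \<le> T" and ac: "a \<le> c"
    and \<xi>: "\<xi> \<in> borel_measurable (\<F> a)" "\<forall>\<omega>\<in>space P. \<bar>\<xi> \<omega>\<bar> \<le> B1"
    and \<eta>: "\<eta> \<in> borel_measurable (\<F> c)" "\<forall>\<omega>\<in>space P. \<bar>\<eta> \<omega>\<bar> \<le> B2"
  shows "(\<integral>\<omega>. (\<xi> \<omega> * (W b \<omega> - W a \<omega>)) * (\<eta> \<omega> * (W d \<omega> - W c \<omega>)) \<partial>P) =
    (\<integral>\<omega>. \<xi> \<omega> * \<eta> \<omega> \<partial>P) * max 0 (min b d - c)"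
proof -
  let ?\<zeta> = "\<lambda>\<omega>. \<xi> \<omega> * \<eta> \<omega>"
  have \<zeta>F: "?\<zeta> \<in> borel_measurable (\<F> c)"
    using F_measurable_mono[OF \<xi>(1) ac] \<eta>(1) by simp
  have \<zeta>P: "?\<zeta> \<in> borel_measurable P" using F_measurable_P[OF \<zeta>F] assms by auto
  have \<zeta>b: "\<forall>\<omega>\<in>space P. \<bar>?\<zeta> \<omega>\<bar> \<le> B1 * B2"
    using \<xi>(2) \<eta>(2) by (auto simp: abs_mult intro!: mult_mono intro: order_trans[OF abs_ge_zero])
  have \<zeta>i: "integrable P ?\<zeta>"
    by (rule integrable_const_bound[of _ "B1 * B2"]) (use \<zeta>P \<zeta>b in auto)
  have zero: "integrable P (\<lambda>\<omega>. ?\<zeta> \<omega> * (W v \<omega> - W u \<omega>) * (W z \<omega> - W y \<omega>)) \<and>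
      (\<integral>\<omega>. ?\<zeta> \<omega> * (W v \<omega> - W u \<omega>) * (W z \<omega> - W y \<omega>) \<partial>P) = 0"
    if "0 \<le> u" "u \<le> v" "v \<le> y" "c \<le> y" "y \<le> z" "z \<le> T" for u v y z
  proof -
    have *: "(\<lambda>\<omega>. ?\<zeta> \<omega> * (W v \<omega> - W u \<omega>)) \<in> borel_measurable (\<F> y)"
      using F_measurable_mono[OF \<zeta>F, of y] F_measurable_mono[OF increment_F_measurable[of u v], of y] that
      by simp
    have "in_L2 P (\<lambda>\<omega>. ?\<zeta> \<omega> * (W v \<omega> - W u \<omega>))"
      by (rule in_L2_bounded_mult[OF \<zeta>P \<zeta>b]) (use increment_moments[of u v] that in auto)
    from in_L2_imp_integrable[OF finite_measure_axioms this]
    have **: "integrable P (\<lambda>\<omega>. ?\<zeta> \<omega> * (W v \<omega> - W u \<omega>))" .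
    show ?thesis
      using increment_indep_product[OF _ _ _ * **, of z "\<lambda>x. x"] increment_moments[of y z] that by auto
  qed
  show ?thesis
  proof (cases "b \<le> c")
    case True
    then have "max 0 (min b d - c) = 0" by auto
    then show ?thesis using zero[of a b c d] True assms by (simp add: ac_simps)
  next
    case False
    define e f where "e = min b d" and "f = max b d"
    have ef: "c \<le> e" "e \<le> f" "f \<le> T" "0 \<le> c" using False assms by (auto simp: e_def f_def)
    have eq: "(\<xi> \<omega> * (W b \<omega> - W a \<omega>)) * (\<eta> \<omega> * (W d \<omega> - W c \<omega>)) =
       ?\<zeta> \<omega> * (W c \<omega> - W a \<omega>) * (W d \<omega> - W c \<omega>) + ?\<zeta> \<omega> * (W e \<omega> - W c \<omega>)\<^sup>2
       + ?\<zeta> \<omega> * (W e \<omega> - W c \<omega>) * (W f \<omega> - W e \<omega>)" for \<omega>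
      by (cases "b \<le> d") (auto simp: e_def f_def algebra_simps power2_eq_square)
    note sq = increment_indep_product[OF \<open>0 \<le> c\<close> \<open>c \<le> e\<close> _ \<zeta>F \<zeta>i, of "\<lambda>x. x\<^sup>2"]
    have "(\<integral>\<omega>. (\<xi> \<omega> * (W b \<omega> - W a \<omega>)) * (\<eta> \<omega> * (W d \<omega> - W c \<omega>)) \<partial>P) = 
      (\<integral>\<omega>. ?\<zeta> \<omega> * (W e \<omega> - W c \<omega>)\<^sup>2 \<partial>P)"
      unfolding eq using zero[of a c c d] zero[of c e e f] sq(1) increment_exp_moments(5)[of c e] ef assms
      by simp
    also have "\<dots> = (\<integral>\<omega>. ?\<zeta> \<omega> \<partial>P) * (e - c)"
      using sq(2) increment_exp_moments(5,6)[of c e] ef by simp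
    finally show ?thesis using ef by (simp add: e_def)
  qed
qed

text \<open>
  The two intervals may overlap in any way, so elementary integrals over different partitions can be
  multiplied term by term. Measurability of a coefficient is required only if its interval is
  nonempty: an elementary integrand stopped at time \<open>t\<close> still has coefficients that become known
  after \<open>t\<close>, but their intervals are empty.
\<close>

lemma weighted_increments_correlation:
  assumes ab: "0 \<le> a" "a \<le> b" "b \<le> T" and cd: "0 \<le> c" "c \<le> d" "d \<le> T"
    and \<xi>: "a < b \<Longrightarrow> \<xi> \<in> borel_measurable (\<F> a)" "\<forall>\<omega>\<in>space P. \<bar>\<xi> \<omega>\<bar> \<le> B1"
    and \<eta>: "c < d \<Longrightarrow> \<eta> \<in> borel_measurable (\<F> c)" "\<forall>\<omega>\<in>space P. \<bar>\<eta> \<omega>\<bar> \<le> B2"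
  shows "(\<integral>\<omega>. (\<xi> \<omega> * (W b \<omega> - W a \<omega>)) * (\<eta> \<omega> * (W d \<omega> - W c \<omega>)) \<partial>P) =
    (\<integral>\<omega>. \<xi> \<omega> * \<eta> \<omega> \<partial>P) * max 0 (min b d - max a c)"
proof (cases "a < b \<and> c < d")
  case True
  show ?thesis
  proof (cases "a \<le> c")
    case le: True
    then show ?thesis
      using weighted_increments_correlation_ordered[OF ab cd(2,3) le \<xi>(1) \<xi>(2) \<eta>(1) \<eta>(2)] True
      by (simp add: max_absorb2)
  next
    case False
    then show ?thesis
      using weighted_increments_correlation_ordered[OF cd ab(2,3) _ \<eta>(1) \<eta>(2) \<xi>(1) \<xi>(2)] True
      by (simp add: max_absorb1 mult.commute min.commute)
  qed
next
  case False
  then have "a = b \<or> c = d" using assms by auto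
  then show ?thesis by (auto simp: max_def min_def)
qed

subsection \<open>The exponential martingale\<close>

text \<open>
  The state price density of a market with market price of risk \<open>l\<close>.
\<close>

definition exp_mart :: "real \<Rightarrow> real \<Rightarrow> 'a \<Rightarrow> real" where
  "exp_mart l t \<omega> = exp (- l * W t \<omega> - l\<^sup>2 * t / 2)"

lemma exp_mart_F_measurable:
  assumes "0 \<le> t" "t \<le> T"
  shows "exp_mart l t \<in> borel_measurable (\<F> t)" "exp_mart l t \<in> borel_measurable P"
proof -
  show *: "exp_mart l t \<in> borel_measurable (\<F> t)"
    unfolding exp_mart_def using W_F_measurable[OF assms] by simp
  show "exp_mart l t \<in> borel_measurable P" using F_measurable_P[OF *] assms by simp
qed

lemma exp_mart_square_integrable:
  assumes "0 \<le> t" "t \<le> T"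
  shows "in_L2 P (exp_mart l t)" "L2norm P (exp_mart l t) = exp (l\<^sup>2 * t / 2)"
proof -
  have ae: "AE \<omega> in P. (exp_mart l t \<omega>)\<^sup>2 = exp (- l\<^sup>2 * t) * exp ((- 2 * l) * (W t \<omega> - W 0 \<omega>))"
    using W_0 by eventually_elim (simp add: exp_mart_def power2_eq_square exp_add[symmetric] algebra_simps)
  note m = increment_exp_moments(1,2)[of 0 t "- 2 * l"]
  have int: "integrable P (\<lambda>\<omega>. (exp_mart l t \<omega>)\<^sup>2)"
    by (subst integrable_cong_AE[OF _ _ ae])
      (use m assms exp_mart_F_measurable[OF assms] increment_measurable[of 0 t] in auto)
  have "(\<integral>\<omega>. (exp_mart l t \<omega>)\<^sup>2 \<partial>P) = exp (- l\<^sup>2 * t) * exp ((- 2 * l)\<^sup>2 * t / 2)"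
    by (subst integral_cong_AE[OF _ _ ae])
      (use m assms exp_mart_F_measurable[OF assms] increment_measurable[of 0 t] in auto)
  also have "\<dots> = (exp (l\<^sup>2 * t / 2))\<^sup>2"
    by (simp add: exp_add[symmetric] power_mult_distrib exp_of_nat_mult[symmetric])
  finally show "L2norm P (exp_mart l t) = exp (l\<^sup>2 * t / 2)"
    by (simp add: L2norm_def)
  show "in_L2 P (exp_mart l t)"
    using int exp_mart_F_measurable[OF assms] by (simp add: in_L2_def)
qed

lemma exp_mart_split:
  "exp_mart l t \<omega> = exp_mart l s \<omega> * (exp (- l\<^sup>2 * (t - s) / 2) * exp (- l * (W t \<omega> - W s \<omega>)))"
  by (simp add: exp_mart_def exp_add[symmetric] algebra_simps diff_divide_distrib)

lemma exp_mart_martingale: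
  assumes st: "0 \<le> s" "s \<le> t" "t \<le> T"
    and \<psi>: "\<psi> \<in> borel_measurable (\<F> s)" "integrable P (\<lambda>\<omega>. exp_mart l s \<omega> * \<psi> \<omega>)"
  shows "integrable P (\<lambda>\<omega>. exp_mart l t \<omega> * \<psi> \<omega>)"
    and "(\<integral>\<omega>. exp_mart l t \<omega> * \<psi> \<omega> \<partial>P) = (\<integral>\<omega>. exp_mart l s \<omega> * \<psi> \<omega> \<partial>P)"
proof -
  let ?\<phi> = "\<lambda>x. exp (- l\<^sup>2 * (t - s) / 2) * exp (- l * x)"
  have meas: "(\<lambda>\<omega>. exp_mart l s \<omega> * \<psi> \<omega>) \<in> borel_measurable (\<F> s)"
    using exp_mart_F_measurable[of s l] \<psi>(1) st by simp
  have eq: "exp_mart l t \<omega> * \<psi> \<omega> = (exp_mart l s \<omega> * \<psi> \<omega>) * ?\<phi> (W t \<omega> - W s \<omega>)" for \<omega>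
    by (subst exp_mart_split[of l t \<omega> s]) simp
  note pr = increment_indep_product[OF st meas \<psi>(2), of ?\<phi>] 
  have i: "integrable P (\<lambda>\<omega>. ?\<phi> (W t \<omega> - W s \<omega>))" "(\<integral>\<omega>. ?\<phi> (W t \<omega> - W s \<omega>) \<partial>P) = 1"
    using increment_exp_moments(1,2)[OF st, of "-l"] by (simp_all add: exp_minus)
  show "integrable P (\<lambda>\<omega>. exp_mart l t \<omega> * \<psi> \<omega>)"
    unfolding eq by (rule pr(1)) (use i in auto)
  show "(\<integral>\<omega>. exp_mart l t \<omega> * \<psi> \<omega> \<partial>P) = (\<integral>\<omega>. exp_mart l s \<omega> * \<psi> \<omega> \<partial>P)"
    unfolding eq by (subst pr(2)) (use i in auto)
qed

text \<open>
  Girsanov's theorem for a single increment: weighted with the exponential martingale, the increment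
  has mean \<open>- l (t - s)\<close>, as the tilting of the normal density shows.
\<close>

lemma exp_mart_drift_correction:
  assumes st: "0 \<le> s" "s \<le> t" "t \<le> T"
    and \<xi>: "\<xi> \<in> borel_measurable (\<F> s)" "\<forall>\<omega>\<in>space P. \<bar>\<xi> \<omega>\<bar> \<le> B"
  shows "integrable P (\<lambda>\<omega>. exp_mart l t \<omega> * (\<xi> \<omega> * (l * (t - s) + (W t \<omega> - W s \<omega>))))"
    and "(\<integral>\<omega>. exp_mart l t \<omega> * (\<xi> \<omega> * (l * (t - s) + (W t \<omega> - W s \<omega>))) \<partial>P) = 0"
proof -
  let ?\<phi> = "\<lambda>x. exp (- l\<^sup>2 * (t - s) / 2) * (l * (t - s) * exp (- l * x) + x * exp (- l * x))"
  have meas: "(\<lambda>\<omega>. exp_mart l s \<omega> * \<xi> \<omega>) \<in> borel_measurable (\<F> s)"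
    using exp_mart_F_measurable[of s l] \<xi>(1) st by simp
  have "in_L2 P (\<lambda>\<omega>. \<xi> \<omega> * exp_mart l s \<omega>)"
    by (rule in_L2_bounded_mult[OF F_measurable_P[OF \<xi>(1)] \<xi>(2)])
       (use exp_mart_square_integrable[of s] st in auto)
  from in_L2_imp_integrable[OF finite_measure_axioms this]
  have int: "integrable P (\<lambda>\<omega>. exp_mart l s \<omega> * \<xi> \<omega>)" by (simp add: mult.commute)
  have eq: "exp_mart l t \<omega> * (\<xi> \<omega> * (l * (t - s) + (W t \<omega> - W s \<omega>))) =
      (exp_mart l s \<omega> * \<xi> \<omega>) * ?\<phi> (W t \<omega> - W s \<omega>)" for \<omega>
    by (subst exp_mart_split[of l t \<omega> s]) (simp add: algebra_simps)
  note pr = increment_indep_product[OF st meas int, of ?\<phi>] 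
  have i: "integrable P (\<lambda>\<omega>. ?\<phi> (W t \<omega> - W s \<omega>))" "(\<integral>\<omega>. ?\<phi> (W t \<omega> - W s \<omega>) \<partial>P) = 0"
    using increment_exp_moments(1-4)[OF st, of "-l"] by simp_all
  show "integrable P (\<lambda>\<omega>. exp_mart l t \<omega> * (\<xi> \<omega> * (l * (t - s) + (W t \<omega> - W s \<omega>))))"
    unfolding eq by (rule pr(1)) (use i in auto)
  show "(\<integral>\<omega>. exp_mart l t \<omega> * (\<xi> \<omega> * (l * (t - s) + (W t \<omega> - W s \<omega>))) \<partial>P) = 0"
    unfolding eq by (subst pr(2)) (use i in auto)
qed

end

section \<open>Processes as functions on time times sample space\<close>

text \<open>
  Lebesgue measure lives on the subspace \<open>{0..T}\<close> here, because nothing is known about the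
  measurability of processes outside this interval.
\<close>

definition time_measure :: "real \<Rightarrow> real measure" where
  "time_measure T = restrict_space lborel {0..T}"

lemma space_time_measure [simp]: "space (time_measure T) = {0..T}"
  by (simp add: time_measure_def space_restrict_space)

lemma sets_time_measure [measurable_cong]: "sets (time_measure T) = sets (restrict_space borel {0..T})"
  by (simp add: time_measure_def sets_restrict_space)

lemma measurable_time_measure_of_borel: "f \<in> borel_measurable borel \<Longrightarrow> f \<in> borel_measurable (time_measure T)"
  by (simp add: time_measure_def measurable_restrict_space1)

lemma ident_measurable_time_measure [measurable]: "(\<lambda>t. t) \<in> borel_measurable (time_measure T)"
  by (rule measurable_time_measure_of_borel) simp

lemma continuous_on_measurable_time_measure:
  "continuous_on {0..T} f \<Longrightarrow> f \<in> borel_measurable (time_measure T)" for f :: "real \<Rightarrow> real"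
  using borel_measurable_continuous_on_restrict[of "{0..T}" f]
  by (simp cong: measurable_cong_sets add: sets_time_measure)

lemma finite_measure_time_measure: "finite_measure (time_measure T)"
  by (rule finite_measureI, cases "0 \<le> T") (simp_all add: time_measure_def emeasure_restrict_space space_restrict_space)

lemma measure_time_measure: "T \<ge> 0 \<Longrightarrow> measure (time_measure T) {0..T} = T"
  by (simp add: time_measure_def measure_restrict_space)

lemma nn_integral_time_measure:
  "(\<integral>\<^sup>+s. f s \<partial>time_measure T) = (\<integral>\<^sup>+s\<in>{0..T}. f s \<partial>lborel)"
  by (simp add: time_measure_def nn_integral_restrict_space)

lemma set_integral_time_measure:
  fixes f :: "real \<Rightarrow> real"
  assumes "0 \<le> t" "t \<le> T"
  shows "(LINT s:{0..t}|lborel. f s) = (\<integral>s. indicator {0..t} s * f s \<partial>time_measure T)"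
proof -
  have eq: "indicator {0..T} s * (indicator {0..t} s * f s) = indicator {0..t} s * f s" for s
    using assms by (auto simp: indicator_def)
  show "(LINT s:{0..t}|lborel. f s) = (\<integral>s. indicator {0..t} s * f s \<partial>time_measure T)"
    by (simp add: time_measure_def integral_restrict_space set_lebesgue_integral_def eq)
qed

lemma set_integral_time_measure_full:
  fixes f :: "real \<Rightarrow> real"
  assumes "0 \<le> T"
  shows "(LINT s:{0..T}|lborel. f s) = (\<integral>s. f s \<partial>time_measure T)"
    "set_integrable lborel {0..T} f \<longleftrightarrow> integrable (time_measure T) f"
  by (simp_all add: time_measure_def integral_restrict_space set_lebesgue_integral_def
      integrable_restrict_space set_integrable_def)

lemma continuous_on_integrable_time_measure:
  fixes f :: "real \<Rightarrow> real"
  assumes "continuous_on {0..T} f" "0 \<le> T"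
  shows "integrable (time_measure T) f"
  using borel_integrable_atLeastAtMost'[OF assms(1)] set_integral_time_measure_full(2)[OF assms(2)] by simp

lemma FTC_indicator_Icc:
  fixes F f :: "real \<Rightarrow> real"
  assumes "a \<le> b" "\<And>x. a \<le> x \<Longrightarrow> x \<le> b \<Longrightarrow> (F has_real_derivative f x) (at x within {a..b})"
    and "continuous_on {a..b} f"
  shows "set_integrable lborel {a..b} f" "(LINT x:{a..b}|lborel. f x) = F b - F a"
proof -
  have "has_bochner_integral lborel (\<lambda>x. indicator {a..b} x *\<^sub>R f x) (F b - F a)"
    by (rule has_bochner_integral_FTC_Icc)
      (use assms in \<open>auto simp: has_real_derivative_iff_has_vector_derivative\<close>)
  then show "set_integrable lborel {a..b} f" "(LINT x:{a..b}|lborel. f x) = F b - F a"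
    by (auto simp: set_integrable_def set_lebesgue_integral_def has_bochner_integral_iff)
qed

context usual_filtered_prob_space
begin

abbreviation "Q \<equiv> time_measure T \<Otimes>\<^sub>M P"

lemma sigma_finite_time_measure: "sigma_finite_measure (time_measure T)"
  by (rule finite_measure.axioms(1)[OF finite_measure_time_measure])

sublocale Q: pair_sigma_finite "time_measure T" P
  by (intro pair_sigma_finite.intro sigma_finite_time_measure sigma_finite_measure_axioms)

lemma finite_measure_Q: "finite_measure Q"
  by (intro finite_measure_pair_measure finite_measure_time_measure finite_measure_axioms)

text \<open>
  The process is the pointwise limit of \<open>X\<close> at the times \<open>\<lfloor>n t\<rfloor> / n\<close>. Each approximation involves
  countably many times only, and rounding down does not leave \<open>{0..T}\<close>.
\<close>

lemma continuous_process_measurable: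
  assumes cont: "continuous_paths P T X" and meas: "\<And>t. t \<in> {0..T} \<Longrightarrow> X t \<in> borel_measurable P"
  shows "(\<lambda>(t, \<omega>). X t \<omega>) \<in> borel_measurable Q"
proof (cases "0 \<le> T")
  case False
  have "space Q = {}" using False by (simp add: space_pair_measure)
  then show ?thesis by (simp add: measurable_def sigma_sets.Empty)
next
  case True
  define clamp where "clamp x = max 0 (min T x)" for x
  define X' where "X' n = (\<lambda>(t, \<omega>). X (clamp (real_of_int \<lfloor>t * real (Suc n)\<rfloor> / real (Suc n))) \<omega>)" for n
  have clamp_mem: "clamp x \<in> {0..T}" for x using True by (auto simp: clamp_def)
  have "X' n \<in> borel_measurable Q" for n
  proof -
    have "(\<lambda>x. X (clamp (real_of_int i / real (Suc n))) (snd x)) \<in> borel_measurable Q" for i :: int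
      by (rule measurable_compose[OF measurable_snd meas[OF clamp_mem]])
    from measurable_compose_countable[OF this, of "\<lambda>x. \<lfloor>fst x * real (Suc n)\<rfloor>"]
    show ?thesis by (simp add: X'_def case_prod_unfold)
  qed
  moreover have "(\<lambda>n. X' n x) \<longlonglongrightarrow> (case x of (t, \<omega>) \<Rightarrow> X t \<omega>)" if x: "x \<in> space Q" for x
  proof -
    obtain t \<omega> where [simp]: "x = (t, \<omega>)" by (cases x)
    have t: "0 \<le> t" "t \<le> T" and \<omega>: "\<omega> \<in> space P" using x by (auto simp: space_pair_measure)
    have "(\<lambda>n. real_of_int \<lfloor>t * real (Suc n)\<rfloor> / real (Suc n)) \<longlonglongrightarrow> t"
    proof (rule real_tendsto_sandwich)
      show "\<forall>\<^sub>F n in sequentially. t - 1 / real (Suc n) \<le> real_of_int \<lfloor>t * real (Suc n)\<rfloor> / real (Suc n)"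
      proof (intro always_eventually allI)
        fix n
        have "t * real (Suc n) - 1 \<le> real_of_int \<lfloor>t * real (Suc n)\<rfloor>" by linarith
        then have "(t * real (Suc n) - 1) / real (Suc n) \<le> real_of_int \<lfloor>t * real (Suc n)\<rfloor> / real (Suc n)"
          by (intro divide_right_mono) auto
        then show "t - 1 / real (Suc n) \<le> real_of_int \<lfloor>t * real (Suc n)\<rfloor> / real (Suc n)"
          by (simp add: diff_divide_distrib del: of_nat_Suc)
      qed
      show "\<forall>\<^sub>F n in sequentially. real_of_int \<lfloor>t * real (Suc n)\<rfloor> / real (Suc n) \<le> t"
      proof (intro always_eventually allI)
        fix n
        have "real_of_int \<lfloor>t * real (Suc n)\<rfloor> / real (Suc n) \<le> t * real (Suc n) / real (Suc n)"
          by (intro divide_right_mono) auto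
        then show "real_of_int \<lfloor>t * real (Suc n)\<rfloor> / real (Suc n) \<le> t" by (simp del: of_nat_Suc)
      qed
      show "(\<lambda>n. t - 1 / real (Suc n)) \<longlonglongrightarrow> t"
        using tendsto_diff[OF tendsto_const LIMSEQ_inverse_real_of_nat, of t] by (simp add: inverse_eq_divide)
    qed simp
    then have "(\<lambda>n. clamp (real_of_int \<lfloor>t * real (Suc n)\<rfloor> / real (Suc n))) \<longlonglongrightarrow> clamp t"
      unfolding clamp_def by (intro tendsto_intros)
    moreover have "clamp t = t" using t by (simp add: clamp_def)
    ultimately have "(\<lambda>n. clamp (real_of_int \<lfloor>t * real (Suc n)\<rfloor> / real (Suc n))) \<longlonglongrightarrow> t" by simp
    moreover have "continuous_on {0..T} (\<lambda>t. X t \<omega>)"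
      using cont \<omega> by (auto simp: continuous_paths_def)
    ultimately have "(\<lambda>n. X (clamp (real_of_int \<lfloor>t * real (Suc n)\<rfloor> / real (Suc n))) \<omega>) \<longlonglongrightarrow> X t \<omega>"
      using t clamp_mem by (intro continuous_on_tendsto_compose[of "{0..T}" "\<lambda>t. X t \<omega>" _ t]) auto
    then show ?thesis by (simp add: X'_def)
  qed
  ultimately show ?thesis by (rule borel_measurable_LIMSEQ_real[rotated])
qed

lemma progressive_measurable:
  assumes "progressive \<F> T H" "0 \<le> T"
  shows "(\<lambda>(t, \<omega>). H t \<omega>) \<in> borel_measurable Q"
proof -
  have 1: "(\<lambda>(t, \<omega>). H t \<omega>) \<in> borel_measurable (restrict_space borel {0..T} \<Otimes>\<^sub>M \<F> T)"
    using assms by (auto simp: progressive_def)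
  have "(\<lambda>x. x) \<in> measurable P (\<F> T)"
    using assms(2) filtration_subalgebra[of T] by (auto simp: measurable_def space_F)
  moreover have "(\<lambda>x. x) \<in> measurable (time_measure T) (restrict_space borel {0..T})"
    by (rule measurable_ident_sets) (rule sets_time_measure)
  ultimately have "(\<lambda>x. (fst x, snd x)) \<in> measurable Q (restrict_space borel {0..T} \<Otimes>\<^sub>M \<F> T)"
    by (intro measurable_Pair) (auto intro: measurable_compose[OF measurable_fst] measurable_compose[OF measurable_snd])
  from measurable_compose[OF this 1] show ?thesis by simp
qed

lemma progressive_section:
  assumes "progressive \<F> T H" "t \<in> {0..T}"
  shows "H t \<in> borel_measurable (\<F> t)"
proof -
  have 1: "(\<lambda>(t, \<omega>). H t \<omega>) \<in> borel_measurable (restrict_space borel {0..t} \<Otimes>\<^sub>M \<F> t)"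
    using assms by (auto simp: progressive_def)
  have "Pair t \<in> measurable (\<F> t) (restrict_space borel {0..t} \<Otimes>\<^sub>M \<F> t)"
    by (rule measurable_Pair1') (use assms in \<open>auto simp: space_restrict_space\<close>)
  from measurable_compose[OF this 1] show ?thesis by simp
qed

lemma nn_integral_Q:
  assumes "(\<lambda>(t, \<omega>). f t \<omega>) \<in> borel_measurable Q"
  shows "(\<integral>\<^sup>+\<omega>. (\<integral>\<^sup>+s\<in>{0..T}. f s \<omega> \<partial>lborel) \<partial>P) = (\<integral>\<^sup>+x. (case x of (t, \<omega>) \<Rightarrow> f t \<omega>) \<partial>Q)"
  using Q.nn_integral_snd[OF assms] by (simp add: nn_integral_time_measure)

lemma square_integrable_Q:
  assumes meas: "(\<lambda>(t, \<omega>). H t \<omega>) \<in> borel_measurable Q" and sq: "square_integrable P T H"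
  shows "in_L2 Q (\<lambda>(t, \<omega>). H t \<omega>)"
proof -
  have m2: "(\<lambda>(t, \<omega>). ennreal ((H t \<omega>)\<^sup>2)) \<in> borel_measurable Q"
    using meas by (simp add: case_prod_unfold)
  have "(\<integral>\<^sup>+x. ennreal ((case x of (t, \<omega>) \<Rightarrow> H t \<omega>)\<^sup>2) \<partial>Q) < \<infinity>"
    using sq nn_integral_Q[OF m2] by (simp add: square_integrable_def case_prod_unfold)
  then have "integrable Q (\<lambda>x. (case x of (t, \<omega>) \<Rightarrow> H t \<omega>)\<^sup>2)"
    using meas by (intro integrableI_bounded) auto
  with meas show ?thesis by (simp add: in_L2_def)
qed

lemma in_L2_Q_sections:
  assumes "in_L2 Q (\<lambda>(t, \<omega>). H t \<omega>)"
  shows "AE t in time_measure T. in_L2 P (H t)"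
    and "AE \<omega> in P. in_L2 (time_measure T) (\<lambda>t. H t \<omega>)"
proof -
  note m = in_L2D(1)[OF assms]
  have i: "integrable Q (\<lambda>(t, \<omega>). (H t \<omega>)\<^sup>2)"
    using in_L2D(2)[OF assms] by (simp add: case_prod_unfold)
  have m1: "H t \<in> borel_measurable P" if "t \<in> {0..T}" for t
    using measurable_compose[OF measurable_Pair1'[of t "time_measure T" P] m] that by simp
  have m2: "(\<lambda>t. H t \<omega>) \<in> borel_measurable (time_measure T)" if "\<omega> \<in> space P" for \<omega>
    using measurable_compose[OF measurable_Pair2'[of \<omega> P "time_measure T"] m] that by simp
  show "AE t in time_measure T. in_L2 P (H t)"
    using Q.AE_integrable_fst[OF i] AE_space
    by eventually_elim (use m1 in \<open>auto simp: in_L2_def\<close>)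
  show "AE \<omega> in P. in_L2 (time_measure T) (\<lambda>t. H t \<omega>)"
    using Q.AE_integrable_snd[OF i] AE_space
    by eventually_elim (use m2 in \<open>auto simp: in_L2_def\<close>)
qed

lemma L2norm_Q_sections:
  assumes "in_L2 Q (\<lambda>(t, \<omega>). H t \<omega>)"
  shows "(L2norm Q (\<lambda>(t, \<omega>). H t \<omega>))\<^sup>2 = (\<integral>\<omega>. (\<integral>t. (H t \<omega>)\<^sup>2 \<partial>time_measure T) \<partial>P)"
    and "integrable P (\<lambda>\<omega>. \<integral>t. (H t \<omega>)\<^sup>2 \<partial>time_measure T)"
proof -
  have i: "integrable Q (\<lambda>(t, \<omega>). (H t \<omega>)\<^sup>2)"
    using in_L2D(2)[OF assms] by (simp add: case_prod_unfold)
  show "(L2norm Q (\<lambda>(t, \<omega>). H t \<omega>))\<^sup>2 = (\<integral>\<omega>. (\<integral>t. (H t \<omega>)\<^sup>2 \<partial>time_measure T) \<partial>P)"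
    using Q.integral_snd[OF i] by (simp add: L2norm_power2 case_prod_unfold)
  show "integrable P (\<lambda>\<omega>. \<integral>t. (H t \<omega>)\<^sup>2 \<partial>time_measure T)"
    using Q.integrable_snd[OF i] .
qed

text \<open>
  Cauchy-Schwarz in the time variable, which is where the factor \<open>sqrt T\<close> comes from.
\<close>

lemma time_integral_square_integrable:
  assumes T: "0 \<le> T" and H: "in_L2 Q (\<lambda>(t, \<omega>). H t \<omega>)"
  shows "in_L2 P (\<lambda>\<omega>. \<integral>t. H t \<omega> \<partial>time_measure T)"
    and "L2norm P (\<lambda>\<omega>. \<integral>t. H t \<omega> \<partial>time_measure T) \<le> sqrt T * L2norm Q (\<lambda>(t, \<omega>). H t \<omega>)"
proof -
  let ?I = "\<lambda>\<omega>. \<integral>t. H t \<omega> \<partial>time_measure T"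
  have i1: "integrable Q (\<lambda>(t, \<omega>). H t \<omega>)"
    by (rule in_L2_imp_integrable[OF finite_measure_Q H])
  have meas: "?I \<in> borel_measurable P"
    using Q.integrable_snd[OF i1] by auto
  have le: "AE \<omega> in P. (?I \<omega>)\<^sup>2 \<le> T * (\<integral>t. (H t \<omega>)\<^sup>2 \<partial>time_measure T)"
    using in_L2_Q_sections(2)[OF H]
  proof eventually_elim
    case (elim \<omega>)
    have "\<bar>?I \<omega>\<bar> \<le> sqrt T * L2norm (time_measure T) (\<lambda>t. H t \<omega>)"
      using Cauchy_Schwarz_L2norm[OF in_L2_const(1)[OF finite_measure_time_measure, of T 1] elim]
        in_L2_const(2)[OF finite_measure_time_measure, of T 1] measure_time_measure[OF T]
      by simp
    then have "(?I \<omega>)\<^sup>2 \<le> (sqrt T * L2norm (time_measure T) (\<lambda>t. H t \<omega>))\<^sup>2"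
      by (metis abs_ge_zero power2_abs power_mono)
    then show ?case using T by (simp add: power_mult_distrib L2norm_power2)
  qed
  have ir: "integrable P (\<lambda>\<omega>. T * (\<integral>t. (H t \<omega>)\<^sup>2 \<partial>time_measure T))"
    using L2norm_Q_sections(2)[OF H] by simp
  have il: "integrable P (\<lambda>\<omega>. (?I \<omega>)\<^sup>2)"
    by (rule Bochner_Integration.integrable_bound[OF ir]) (use meas le in auto)
  then show "in_L2 P ?I" using meas by (simp add: in_L2_def)
  have "(L2norm P ?I)\<^sup>2 \<le> (sqrt T * L2norm Q (\<lambda>(t, \<omega>). H t \<omega>))\<^sup>2"
    using integral_mono_AE[OF il ir le] T L2norm_Q_sections(1)[OF H]
    by (simp add: L2norm_power2[of P] power_mult_distrib)
  then show "L2norm P ?I \<le> sqrt T * L2norm Q (\<lambda>(t, \<omega>). H t \<omega>)"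
    by (rule power2_le_imp_le) (use T in auto)
qed

lemma in_L2_Q_of_sections:
  assumes T: "0 \<le> T" and m: "(\<lambda>(t, \<omega>). H t \<omega>) \<in> borel_measurable Q"
    and H: "\<And>t. t \<in> {0..T} \<Longrightarrow> in_L2 P (H t)" "\<And>t. t \<in> {0..T} \<Longrightarrow> L2norm P (H t) \<le> B"
  shows "in_L2 Q (\<lambda>(t, \<omega>). H t \<omega>)" "L2norm Q (\<lambda>(t, \<omega>). H t \<omega>) \<le> sqrt T * B"
proof -
  have B: "0 \<le> B" using order_trans[OF L2norm_nonneg H(2)[of 0]] T by simp
  have m2: "(\<lambda>(t, \<omega>). ennreal ((H t \<omega>)\<^sup>2)) \<in> borel_measurable Q" using m by (simp add: case_prod_unfold)
  have "(\<integral>\<^sup>+x. ennreal ((case x of (t, \<omega>) \<Rightarrow> H t \<omega>)\<^sup>2) \<partial>Q) =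
    (\<integral>\<^sup>+t. (\<integral>\<^sup>+\<omega>. ennreal ((H t \<omega>)\<^sup>2) \<partial>P) \<partial>time_measure T)"
    using nn_integral_fst[OF m2] by (simp add: case_prod_unfold)
  also have "\<dots> \<le> (\<integral>\<^sup>+t. ennreal (B\<^sup>2) \<partial>time_measure T)"
  proof (rule nn_integral_mono)
    fix t assume "t \<in> space (time_measure T)"
    then have t: "t \<in> {0..T}" by simp
    show "(\<integral>\<^sup>+\<omega>. ennreal ((H t \<omega>)\<^sup>2) \<partial>P) \<le> ennreal (B\<^sup>2)"
      using H(2)[OF t] by (simp add: nn_integral_L2norm[OF H(1)[OF t]] ennreal_leI power_mono)
  qed
  also have "\<dots> = ennreal ((sqrt T * B)\<^sup>2)"
    using T by (simp add: time_measure_def emeasure_restrict_space ennreal_mult[symmetric] power_mult_distrib mult.commute)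
  finally have le: "(\<integral>\<^sup>+x. ennreal ((case x of (t, \<omega>) \<Rightarrow> H t \<omega>)\<^sup>2) \<partial>Q) \<le> ennreal ((sqrt T * B)\<^sup>2)" .
  show "in_L2 Q (\<lambda>(t, \<omega>). H t \<omega>)"
    by (rule in_L2I_nn_integral(1)[OF m le]) simp
  show "L2norm Q (\<lambda>(t, \<omega>). H t \<omega>) \<le> sqrt T * B"
    using in_L2I_nn_integral(2)[OF m le] T B by simp
qed

lemma in_L2_Q_const_in_time:
  assumes T: "0 \<le> T" and Y: "in_L2 P Y"
  shows "in_L2 Q (\<lambda>(t, \<omega>). Y \<omega>)" "L2norm Q (\<lambda>(t, \<omega>). Y \<omega>) = sqrt T * L2norm P Y"
proof -
  have m: "(\<lambda>(t, \<omega>). Y \<omega>) \<in> borel_measurable Q"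
    using in_L2D(1)[OF Y] by (simp add: case_prod_unfold)
  have "(\<lambda>(t, \<omega>). ennreal ((Y \<omega>)\<^sup>2)) \<in> borel_measurable Q"
    using in_L2D(1)[OF Y] by (simp add: case_prod_unfold)
  from nn_integral_Q[OF this]
  have "(\<integral>\<^sup>+x. (case x of (t, \<omega>) \<Rightarrow> ennreal ((Y \<omega>)\<^sup>2)) \<partial>Q) = (\<integral>\<^sup>+\<omega>. ennreal ((Y \<omega>)\<^sup>2) * ennreal T \<partial>P)"
    using T by (simp add: nn_integral_cmult)
  also have "\<dots> = ennreal ((L2norm P Y)\<^sup>2) * ennreal T"
    using nn_integral_L2norm[OF Y] in_L2D(1)[OF Y] by (simp add: nn_integral_multc)
  finally have *: "(\<integral>\<^sup>+x. ennreal ((case x of (t, \<omega>) \<Rightarrow> Y \<omega>)\<^sup>2) \<partial>Q) = ennreal ((sqrt T * L2norm P Y)\<^sup>2)"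
    using T by (simp add: case_prod_unfold ennreal_mult[symmetric] power_mult_distrib mult.commute)
  show 1: "in_L2 Q (\<lambda>(t, \<omega>). Y \<omega>)"
    by (rule in_L2I_nn_integral(1)[OF m eq_refl[OF *]]) simp
  have "(L2norm Q (\<lambda>(t, \<omega>). Y \<omega>))\<^sup>2 = (sqrt T * L2norm P Y)\<^sup>2"
    using nn_integral_L2norm[OF 1] * by simp
  then show "L2norm Q (\<lambda>(t, \<omega>). Y \<omega>) = sqrt T * L2norm P Y"
    by (rule power2_eq_imp_eq) (use T in auto)
qed

lemma expectation_time_integral:
  assumes T: "0 \<le> T" and H: "in_L2 Q (\<lambda>(t, \<omega>). H t \<omega>)" and Y: "in_L2 P Y"
  shows "integrable Q (\<lambda>(t, \<omega>). Y \<omega> * H t \<omega>)"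
    and "(\<integral>\<omega>. Y \<omega> * (\<integral>t. H t \<omega> \<partial>time_measure T) \<partial>P) = (\<integral>t. (\<integral>\<omega>. Y \<omega> * H t \<omega> \<partial>P) \<partial>time_measure T)"
proof -
  show i: "integrable Q (\<lambda>(t, \<omega>). Y \<omega> * H t \<omega>)"
    using in_L2_mult[OF in_L2_Q_const_in_time(1)[OF T Y] H] by (simp add: case_prod_unfold)
  show "(\<integral>\<omega>. Y \<omega> * (\<integral>t. H t \<omega> \<partial>time_measure T) \<partial>P) = (\<integral>t. (\<integral>\<omega>. Y \<omega> * H t \<omega> \<partial>P) \<partial>time_measure T)"
    using Q.Fubini_integral[OF i] by simp
qed

end

section \<open>The Ito integral of the remaining time\<close>

lemma set_integral_min:
  fixes a t :: real
  assumes "0 \<le> a" "a \<le> t"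
  shows "(LINT s:{0..t}|lborel. min a s) = a * t - a\<^sup>2 / 2"
proof -
  have cont: "continuous_on {0..t} (\<lambda>s. min a s)" by (intro continuous_intros)
  have "(LINT s:{0..t}|lborel. min a s) = integral {0..t} (\<lambda>s. min a s)"
    by (rule set_borel_integral_eq_integral(2)[OF borel_integrable_atLeastAtMost'[OF cont]])
  also have "\<dots> = integral {0..a} (\<lambda>s. min a s) + integral {a..t} (\<lambda>s. min a s)"
    using assms by (intro Henstock_Kurzweil_Integration.integral_combine[symmetric] integrable_continuous_real cont) auto
  also have "integral {0..a} (\<lambda>s. min a s) = integral {0..a} (\<lambda>s. s)"
    by (rule integral_cong) auto
  also have "\<dots> = a\<^sup>2 / 2" using assms by simp
  also have "integral {a..t} (\<lambda>s. min a s) = integral {a..t} (\<lambda>s. a)"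
    by (rule integral_cong) auto
  also have "\<dots> = a * (t - a)" using assms by simp
  finally show ?thesis by (simp add: algebra_simps power2_eq_square)
qed

lemma has_bochner_integral_indicator_overlap:
  fixes a b c d t :: real
  assumes "0 \<le> a" "b \<le> t"
  shows "has_bochner_integral lborel (\<lambda>s. indicator {0..t} s * (indicator {a<..b} s * indicator {c<..d} s))
    (max 0 (min b d - max a c))"
proof -
  have "(\<lambda>s. indicator {0..t} s * (indicator {a<..b} s * indicator {c<..d} s)) = 
    (indicator {max a c<..min b d} :: real \<Rightarrow> real)"
    using assms by (auto simp: indicator_def fun_eq_iff)
  moreover have "has_bochner_integral lborel (indicator {max a c<..min b d}) (measure lborel {max a c<..min b d})"
    by (rule has_bochner_integral_real_indicator, simp, cases "max a c \<le> min b d") auto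
  moreover have "measure lborel {max a c<..min b d} = max 0 (min b d - max a c)"
    by (cases "max a c \<le> min b d") (auto simp: max_def)
  ultimately show ?thesis by simp
qed

lemma square_sum_minus:
  fixes f :: "nat \<Rightarrow> real"
  shows "((\<Sum>j<m. f j) - c * L)\<^sup>2 = (\<Sum>i<m. \<Sum>j<m. f i * f j) - 2 * c * (\<Sum>j<m. f j * L) + c\<^sup>2 * (L * L)"
proof -
  have "(x - c * L)\<^sup>2 = x * x - 2 * c * (x * L) + c\<^sup>2 * (L * L)" for x
    by (simp add: power2_eq_square algebra_simps)
  from this[of "\<Sum>j<m. f j"] show ?thesis
    by (simp only: sum_product[of f "{..<m}" f "{..<m}"] sum_distrib_right[of f "{..<m}" L])
qed

context brownian
begin

lemma in_L2_Q_restrict_time: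
  assumes "in_L2 Q (\<lambda>(s, \<omega>). H s \<omega>)"
  shows "in_L2 Q (\<lambda>(s, \<omega>). indicator {0..t} s * H s \<omega>)"
proof (rule in_L2_bound(1)[OF in_L2_abs(1)[OF assms]])
  have "(\<lambda>s. indicator {0..t} s :: real) \<in> borel_measurable (time_measure T)"
    by (rule measurable_time_measure_of_borel) simp
  then have "(\<lambda>x. indicator {0..t} (fst x) :: real) \<in> borel_measurable Q"
    by (rule measurable_compose[OF measurable_fst])
  then show "(\<lambda>(s, \<omega>). indicator {0..t} s * H s \<omega>) \<in> borel_measurable Q"
    using in_L2D(1)[OF assms] by (simp add: case_prod_unfold)
  show "AE x in Q. \<bar>case x of (s, \<omega>) \<Rightarrow> indicator {0..t} s * H s \<omega>\<bar> \<le> \<bar>case x of (s, \<omega>) \<Rightarrow> H s \<omega>\<bar>"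
    by (auto simp: indicator_def)
qed

lemma W_square_integrable_Q: 
  shows "in_L2 Q (\<lambda>(t, \<omega>). W t \<omega>)" "L2norm Q (\<lambda>(t, \<omega>). W t \<omega>) \<le> T"
proof -
  have m: "(\<lambda>(t, \<omega>). W t \<omega>) \<in> borel_measurable Q"
    by (rule continuous_process_measurable) (use brownian W_measurable in \<open>auto simp: brownian_motion_def\<close>)
  have "L2norm P (W t) \<le> sqrt T" if "t \<in> {0..T}" for t
    using W_square_integrable(3)[of t] that by (simp add: L2norm_def)
  note sec = in_L2_Q_of_sections[OF less_imp_le[OF T_pos] m _ this]
  show "in_L2 Q (\<lambda>(t, \<omega>). W t \<omega>)" "L2norm Q (\<lambda>(t, \<omega>). W t \<omega>) \<le> T"
    using sec W_square_integrable(1) T_pos by auto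
qed

text \<open>
  This is \<open>\<integral> (T + 1 - s) dW\<^sub>s\<close> over \<open>[0, t]\<close> after integration by parts. The candidate
  investment is a multiple of \<open>T + 1 - s\<close>, so this is the noise in its wealth equation up to a factor.
\<close>

definition ito_remaining :: "real \<Rightarrow> 'a \<Rightarrow> real" where
  "ito_remaining t \<omega> = (T + 1 - t) * W t \<omega> + (LINT s:{0..t}|lborel. W s \<omega>)"

text \<open>
  The antiderivative of the remaining time that vanishes at \<open>0\<close>; for \<open>u \<le> t\<close> it is also the covariance of
  \<open>W u\<close> and \<open>ito_remaining t\<close>.
\<close>

definition remaining_primitive :: "real \<Rightarrow> real" where
  "remaining_primitive u = (T + 1) * u - u\<^sup>2 / 2"

lemma integral_remaining_time:
  assumes "a \<le> b"
  shows "set_integrable lborel {a..b} (\<lambda>s. T + 1 - s)"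
    "(LINT s:{a..b}|lborel. T + 1 - s) = remaining_primitive b - remaining_primitive a"
proof -
  have deriv: "(remaining_primitive has_real_derivative T + 1 - s) (at s within {a..b})" for s
    unfolding remaining_primitive_def[abs_def] by (auto intro!: derivative_eq_intros)
  have cont: "continuous_on {a..b} (\<lambda>s. T + 1 - s)" by (intro continuous_intros)
  show "set_integrable lborel {a..b} (\<lambda>s. T + 1 - s)"
    "(LINT s:{a..b}|lborel. T + 1 - s) = remaining_primitive b - remaining_primitive a"
    using FTC_indicator_Icc[OF assms deriv cont] by blast+
qed

lemma ito_remaining_square_integrable:
  assumes "0 \<le> t" "t \<le> T"
  shows "in_L2 P (ito_remaining t)"
proof -
  have "in_L2 P (\<lambda>\<omega>. \<integral>s. indicator {0..t} s * W s \<omega> \<partial>time_measure T)"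
    by (rule time_integral_square_integrable(1)) (use T_pos in_L2_Q_restrict_time[OF W_square_integrable_Q(1)] in auto)
  from in_L2_add(1)[OF in_L2_cmult(1)[OF W_square_integrable(1)[OF assms]] this]
  show ?thesis
    unfolding ito_remaining_def set_integral_time_measure[OF assms] .
qed

text \<open>
  By Fubini every covariance with \<open>ito_remaining t\<close> is obtained from covariances with \<open>W\<close>; this is used
  for weighted increments, for \<open>W s\<close> and for \<open>ito_remaining t\<close> itself.
\<close>

lemma expectation_ito_remaining:
  assumes t: "0 \<le> t" "t \<le> T" and \<Phi>: "in_L2 P \<Phi>"
  shows "(\<integral>\<omega>. \<Phi> \<omega> * ito_remaining t \<omega> \<partial>P) =
    (T + 1 - t) * (\<integral>\<omega>. \<Phi> \<omega> * W t \<omega> \<partial>P) + (LINT s:{0..t}|lborel. (\<integral>\<omega>. \<Phi> \<omega> * W s \<omega> \<partial>P))"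
proof -
  let ?H = "\<lambda>s \<omega>. indicator {0..t} s * W s \<omega>"
  have H: "in_L2 Q (\<lambda>(s, \<omega>). ?H s \<omega>)"
    by (rule in_L2_Q_restrict_time[OF W_square_integrable_Q(1)])
  have 1: "integrable P (\<lambda>\<omega>. \<Phi> \<omega> * W t \<omega>)"
    by (rule in_L2_mult[OF \<Phi> W_square_integrable(1)[OF t]])
  have 2: "integrable P (\<lambda>\<omega>. \<Phi> \<omega> * (\<integral>s. ?H s \<omega> \<partial>time_measure T))"
    by (rule in_L2_mult[OF \<Phi> time_integral_square_integrable(1)[OF less_imp_le[OF T_pos] H]])
  have "(\<integral>\<omega>. \<Phi> \<omega> * ito_remaining t \<omega> \<partial>P) =
     (\<integral>\<omega>. (T + 1 - t) * (\<Phi> \<omega> * W t \<omega>) + \<Phi> \<omega> * (\<integral>s. ?H s \<omega> \<partial>time_measure T) \<partial>P)"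
    unfolding ito_remaining_def set_integral_time_measure[OF t] by (simp add: algebra_simps)
  also have "\<dots> = (T + 1 - t) * (\<integral>\<omega>. \<Phi> \<omega> * W t \<omega> \<partial>P) + (\<integral>\<omega>. \<Phi> \<omega> * (\<integral>s. ?H s \<omega> \<partial>time_measure T) \<partial>P)"
    using 1 2 by simp
  also have "(\<integral>\<omega>. \<Phi> \<omega> * (\<integral>s. ?H s \<omega> \<partial>time_measure T) \<partial>P) =
     (\<integral>s. (\<integral>\<omega>. \<Phi> \<omega> * ?H s \<omega> \<partial>P) \<partial>time_measure T)"
    by (rule expectation_time_integral(2)[OF less_imp_le[OF T_pos] H \<Phi>])
  also have "\<dots> = (\<integral>s. indicator {0..t} s * (\<integral>\<omega>. \<Phi> \<omega> * W s \<omega> \<partial>P) \<partial>time_measure T)"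
    by (intro Bochner_Integration.integral_cong refl) (subst mult.left_commute, simp)
  finally show ?thesis by (simp add: set_integral_time_measure[OF t])
qed

lemma expectation_weighted_increment_W:
  assumes ab: "0 \<le> a" "a \<le> b" "b \<le> T" and s: "0 \<le> s" "s \<le> T"
    and \<xi>: "a < b \<Longrightarrow> \<xi> \<in> borel_measurable (\<F> a)" "\<xi> \<in> borel_measurable P" "\<forall>\<omega>\<in>space P. \<bar>\<xi> \<omega>\<bar> \<le> B"
  shows "(\<integral>\<omega>. (\<xi> \<omega> * (W b \<omega> - W a \<omega>)) * W s \<omega> \<partial>P) = (\<integral>\<omega>. \<xi> \<omega> \<partial>P) * (min b s - min a s)"
proof -
  have "(\<integral>\<omega>. (\<xi> \<omega> * (W b \<omega> - W a \<omega>)) * W s \<omega> \<partial>P) =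
      (\<integral>\<omega>. (\<xi> \<omega> * (W b \<omega> - W a \<omega>)) * (1 * (W s \<omega> - W 0 \<omega>)) \<partial>P)"
    by (rule integral_cong_AE)
      (use W_0 \<xi>(2) ab s increment_measurable[of a b] increment_measurable[of 0 s] W_measurable[of s] in auto)
  also have "\<dots> = (\<integral>\<omega>. \<xi> \<omega> * 1 \<partial>P) * max 0 (min b s - max a 0)"
    by (rule weighted_increments_correlation[where ?B1.0 = B and ?B2.0 = 1]) (use ab s \<xi> in auto)
  also have "max 0 (min b s - max a 0) = min b s - min a s" using ab s by auto
  finally show ?thesis by simp
qed

lemma weighted_increment_square_integrable:
  assumes "0 \<le> a" "a \<le> b" "b \<le> T" "\<xi> \<in> borel_measurable P" "\<forall>\<omega>\<in>space P. \<bar>\<xi> \<omega>\<bar> \<le> B"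
  shows "in_L2 P (\<lambda>\<omega>. \<xi> \<omega> * (W b \<omega> - W a \<omega>))"
  by (rule in_L2_bounded_mult[OF assms(4,5) increment_moments(1)[OF assms(1-3)]])

lemma expectation_weighted_increment_ito_remaining:
  assumes ab: "0 \<le> a" "a \<le> b" "b \<le> t" and t: "t \<le> T"
    and \<xi>: "a < b \<Longrightarrow> \<xi> \<in> borel_measurable (\<F> a)" "\<xi> \<in> borel_measurable P" "\<forall>\<omega>\<in>space P. \<bar>\<xi> \<omega>\<bar> \<le> B"
  shows "(\<integral>\<omega>. (\<xi> \<omega> * (W b \<omega> - W a \<omega>)) * ito_remaining t \<omega> \<partial>P) =
    (\<integral>\<omega>. \<xi> \<omega> \<partial>P) * (remaining_primitive b - remaining_primitive a)"
proof -
  have 0: "0 \<le> t" "b \<le> T" using ab t by auto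
  note corr = expectation_weighted_increment_W[OF ab(1,2) 0(2) _ _ \<xi>]
  have si: "set_integrable lborel {0..t} (\<lambda>s. min x s)" for x :: real
    by (intro borel_integrable_atLeastAtMost' continuous_intros)
  have "(\<integral>\<omega>. (\<xi> \<omega> * (W b \<omega> - W a \<omega>)) * ito_remaining t \<omega> \<partial>P) =
    (T + 1 - t) * ((\<integral>\<omega>. \<xi> \<omega> \<partial>P) * (min b t - min a t)) +
    (LINT s:{0..t}|lborel. (\<integral>\<omega>. (\<xi> \<omega> * (W b \<omega> - W a \<omega>)) * W s \<omega> \<partial>P))"
    using expectation_ito_remaining[OF 0(1) t weighted_increment_square_integrable[OF ab(1,2) 0(2) \<xi>(2,3)]]
      corr[of t] 0 t by simp
  also have "(LINT s:{0..t}|lborel. (\<integral>\<omega>. (\<xi> \<omega> * (W b \<omega> - W a \<omega>)) * W s \<omega> \<partial>P)) =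
    (LINT s:{0..t}|lborel. (\<integral>\<omega>. \<xi> \<omega> \<partial>P) * (min b s - min a s))"
    by (rule set_lebesgue_integral_cong) (use corr t in auto)
  also have "\<dots> = (\<integral>\<omega>. \<xi> \<omega> \<partial>P) * ((b * t - b\<^sup>2 / 2) - (a * t - a\<^sup>2 / 2))"
    using si[of a] si[of b] set_integral_min[of a t] set_integral_min[of b t] ab by simp
  finally show ?thesis
    using ab by (simp add: remaining_primitive_def algebra_simps)
qed

lemma expectation_ito_remaining_square:
  assumes t: "0 \<le> t" "t \<le> T"
  shows "(\<integral>\<omega>. ito_remaining t \<omega> * ito_remaining t \<omega> \<partial>P) = (LINT s:{0..t}|lborel. (T + 1 - s)\<^sup>2)"
proof -
  have WL: "(\<integral>\<omega>. ito_remaining t \<omega> * W s \<omega> \<partial>P) = remaining_primitive s" if s: "0 \<le> s" "s \<le> t" for s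
  proof -
    have "(\<integral>\<omega>. ito_remaining t \<omega> * W s \<omega> \<partial>P) = (\<integral>\<omega>. (1 * (W s \<omega> - W 0 \<omega>)) * ito_remaining t \<omega> \<partial>P)"
      by (rule integral_cong_AE)
        (use W_0 s t in_L2D(1)[OF ito_remaining_square_integrable[OF t]]
          increment_measurable[of 0 s] W_measurable[of s] in auto)
    also have "\<dots> = (\<integral>\<omega>. 1 \<partial>P) * (remaining_primitive s - remaining_primitive 0)"
      by (rule expectation_weighted_increment_ito_remaining[where B = 1]) (use s t in auto)
    finally show ?thesis by (simp add: remaining_primitive_def prob_space)
  qed
  have "(\<integral>\<omega>. ito_remaining t \<omega> * ito_remaining t \<omega> \<partial>P) =
    (T + 1 - t) * remaining_primitive t + (LINT s:{0..t}|lborel. (\<integral>\<omega>. ito_remaining t \<omega> * W s \<omega> \<partial>P))"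
    using expectation_ito_remaining[OF t ito_remaining_square_integrable[OF t]] WL[of t] t by simp
  also have "(LINT s:{0..t}|lborel. (\<integral>\<omega>. ito_remaining t \<omega> * W s \<omega> \<partial>P)) = (LINT s:{0..t}|lborel. remaining_primitive s)"
    by (rule set_lebesgue_integral_cong) (use WL in auto)
  also have "\<dots> = (T + 1) * t\<^sup>2 / 2 - t ^ 3 / 6"
    by (subst FTC_indicator_Icc(2)[where F = "\<lambda>s. (T + 1) * s\<^sup>2 / 2 - s ^ 3 / 6"])
      (use t in \<open>auto simp: remaining_primitive_def power2_eq_square power3_eq_cube
         intro!: derivative_eq_intros continuous_intros\<close>)
  also have "(T + 1 - t) * remaining_primitive t + ((T + 1) * t\<^sup>2 / 2 - t ^ 3 / 6) =
     (- ((T + 1 - t) ^ 3 / 3)) - (- ((T + 1 - 0) ^ 3 / 3))"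
    by (simp add: remaining_primitive_def field_simps power2_eq_square power3_eq_cube)
  also have "\<dots> = (LINT s:{0..t}|lborel. (T + 1 - s)\<^sup>2)"
    by (subst FTC_indicator_Icc(2)[where F = "\<lambda>s. - ((T + 1 - s) ^ 3 / 3)"])
      (use t in \<open>auto intro!: derivative_eq_intros continuous_intros\<close>)
  finally show ?thesis .
qed

text \<open>
  The Ito isometry for the integrand \<open>h - c (T + 1 - s)\<close> with \<open>h\<close> elementary. Both sides are expanded, and
  each covariance on the left is the integral over \<open>[0, t]\<close> of the product of the integrands on the
  right. The inequality is due to the time interval \<open>[t, T]\<close>, which counts on the right only.
\<close>

lemma elementary_process_deviation:
  assumes data: "elementary_data P \<F> T m \<tau> \<xi>" and t: "0 \<le> t" "t \<le> T"
  shows "in_L2 P (elementary_integral W m \<tau> \<xi> t)"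
    and "(\<integral>\<^sup>+\<omega>. ennreal ((elementary_integral W m \<tau> \<xi> t \<omega> - c * ito_remaining t \<omega>)\<^sup>2) \<partial>P) \<le>
      (\<integral>\<^sup>+\<omega>. (\<integral>\<^sup>+s\<in>{0..T}. ennreal ((elementary_process m \<tau> \<xi> s \<omega> - c * (T + 1 - s))\<^sup>2) \<partial>lborel) \<partial>P)"
proof -
  define a b where "a j = min (\<tau> j) t" and "b j = min (\<tau> (Suc j)) t" for j
  define ov where "ov i j = max 0 (min (b i) (b j) - max (a i) (a j))" for i j
  define r where "r j = remaining_primitive (b j) - remaining_primitive (a j)" for j
  define R where "R = (LINT s:{0..t}|lborel. (T + 1 - s)\<^sup>2)"
  let ?S = "elementary_integral W m \<tau> \<xi> t" and ?L = "ito_remaining t"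
  let ?D = "\<lambda>j \<omega>. \<xi> j \<omega> * (W (b j) \<omega> - W (a j) \<omega>)"
  have tau: "0 \<le> \<tau> j" "\<tau> j \<le> T" if "j \<le> m" for j
    using data that by (auto simp: elementary_data_def)
  have ab: "0 \<le> a j" "a j \<le> b j" "b j \<le> t" "b j \<le> T" if "j < m" for j
    using data that t by (auto simp: elementary_data_def a_def b_def min_def)
  have \<xi>F: "\<xi> j \<in> borel_measurable (\<F> (a j))" if "j < m" "a j < b j" for j
    using data that by (auto simp: elementary_data_def a_def b_def min_def split: if_splits)
  have \<xi>P: "\<xi> j \<in> borel_measurable P" if "j < m" for j
    using data that tau[of j] by (auto simp: elementary_data_def intro!: F_measurable_P[of _ "\<tau> j"])
  have "\<forall>j. \<exists>c. j < m \<longrightarrow> (\<forall>\<omega>\<in>space P. \<bar>\<xi> j \<omega>\<bar> \<le> c)"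
    using data by (auto simp: elementary_data_def)
  then obtain B where B: "\<forall>\<omega>\<in>space P. \<bar>\<xi> j \<omega>\<bar> \<le> B j" if "j < m" for j
    by metis
  have \<xi>i: "integrable P (\<xi> j)" if "j < m" for j
    by (rule integrable_const_bound[of _ "B j"]) (use \<xi>P B that in auto)
  have \<xi>\<xi>i: "integrable P (\<lambda>\<omega>. \<xi> i \<omega> * \<xi> j \<omega>)" if "i < m" "j < m" for i j
  proof -
    have "in_L2 P (\<xi> k)" if "k < m" for k
      using in_L2_bounded_mult[OF \<xi>P[OF that] B[OF that] in_L2_const(1)[OF finite_measure_axioms, of 1]] by simp
    then show ?thesis using that by (intro in_L2_mult) auto
  qed
  have S_eq: "?S \<omega> = (\<Sum>j<m. ?D j \<omega>)" for \<omega>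
    by (simp add: elementary_integral_def a_def b_def)
  have Dsq: "in_L2 P (?D j)" if "j < m" for j
    by (rule weighted_increment_square_integrable[where B = "B j"]) (use ab \<xi>P B that in auto)
  show S: "in_L2 P ?S"
    using in_L2_sum[of "{..<m}" P ?D] Dsq unfolding S_eq[abs_def] by simp
  have L: "in_L2 P ?L" by (rule ito_remaining_square_integrable[OF t])

  have DD: "(\<integral>\<omega>. ?D i \<omega> * ?D j \<omega> \<partial>P) = (\<integral>\<omega>. \<xi> i \<omega> * \<xi> j \<omega> \<partial>P) * ov i j" if "i < m" "j < m" for i j
    unfolding ov_def
    by (rule weighted_increments_correlation[where ?B1.0 = "B i" and ?B2.0 = "B j"]) (use ab \<xi>F B that in auto)
  have DL: "(\<integral>\<omega>. ?D j \<omega> * ?L \<omega> \<partial>P) = (\<integral>\<omega>. \<xi> j \<omega> \<partial>P) * r j" if "j < m" for j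
    unfolding r_def
    by (rule expectation_weighted_increment_ito_remaining[where B = "B j"]) (use ab \<xi>F \<xi>P B t that in auto)
  \<comment> \<open>The expectation of the squared distance; \<open>K\<close> below is the same expression before taking expectations
    of the coefficients, and equals the time integral for each outcome.\<close>
  have "(\<integral>\<omega>. (?S \<omega> - c * ?L \<omega>)\<^sup>2 \<partial>P) = (\<integral>\<omega>. (\<Sum>i<m. \<Sum>j<m. ?D i \<omega> * ?D j \<omega>) - 2 * c * (\<Sum>j<m. ?D j \<omega> * ?L \<omega>)
      + c\<^sup>2 * (?L \<omega> * ?L \<omega>) \<partial>P)"
    unfolding S_eq square_sum_minus ..
  also have "\<dots> = (\<Sum>i<m. \<Sum>j<m. (\<integral>\<omega>. \<xi> i \<omega> * \<xi> j \<omega> \<partial>P) * ov i j) - 2 * c * (\<Sum>j<m. (\<integral>\<omega>. \<xi> j \<omega> \<partial>P) * r j) + c\<^sup>2 * R"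
  proof (rule has_bochner_integral_integral_eq)
    have 1: "has_bochner_integral P (\<lambda>\<omega>. ?D i \<omega> * ?D j \<omega>) ((\<integral>\<omega>. \<xi> i \<omega> * \<xi> j \<omega> \<partial>P) * ov i j)"
      if "i < m" "j < m" for i j
      using in_L2_mult[OF Dsq Dsq, OF that] DD[OF that] by (simp add: has_bochner_integral_iff)
    have 2: "has_bochner_integral P (\<lambda>\<omega>. ?D j \<omega> * ?L \<omega>) ((\<integral>\<omega>. \<xi> j \<omega> \<partial>P) * r j)" if "j < m" for j
      using in_L2_mult[OF Dsq L, OF that] DL[OF that] by (simp add: has_bochner_integral_iff)
    have 3: "has_bochner_integral P (\<lambda>\<omega>. ?L \<omega> * ?L \<omega>) R"
      using in_L2_mult[OF L L] expectation_ito_remaining_square[OF t]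
      by (simp add: has_bochner_integral_iff R_def)
    show "has_bochner_integral P (\<lambda>\<omega>. (\<Sum>i<m. \<Sum>j<m. ?D i \<omega> * ?D j \<omega>) - 2 * c * (\<Sum>j<m. ?D j \<omega> * ?L \<omega>)
      + c\<^sup>2 * (?L \<omega> * ?L \<omega>))
     ((\<Sum>i<m. \<Sum>j<m. (\<integral>\<omega>. \<xi> i \<omega> * \<xi> j \<omega> \<partial>P) * ov i j) - 2 * c * (\<Sum>j<m. (\<integral>\<omega>. \<xi> j \<omega> \<partial>P) * r j) + c\<^sup>2 * R)"
      by (intro has_bochner_integral_add has_bochner_integral_diff has_bochner_integral_sum
          has_bochner_integral_mult_right 1 2 3) auto
  qed
  finally have ES: "(\<integral>\<omega>. (?S \<omega> - c * ?L \<omega>)\<^sup>2 \<partial>P) = \<dots>" .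

  define K where "K \<omega> = (\<Sum>i<m. \<Sum>j<m. \<xi> i \<omega> * \<xi> j \<omega> * ov i j) - 2 * c * (\<Sum>j<m. \<xi> j \<omega> * r j) + c\<^sup>2 * R" for \<omega>
  have "has_bochner_integral P K ((\<Sum>i<m. \<Sum>j<m. (\<integral>\<omega>. \<xi> i \<omega> * \<xi> j \<omega> \<partial>P) * ov i j)
     - 2 * c * (\<Sum>j<m. (\<integral>\<omega>. \<xi> j \<omega> \<partial>P) * r j) + c\<^sup>2 * R)"
  proof -
    have 1: "has_bochner_integral P (\<xi> j) (\<integral>\<omega>. \<xi> j \<omega> \<partial>P)" if "j < m" for j
      using \<xi>i[OF that] by (simp add: has_bochner_integral_iff)
    have 2: "has_bochner_integral P (\<lambda>\<omega>. \<xi> i \<omega> * \<xi> j \<omega>) (\<integral>\<omega>. \<xi> i \<omega> * \<xi> j \<omega> \<partial>P)" if "i < m" "j < m" for i j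
      using \<xi>\<xi>i[OF that] by (simp add: has_bochner_integral_iff)
    have 3: "has_bochner_integral P (\<lambda>\<omega>. c\<^sup>2 * R) (c\<^sup>2 * R)"
      by (simp add: has_bochner_integral_iff prob_space)
    show ?thesis unfolding K_def[abs_def]
      by (intro has_bochner_integral_add has_bochner_integral_diff has_bochner_integral_sum
          has_bochner_integral_mult_right has_bochner_integral_mult_left 1 2 3) auto
  qed
  then have Ki: "integrable P K" and EK: "(\<integral>\<omega>. K \<omega> \<partial>P) = (\<integral>\<omega>. (?S \<omega> - c * ?L \<omega>)\<^sup>2 \<partial>P)"
    unfolding ES by (auto simp: has_bochner_integral_iff)
  let ?p = "\<lambda>s \<omega>. elementary_process m \<tau> \<xi> s \<omega> - c * (T + 1 - s)"
  let ?ind = "\<lambda>j s. indicator {a j<..b j} s :: real" and ?I = "\<lambda>s. indicator {0..t} s :: real"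
  have HK: "has_bochner_integral lborel (\<lambda>s. ?I s * (?p s \<omega>)\<^sup>2) (K \<omega>)" for \<omega>
  proof -
    have 1: "has_bochner_integral lborel (\<lambda>s. ?I s * (?ind i s * ?ind j s)) (ov i j)" if "i < m" for i j
      unfolding ov_def by (rule has_bochner_integral_indicator_overlap) (use ab that in auto)
    have 2: "has_bochner_integral lborel (\<lambda>s. ?I s * (?ind j s * (T + 1 - s))) (r j)" if "j < m" for j
    proof -
      have "set_integrable lborel {a j..b j} (\<lambda>s. T + 1 - s)" "(LINT s:{a j..b j}|lborel. T + 1 - s) = r j"
        unfolding r_def by (rule integral_remaining_time[OF ab(2)[OF that]])+
      then have "has_bochner_integral lborel (\<lambda>s. indicator {a j..b j} s *\<^sub>R (T + 1 - s)) (r j)"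
        by (simp add: has_bochner_integral_iff set_integrable_def set_lebesgue_integral_def)
      moreover have "AE s in lborel. indicator {a j..b j} s *\<^sub>R (T + 1 - s) = ?I s * (?ind j s * (T + 1 - s))"
        using AE_lborel_singleton[of "a j"]
        by eventually_elim (use ab[OF that] in \<open>auto simp: indicator_def\<close>)
      ultimately show ?thesis
        by (subst (asm) has_bochner_integral_cong_AE) auto
    qed
    have 3: "has_bochner_integral lborel (\<lambda>s. ?I s * (T + 1 - s)\<^sup>2) R"
    proof -
      have "set_integrable lborel {0..t} (\<lambda>s. (T + 1 - s)\<^sup>2)"
        by (intro borel_integrable_atLeastAtMost' continuous_intros)
      then show ?thesis
        by (simp add: R_def has_bochner_integral_iff set_integrable_def set_lebesgue_integral_def)
    qed
    have "has_bochner_integral lborel (\<lambda>s. (\<Sum>i<m. \<Sum>j<m. \<xi> i \<omega> * \<xi> j \<omega> * (?I s * (?ind i s * ?ind j s)))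
       - 2 * c * (\<Sum>j<m. \<xi> j \<omega> * (?I s * (?ind j s * (T + 1 - s)))) + c\<^sup>2 * (?I s * (T + 1 - s)\<^sup>2)) (K \<omega>)"
      unfolding K_def
      by (intro has_bochner_integral_add has_bochner_integral_diff has_bochner_integral_sum
          has_bochner_integral_mult_right 1 2 3) auto
    moreover have "(\<Sum>i<m. \<Sum>j<m. \<xi> i \<omega> * \<xi> j \<omega> * (?I s * (?ind i s * ?ind j s)))
       - 2 * c * (\<Sum>j<m. \<xi> j \<omega> * (?I s * (?ind j s * (T + 1 - s)))) + c\<^sup>2 * (?I s * (T + 1 - s)\<^sup>2) =
       ?I s * (?p s \<omega>)\<^sup>2" for s
    proof (cases "s \<in> {0..t}")
      case True
      have "indicator {\<tau> j<..\<tau> (Suc j)} s = ?ind j s" for j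
        using True by (auto simp: indicator_def a_def b_def)
      then have "?p s \<omega> = (\<Sum>j<m. \<xi> j \<omega> * ?ind j s) - c * (T + 1 - s)"
        by (simp add: elementary_process_def)
      then have "(?p s \<omega>)\<^sup>2 = (\<Sum>i<m. \<Sum>j<m. (\<xi> i \<omega> * ?ind i s) * (\<xi> j \<omega> * ?ind j s))
         - 2 * c * (\<Sum>j<m. (\<xi> j \<omega> * ?ind j s) * (T + 1 - s)) + c\<^sup>2 * ((T + 1 - s) * (T + 1 - s))"
        by (simp only: square_sum_minus)
      then show ?thesis
        using True by (simp add: power2_eq_square[of "1 + T - s"] ac_simps)
    qed simp
    ultimately show ?thesis by simp
  qed
  have K_nn: "ennreal (K \<omega>) = (\<integral>\<^sup>+s\<in>{0..t}. ennreal ((?p s \<omega>)\<^sup>2) \<partial>lborel)" for \<omega>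
  proof -
    have "(\<integral>\<^sup>+s. ennreal (?I s * (?p s \<omega>)\<^sup>2) \<partial>lborel) = ennreal (K \<omega>)"
      using HK[of \<omega>] nn_integral_eq_integral[of lborel "\<lambda>s. ?I s * (?p s \<omega>)\<^sup>2"] by (auto simp: has_bochner_integral_iff)
    moreover have "(\<integral>\<^sup>+s. ennreal (?I s * (?p s \<omega>)\<^sup>2) \<partial>lborel) = (\<integral>\<^sup>+s\<in>{0..t}. ennreal ((?p s \<omega>)\<^sup>2) \<partial>lborel)"
      by (intro nn_integral_cong) (auto simp: indicator_def)
    ultimately show ?thesis by simp
  qed
  have K0: "0 \<le> K \<omega>" for \<omega>
  proof -
    have "K \<omega> = (\<integral>s. ?I s * (?p s \<omega>)\<^sup>2 \<partial>lborel)"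
      using HK[of \<omega>] by (simp add: has_bochner_integral_iff)
    also have "0 \<le> \<dots>" by simp
    finally show ?thesis .
  qed
  have "(\<integral>\<^sup>+\<omega>. ennreal ((?S \<omega> - c * ?L \<omega>)\<^sup>2) \<partial>P) = ennreal (\<integral>\<omega>. (?S \<omega> - c * ?L \<omega>)\<^sup>2 \<partial>P)"
    using in_L2_diff[OF S in_L2_cmult(1)[OF L, of c]]
    by (intro nn_integral_eq_integral) (auto simp: in_L2_def)
  also have "\<dots> = (\<integral>\<^sup>+\<omega>. ennreal (K \<omega>) \<partial>P)"
    using nn_integral_eq_integral[OF Ki] K0 EK by simp
  also have "\<dots> \<le> (\<integral>\<^sup>+\<omega>. (\<integral>\<^sup>+s\<in>{0..T}. ennreal ((?p s \<omega>)\<^sup>2) \<partial>lborel) \<partial>P)"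
    unfolding K_nn by (intro nn_integral_mono) (use t in \<open>auto simp: indicator_def\<close>)
  finally show "(\<integral>\<^sup>+\<omega>. ennreal ((?S \<omega> - c * ?L \<omega>)\<^sup>2) \<partial>P) \<le>
      (\<integral>\<^sup>+\<omega>. (\<integral>\<^sup>+s\<in>{0..T}. ennreal ((?p s \<omega>)\<^sup>2) \<partial>lborel) \<partial>P)" .
qed

text \<open>
  Both sides are \<open>L\<^sup>2\<close> limits of the same elementary integrals.
\<close>

theorem ito_integral_remaining_time:
  assumes ito: "ito_integral P \<F> T W (\<lambda>t \<omega>. c * (T + 1 - t)) I" and t: "0 \<le> t" "t \<le> T"
  shows "AE \<omega> in P. I t \<omega> = c * ito_remaining t \<omega>"
proof -
  let ?H = "\<lambda>t \<omega>::'a. c * (T + 1 - t)" and ?L = "\<lambda>\<omega>. c * ito_remaining t \<omega>"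
  from ito obtain m \<tau> \<xi> where data: "\<And>l. elementary_data P \<F> T (m l) (\<tau> l) (\<xi> l)"
    and lim1: "(\<lambda>l. \<integral>\<^sup>+\<omega>. (\<integral>\<^sup>+s\<in>{0..T}.
            ennreal ((elementary_process (m l) (\<tau> l) (\<xi> l) s \<omega> - ?H s \<omega>)\<^sup>2) \<partial>lborel) \<partial>P) \<longlonglongrightarrow> 0"
    and lim2: "(\<lambda>l. \<integral>\<^sup>+\<omega>. ennreal ((elementary_integral W (m l) (\<tau> l) (\<xi> l) t \<omega> - I t \<omega>)\<^sup>2) \<partial>P) \<longlonglongrightarrow> 0"
    using t by (fastforce simp: ito_integral_def)
  let ?S = "\<lambda>l. elementary_integral W (m l) (\<tau> l) (\<xi> l) t"
  have I: "I t \<in> borel_measurable P"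
    using ito t by (auto simp: ito_integral_def adapted_def intro!: F_measurable_P[of _ t])
  have L: "?L \<in> borel_measurable P"
    using in_L2D(1)[OF ito_remaining_square_integrable[OF t]] by simp
  have S: "?S l \<in> borel_measurable P" for l
    using in_L2D(1)[OF elementary_process_deviation(1)[OF data t]] .
  have lim3: "(\<lambda>l. \<integral>\<^sup>+\<omega>. ennreal ((?S l \<omega> - ?L \<omega>)\<^sup>2) \<partial>P) \<longlonglongrightarrow> 0"
    by (rule tendsto_sandwich[OF _ _ tendsto_const lim1])
       (use elementary_process_deviation(2)[OF data t, where c = c] in auto)
  have bound: "(\<integral>\<^sup>+\<omega>. ennreal ((I t \<omega> - ?L \<omega>)\<^sup>2) \<partial>P) \<le>
     2 * (\<integral>\<^sup>+\<omega>. ennreal ((?S l \<omega> - I t \<omega>)\<^sup>2) \<partial>P) + 2 * (\<integral>\<^sup>+\<omega>. ennreal ((?S l \<omega> - ?L \<omega>)\<^sup>2) \<partial>P)" for l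
  proof -
    have "(\<integral>\<^sup>+\<omega>. ennreal ((I t \<omega> - ?L \<omega>)\<^sup>2) \<partial>P) \<le>
       (\<integral>\<^sup>+\<omega>. 2 * ennreal ((?S l \<omega> - I t \<omega>)\<^sup>2) + 2 * ennreal ((?S l \<omega> - ?L \<omega>)\<^sup>2) \<partial>P)"
    proof (rule nn_integral_mono)
      fix \<omega>
      have "(x - y)\<^sup>2 \<le> 2 * (z - x)\<^sup>2 + 2 * (z - y)\<^sup>2" for x y z :: real
        using sum_squares_ge_zero[of "(z - x) + (z - y)" 0] by (simp add: power2_eq_square algebra_simps)
      then have "ennreal ((I t \<omega> - ?L \<omega>)\<^sup>2) \<le> ennreal (2 * (?S l \<omega> - I t \<omega>)\<^sup>2 + 2 * (?S l \<omega> - ?L \<omega>)\<^sup>2)"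
        by (intro ennreal_leI) blast
      then show "ennreal ((I t \<omega> - ?L \<omega>)\<^sup>2) \<le> 2 * ennreal ((?S l \<omega> - I t \<omega>)\<^sup>2) + 2 * ennreal ((?S l \<omega> - ?L \<omega>)\<^sup>2)"
        by (simp add: ennreal_mult)
    qed
    also have "\<dots> = 2 * (\<integral>\<^sup>+\<omega>. ennreal ((?S l \<omega> - I t \<omega>)\<^sup>2) \<partial>P) + 2 * (\<integral>\<^sup>+\<omega>. ennreal ((?S l \<omega> - ?L \<omega>)\<^sup>2) \<partial>P)"
      using I L S by (simp add: nn_integral_add nn_integral_cmult)
    finally show ?thesis .
  qed
  have "(\<lambda>l. 2 * (\<integral>\<^sup>+\<omega>. ennreal ((?S l \<omega> - I t \<omega>)\<^sup>2) \<partial>P) + 2 * (\<integral>\<^sup>+\<omega>. ennreal ((?S l \<omega> - ?L \<omega>)\<^sup>2) \<partial>P)) \<longlonglongrightarrow> 2 * 0 + 2 * 0"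
    by (intro tendsto_add ennreal_tendsto_cmult lim2 lim3) auto
  then have "(\<integral>\<^sup>+\<omega>. ennreal ((I t \<omega> - ?L \<omega>)\<^sup>2) \<partial>P) \<le> 2 * 0 + 2 * 0"
    by (rule tendsto_lowerbound) (use bound in auto)
  then have "AE \<omega> in P. ennreal ((I t \<omega> - ?L \<omega>)\<^sup>2) = 0"
    using I L by (subst (asm) le_zero_eq[symmetric, THEN iffD2, THEN eq_refl, THEN order_antisym[OF _ zero_le], symmetric])
       (auto simp: nn_integral_0_iff_AE)
  then show ?thesis by eventually_elim (auto simp: ennreal_eq_0_iff)
qed

end

section \<open>Duality between wealth and the exponential martingale\<close>

lemma L2norm_tendsto_0:
  assumes "\<And>l. f l \<in> borel_measurable M" "(\<lambda>l. \<integral>\<^sup>+x. ennreal ((f l x)\<^sup>2) \<partial>M) \<longlonglongrightarrow> 0"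
  shows "(\<lambda>l. L2norm M (f l)) \<longlonglongrightarrow> 0"
proof -
  have "L2norm M (f l) = sqrt (enn2real (\<integral>\<^sup>+x. ennreal ((f l x)\<^sup>2) \<partial>M))" for l
    unfolding L2norm_def by (subst integral_eq_nn_integral) (use assms(1)[of l] in auto)
  moreover have "(\<lambda>l. enn2real (\<integral>\<^sup>+x. ennreal ((f l x)\<^sup>2) \<partial>M)) \<longlonglongrightarrow> enn2real 0"
    using tendsto_enn2real[of _ 0 sequentially] assms(2) by simp
  ultimately show ?thesis
    using tendsto_real_sqrt[of "\<lambda>l. enn2real (\<integral>\<^sup>+x. ennreal ((f l x)\<^sup>2) \<partial>M)" 0] by simp
qed

context brownian
begin

lemma exp_mart_square_integrable_Q:
  shows "in_L2 Q (\<lambda>(t, \<omega>). exp_mart l t \<omega>)"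
    and "L2norm Q (\<lambda>(t, \<omega>). exp_mart l t \<omega>) \<le> sqrt T * exp (l\<^sup>2 * T / 2)"
proof -
  have m: "(\<lambda>(t, \<omega>). exp_mart l t \<omega>) \<in> borel_measurable Q"
  proof -
    have "(\<lambda>x. fst x) \<in> borel_measurable Q"
      by (rule measurable_compose[OF measurable_fst ident_measurable_time_measure])
    then show ?thesis
      using in_L2D(1)[OF W_square_integrable_Q(1)]
      unfolding exp_mart_def case_prod_unfold by (intro borel_measurable_exp[THEN measurable_compose[rotated]]
          borel_measurable_diff borel_measurable_times borel_measurable_divide borel_measurable_const) auto
  qed
  have "L2norm P (exp_mart l t) \<le> exp (l\<^sup>2 * T / 2)" if "t \<in> {0..T}" for t
    using exp_mart_square_integrable(2)[of t l] that by (simp add: mult_left_mono)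
  note sec = in_L2_Q_of_sections[OF less_imp_le[OF T_pos] m _ this]
  show "in_L2 Q (\<lambda>(t, \<omega>). exp_mart l t \<omega>)"
    "L2norm Q (\<lambda>(t, \<omega>). exp_mart l t \<omega>) \<le> sqrt T * exp (l\<^sup>2 * T / 2)"
    using sec exp_mart_square_integrable(1) by auto
qed

text \<open>
  For each increment the weight is moved from time \<open>T\<close> to the end of the interval by the martingale
  property; then the mean vanishes by the drift correction.
\<close>

lemma elementary_duality:
  assumes data: "elementary_data P \<F> T m \<tau> \<xi>"
  shows "in_L2 Q (\<lambda>(s, \<omega>). elementary_process m \<tau> \<xi> s \<omega>)"
    and "(\<integral>\<omega>. exp_mart l T \<omega> * (l * (\<integral>s. elementary_process m \<tau> \<xi> s \<omega> \<partial>time_measure T)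
        + elementary_integral W m \<tau> \<xi> T \<omega>) \<partial>P) = 0"
proof -
  have tau: "0 \<le> \<tau> j" "\<tau> j \<le> \<tau> (Suc j)" "\<tau> (Suc j) \<le> T" if "j < m" for j
    using data that by (auto simp: elementary_data_def)
  have \<xi>F: "\<xi> j \<in> borel_measurable (\<F> (\<tau> j))" if "j < m" for j
    using data that by (auto simp: elementary_data_def)
  have \<xi>P: "\<xi> j \<in> borel_measurable P" if "j < m" for j
    using F_measurable_P[OF \<xi>F[OF that]] tau[OF that] by auto
  have "\<forall>j. \<exists>c. j < m \<longrightarrow> (\<forall>\<omega>\<in>space P. \<bar>\<xi> j \<omega>\<bar> \<le> c)"
    using data by (auto simp: elementary_data_def)
  then obtain B where B: "\<forall>\<omega>\<in>space P. \<bar>\<xi> j \<omega>\<bar> \<le> B j" if "j < m" for j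
    by metis
  have int: "(\<integral>s. elementary_process m \<tau> \<xi> s \<omega> \<partial>time_measure T) = (\<Sum>j<m. \<xi> j \<omega> * (\<tau> (Suc j) - \<tau> j))" for \<omega>
  proof -
    have "has_bochner_integral (time_measure T) (\<lambda>s. indicator {\<tau> j<..\<tau> (Suc j)} s) (\<tau> (Suc j) - \<tau> j)"
      if "j < m" for j
    proof -
      have "emeasure (time_measure T) {\<tau> j<..\<tau> (Suc j)} = ennreal (\<tau> (Suc j) - \<tau> j)"
        unfolding time_measure_def using tau[OF that] by (subst emeasure_restrict_space) auto
      moreover have "{\<tau> j<..\<tau> (Suc j)} \<in> sets (time_measure T)"
        unfolding time_measure_def using tau[OF that] by (auto simp: sets_restrict_space_iff)
      ultimately show ?thesis
        using has_bochner_integral_real_indicator[of "{\<tau> j<..\<tau> (Suc j)}" "time_measure T"] tau[OF that]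
        by (simp add: measure_def)
    qed
    then have "has_bochner_integral (time_measure T) (\<lambda>s. \<Sum>j<m. \<xi> j \<omega> * indicator {\<tau> j<..\<tau> (Suc j)} s)
        (\<Sum>j<m. \<xi> j \<omega> * (\<tau> (Suc j) - \<tau> j))"
      by (intro has_bochner_integral_sum has_bochner_integral_mult_right) auto
    then show ?thesis
      by (simp add: elementary_process_def has_bochner_integral_integral_eq)
  qed
  have S: "elementary_integral W m \<tau> \<xi> T \<omega> = (\<Sum>j<m. \<xi> j \<omega> * (W (\<tau> (Suc j)) \<omega> - W (\<tau> j) \<omega>))" for \<omega>
    unfolding elementary_integral_def using tau by (intro sum.cong refl) (auto simp: min_def intro: antisym order_trans)
  let ?\<psi> = "\<lambda>j \<omega>. \<xi> j \<omega> * (l * (\<tau> (Suc j) - \<tau> j) + (W (\<tau> (Suc j)) \<omega> - W (\<tau> j) \<omega>))"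
  have drift: "has_bochner_integral P (\<lambda>\<omega>. exp_mart l T \<omega> * ?\<psi> j \<omega>) 0" if "j < m" for j
  proof -
    have 1: "?\<psi> j \<in> borel_measurable (\<F> (\<tau> (Suc j)))"
      using F_measurable_mono[OF \<xi>F[OF that] tau(2)[OF that]] increment_F_measurable[OF tau[OF that]] by simp
    note d = exp_mart_drift_correction[OF tau[OF that] \<xi>F[OF that] B[OF that], of l]
    note mt = exp_mart_martingale[OF _ tau(3)[OF that] order_refl 1 d(1)]
    show ?thesis using mt d(2) tau[OF that] by (simp add: has_bochner_integral_iff)
  qed
  have eq: "exp_mart l T \<omega> * (l * (\<integral>s. elementary_process m \<tau> \<xi> s \<omega> \<partial>time_measure T)
        + elementary_integral W m \<tau> \<xi> T \<omega>) = (\<Sum>j<m. exp_mart l T \<omega> * ?\<psi> j \<omega>)" for \<omega>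
    unfolding int S by (simp add: sum_distrib_left sum.distrib[symmetric] algebra_simps)
  have "has_bochner_integral P (\<lambda>\<omega>. \<Sum>j<m. exp_mart l T \<omega> * ?\<psi> j \<omega>) (\<Sum>j<m. 0)"
    by (intro has_bochner_integral_sum drift) auto
  then show "(\<integral>\<omega>. exp_mart l T \<omega> * (l * (\<integral>s. elementary_process m \<tau> \<xi> s \<omega> \<partial>time_measure T)
        + elementary_integral W m \<tau> \<xi> T \<omega>) \<partial>P) = 0"
    unfolding eq by (simp add: has_bochner_integral_integral_eq)
  have "in_L2 Q (\<lambda>x. \<Sum>j<m. \<xi> j (snd x) * indicator {\<tau> j<..\<tau> (Suc j)} (fst x))"
  proof (rule in_L2_sum)
    fix j assume "j \<in> {..<m}" then have j: "j < m" by simp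
    have i: "(\<lambda>x. indicator {\<tau> j<..\<tau> (Suc j)} (fst x) :: real) \<in> borel_measurable Q"
      by (rule measurable_compose[OF measurable_fst measurable_time_measure_of_borel]) simp
    have x: "(\<lambda>x. \<xi> j (snd x)) \<in> borel_measurable Q"
      by (rule measurable_compose[OF measurable_snd \<xi>P[OF j]])
    show "in_L2 Q (\<lambda>x. \<xi> j (snd x) * indicator {\<tau> j<..\<tau> (Suc j)} (fst x))"
    proof (rule in_L2_bound(1)[OF in_L2_const(1)[OF finite_measure_Q]])
      show "(\<lambda>x. \<xi> j (snd x) * indicator {\<tau> j<..\<tau> (Suc j)} (fst x)) \<in> borel_measurable Q"
        using i x by simp
      show "AE x in Q. \<bar>\<xi> j (snd x) * indicator {\<tau> j<..\<tau> (Suc j)} (fst x)\<bar> \<le> \<bar>B j\<bar>"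
      proof (rule AE_I2)
        fix x assume "x \<in> space Q"
        then have "snd x \<in> space P" by (auto simp: space_pair_measure)
        then have "\<bar>\<xi> j (snd x)\<bar> \<le> \<bar>B j\<bar>" using B[OF j] by force
        then show "\<bar>\<xi> j (snd x) * indicator {\<tau> j<..\<tau> (Suc j)} (fst x)\<bar> \<le> \<bar>B j\<bar>"
          by (auto simp: indicator_def)
      qed
    qed
  qed
  then show "in_L2 Q (\<lambda>(s, \<omega>). elementary_process m \<tau> \<xi> s \<omega>)"
    by (simp add: elementary_process_def case_prod_unfold)
qed

text \<open>
  Pairing with \<open>exp_mart l T\<close> is continuous in \<open>L\<^sup>2\<close>, so the identity passes from elementary integrands
  to their limits.
\<close>

lemma ito_integral_duality:
  assumes ito: "ito_integral P \<F> T W H I"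
  shows "in_L2 Q (\<lambda>(t, \<omega>). H t \<omega>)" "in_L2 P (I T)"
    and "(\<integral>\<omega>. exp_mart l T \<omega> * (l * (\<integral>s. H s \<omega> \<partial>time_measure T) + I T \<omega>) \<partial>P) = 0"
proof -
  have T: "0 \<le> T" using T_pos by simp
  from ito obtain m \<tau> \<xi> where data: "\<And>k. elementary_data P \<F> T (m k) (\<tau> k) (\<xi> k)"
    and lim1: "(\<lambda>k. \<integral>\<^sup>+\<omega>. (\<integral>\<^sup>+s\<in>{0..T}.
            ennreal ((elementary_process (m k) (\<tau> k) (\<xi> k) s \<omega> - H s \<omega>)\<^sup>2) \<partial>lborel) \<partial>P) \<longlonglongrightarrow> 0"
    and lim2: "(\<lambda>k. \<integral>\<^sup>+\<omega>. ennreal ((elementary_integral W (m k) (\<tau> k) (\<xi> k) T \<omega> - I T \<omega>)\<^sup>2) \<partial>P) \<longlonglongrightarrow> 0"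
    using T by (fastforce simp: ito_integral_def)
  let ?h = "\<lambda>k. elementary_process (m k) (\<tau> k) (\<xi> k)"
  let ?S = "\<lambda>k. elementary_integral W (m k) (\<tau> k) (\<xi> k) T"
  have Hm: "(\<lambda>(t, \<omega>). H t \<omega>) \<in> borel_measurable Q"
    using ito progressive_measurable[of H] T by (simp add: ito_integral_def)
  show H: "in_L2 Q (\<lambda>(t, \<omega>). H t \<omega>)"
    using ito square_integrable_Q[OF Hm] by (simp add: ito_integral_def)
  have Im: "I T \<in> borel_measurable P"
    using ito T by (auto simp: ito_integral_def adapted_def intro!: F_measurable_P[of _ T])
  have h: "in_L2 Q (\<lambda>(t, \<omega>). ?h k t \<omega>)" for k
    by (rule elementary_duality(1)[OF data])
  have S: "in_L2 P (?S k)" for k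
    by (rule elementary_process_deviation(1)[OF data T order_refl])
  have "eventually (\<lambda>k. (\<integral>\<^sup>+\<omega>. ennreal ((?S k \<omega> - I T \<omega>)\<^sup>2) \<partial>P) < 1) sequentially"
    by (rule order_tendstoD(2)[OF lim2]) simp
  then obtain k0 where k0: "(\<integral>\<^sup>+\<omega>. ennreal ((?S k0 \<omega> - I T \<omega>)\<^sup>2) \<partial>P) < 1"
    by (auto simp: eventually_sequentially)
  have "in_L2 P (\<lambda>\<omega>. ?S k0 \<omega> - I T \<omega>)"
    by (rule in_L2I_nn_integral(1)[of _ _ 1])
      (use k0 Im in_L2D(1)[OF S] in \<open>auto simp: less_imp_le\<close>)
  from in_L2_diff[OF S[of k0] this] show I: "in_L2 P (I T)" by simp
  have dh: "in_L2 Q (\<lambda>(t, \<omega>). ?h k t \<omega> - H t \<omega>)" for k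
    using in_L2_diff[OF h H] by (simp add: case_prod_unfold)
  have lim1': "(\<lambda>k. L2norm Q (\<lambda>(t, \<omega>). ?h k t \<omega> - H t \<omega>)) \<longlonglongrightarrow> 0"
  proof (rule L2norm_tendsto_0)
    show "(\<lambda>(t, \<omega>). ?h k t \<omega> - H t \<omega>) \<in> borel_measurable Q" for k
      using in_L2D(1)[OF dh] .
    have "(\<integral>\<^sup>+\<omega>. (\<integral>\<^sup>+s\<in>{0..T}. ennreal ((?h k s \<omega> - H s \<omega>)\<^sup>2) \<partial>lborel) \<partial>P) =
      (\<integral>\<^sup>+x. ennreal ((case x of (t, \<omega>) \<Rightarrow> ?h k t \<omega> - H t \<omega>)\<^sup>2) \<partial>Q)" for k
      using in_L2D(1)[OF dh, of k]
      by (subst nn_integral_Q) (simp_all add: case_prod_unfold)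
    then show "(\<lambda>k. \<integral>\<^sup>+x. ennreal ((case x of (t, \<omega>) \<Rightarrow> ?h k t \<omega> - H t \<omega>)\<^sup>2) \<partial>Q) \<longlonglongrightarrow> 0"
      using lim1 by simp
  qed
  have lim2': "(\<lambda>k. L2norm P (\<lambda>\<omega>. ?S k \<omega> - I T \<omega>)) \<longlonglongrightarrow> 0"
    by (rule L2norm_tendsto_0[OF _ lim2]) (use Im in_L2D(1)[OF S] in auto)
  let ?Y = "exp_mart l T"
  have Y: "in_L2 P ?Y" by (rule exp_mart_square_integrable(1)[OF T order_refl])
  let ?A = "\<lambda>\<omega>. l * (\<integral>s. H s \<omega> \<partial>time_measure T) + I T \<omega>"
  have A: "in_L2 P ?A"
    by (intro in_L2_add in_L2_cmult time_integral_square_integrable T H I)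
  have bound: "\<bar>\<integral>\<omega>. ?Y \<omega> * ?A \<omega> \<partial>P\<bar> \<le>
     L2norm P ?Y * (\<bar>l\<bar> * (sqrt T * L2norm Q (\<lambda>(t, \<omega>). ?h k t \<omega> - H t \<omega>)) + L2norm P (\<lambda>\<omega>. ?S k \<omega> - I T \<omega>))" for k
  proof -
    let ?E = "\<lambda>\<omega>. l * (\<integral>s. ?h k s \<omega> \<partial>time_measure T) + ?S k \<omega>"
    let ?D = "\<lambda>\<omega>. l * (\<integral>s. ?h k s \<omega> - H s \<omega> \<partial>time_measure T)"
    have E: "in_L2 P ?E"
      by (intro in_L2_add in_L2_cmult time_integral_square_integrable T h S)
    have D1: "in_L2 P ?D"
      by (intro in_L2_cmult time_integral_square_integrable T dh)
    have D2: "in_L2 P (\<lambda>\<omega>. ?S k \<omega> - I T \<omega>)"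
      by (rule in_L2_diff[OF S I])
    have ae: "AE \<omega> in P. ?E \<omega> - ?A \<omega> = ?D \<omega> + (?S k \<omega> - I T \<omega>)"
      using in_L2_Q_sections(2)[OF h[of k]] in_L2_Q_sections(2)[OF H]
    proof eventually_elim
      case (elim \<omega>)
      then have "integrable (time_measure T) (\<lambda>s. ?h k s \<omega>)" "integrable (time_measure T) (\<lambda>s. H s \<omega>)"
        by (auto intro: in_L2_imp_integrable[OF finite_measure_time_measure])
      then show ?case by (simp add: algebra_simps)
    qed
    have EA: "in_L2 P (\<lambda>\<omega>. ?E \<omega> - ?A \<omega>)" by (rule in_L2_diff[OF E A])
    have "(\<integral>\<omega>. ?Y \<omega> * (?E \<omega> - ?A \<omega>) \<partial>P) = (\<integral>\<omega>. ?Y \<omega> * ?E \<omega> - ?Y \<omega> * ?A \<omega> \<partial>P)"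
      by (simp only: right_diff_distrib)
    also have "\<dots> = (\<integral>\<omega>. ?Y \<omega> * ?E \<omega> \<partial>P) - (\<integral>\<omega>. ?Y \<omega> * ?A \<omega> \<partial>P)"
      by (rule Bochner_Integration.integral_diff[OF in_L2_mult[OF Y E] in_L2_mult[OF Y A]])
    also have "(\<integral>\<omega>. ?Y \<omega> * ?E \<omega> \<partial>P) = 0" by (rule elementary_duality(2)[OF data])
    finally have "\<bar>\<integral>\<omega>. ?Y \<omega> * ?A \<omega> \<partial>P\<bar> = \<bar>\<integral>\<omega>. ?Y \<omega> * (?E \<omega> - ?A \<omega>) \<partial>P\<bar>" by simp
    also have "\<dots> \<le> L2norm P ?Y * L2norm P (\<lambda>\<omega>. ?E \<omega> - ?A \<omega>)"
      by (rule Cauchy_Schwarz_L2norm[OF Y EA])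
    also have "L2norm P (\<lambda>\<omega>. ?E \<omega> - ?A \<omega>) = L2norm P (\<lambda>\<omega>. ?D \<omega> + (?S k \<omega> - I T \<omega>))"
      by (rule in_L2_AE_cong(2)[OF in_L2_add(1)[OF D1 D2] in_L2D(1)[OF EA] ae])
    also have "\<dots> \<le> L2norm P ?D + L2norm P (\<lambda>\<omega>. ?S k \<omega> - I T \<omega>)"
      by (rule in_L2_add(2)[OF D1 D2])
    also have "L2norm P ?D = \<bar>l\<bar> * L2norm P (\<lambda>\<omega>. \<integral>s. ?h k s \<omega> - H s \<omega> \<partial>time_measure T)"
      by (rule in_L2_cmult(2)[OF time_integral_square_integrable(1)[OF T dh]])
    also have "\<dots> \<le> \<bar>l\<bar> * (sqrt T * L2norm Q (\<lambda>(t, \<omega>). ?h k t \<omega> - H t \<omega>))"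
      by (intro mult_left_mono time_integral_square_integrable(2)[OF T dh]) simp
    finally show ?thesis by (simp add: mult_left_mono)
  qed
  have "(\<lambda>k. L2norm P ?Y * (\<bar>l\<bar> * (sqrt T * L2norm Q (\<lambda>(t, \<omega>). ?h k t \<omega> - H t \<omega>)) + L2norm P (\<lambda>\<omega>. ?S k \<omega> - I T \<omega>)))
     \<longlonglongrightarrow> L2norm P ?Y * (\<bar>l\<bar> * (sqrt T * 0) + 0)"
    by (intro tendsto_intros lim1' lim2')
  then have "\<bar>\<integral>\<omega>. ?Y \<omega> * ?A \<omega> \<partial>P\<bar> \<le> L2norm P ?Y * (\<bar>l\<bar> * (sqrt T * 0) + 0)"
    by (rule tendsto_lowerbound) (use bound in auto)
  then show "(\<integral>\<omega>. ?Y \<omega> * ?A \<omega> \<partial>P) = 0" by simp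
qed

text \<open>
  The drift of the gains process is \<open>l\<close> times its volatility, so gains have price zero whatever the
  investment; consumption at time \<open>t\<close> can be priced by the martingale at time \<open>t\<close> instead of \<open>T\<close>,
  because it is known at time \<open>t\<close>.
\<close>

theorem wealth_duality:
  assumes wealth: "wealth_process P \<F> T x0 a W \<pi> C X" and sig: "sigma a \<noteq> 0"
    and C: "in_L2 Q (\<lambda>(t, \<omega>). C t \<omega>)"
    and adapted_C: "\<And>t. t \<in> {0..T} \<Longrightarrow> C t \<in> borel_measurable (\<F> t)"
    and l: "l = mu a / sigma a"
  shows "in_L2 P (X T)"
    and "(\<integral>\<omega>. exp_mart l T \<omega> * X T \<omega> \<partial>P) + (\<integral>x. (case x of (t, \<omega>) \<Rightarrow> exp_mart l t \<omega> * C t \<omega>) \<partial>Q)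
       = x0 * (\<integral>\<omega>. exp_mart l T \<omega> \<partial>P)"
proof -
  have T: "0 \<le> T" using T_pos by simp
  from wealth obtain I where ito: "ito_integral P \<F> T W (\<lambda>t \<omega>. \<pi> t \<omega> * sigma a) I"
    and X: "AE \<omega> in P. \<forall>t\<in>{0..T}.
          X t \<omega> = x0 + (LINT s:{0..t}|lborel. \<pi> s \<omega> * mu a) + I t \<omega> - (LINT s:{0..t}|lborel. C s \<omega>)"
    by (auto simp: wealth_process_def)
  let ?H = "\<lambda>t \<omega>. \<pi> t \<omega> * sigma a"
  note d = ito_integral_duality[OF ito]
  let ?A = "\<lambda>\<omega>. l * (\<integral>s. ?H s \<omega> \<partial>time_measure T) + I T \<omega>" and ?B = "\<lambda>\<omega>. \<integral>s. C s \<omega> \<partial>time_measure T"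
  have XT: "AE \<omega> in P. X T \<omega> = x0 + ?A \<omega> - ?B \<omega>"
    using X
  proof eventually_elim
    case (elim \<omega>)
    have "(LINT s:{0..T}|lborel. \<pi> s \<omega> * mu a) = (\<integral>s. l * ?H s \<omega> \<partial>time_measure T)"
      unfolding set_integral_time_measure_full[OF T] using sig l
      by (intro Bochner_Integration.integral_cong refl) (simp add: field_simps)
    also have "\<dots> = l * (\<integral>s. ?H s \<omega> \<partial>time_measure T)" by simp
    finally show ?case using elim T by (simp add: set_integral_time_measure_full[OF T])
  qed
  have A: "in_L2 P ?A"
    by (intro in_L2_add in_L2_cmult time_integral_square_integrable T d)
  have B: "in_L2 P ?B" by (rule time_integral_square_integrable(1)[OF T C])
  have x0A: "in_L2 P (\<lambda>\<omega>. x0 + ?A \<omega>)"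
    by (rule in_L2_add(1)[OF in_L2_const(1)[OF finite_measure_axioms] A])
  have Xm: "X T \<in> borel_measurable P"
    using wealth T by (auto simp: wealth_process_def adapted_def intro!: F_measurable_P[of _ T])
  show XS: "in_L2 P (X T)"
    by (rule in_L2_AE_cong(1)[OF in_L2_diff[OF x0A B] Xm XT])
  let ?Y = "exp_mart l T"
  have Y: "in_L2 P ?Y" by (rule exp_mart_square_integrable(1)[OF T order_refl])
  have Yi: "integrable P ?Y" by (rule in_L2_imp_integrable[OF finite_measure_axioms Y])
  let ?R = "\<lambda>\<omega>. x0 * ?Y \<omega> + ?Y \<omega> * ?A \<omega> - ?Y \<omega> * ?B \<omega>"
  have hb: "has_bochner_integral P ?R
      (x0 * (\<integral>\<omega>. ?Y \<omega> \<partial>P) + (\<integral>\<omega>. ?Y \<omega> * ?A \<omega> \<partial>P) - (\<integral>\<omega>. ?Y \<omega> * ?B \<omega> \<partial>P))"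
    by (intro has_bochner_integral_add has_bochner_integral_diff has_bochner_integral_mult_right
        has_bochner_integral_integrable in_L2_mult Y A B Yi)
  have "(\<integral>\<omega>. ?Y \<omega> * X T \<omega> \<partial>P) = (\<integral>\<omega>. ?R \<omega> \<partial>P)"
  proof (rule integral_cong_AE)
    show "(\<lambda>\<omega>. ?Y \<omega> * X T \<omega>) \<in> borel_measurable P"
      using in_L2D(1)[OF Y] Xm by simp
    show "?R \<in> borel_measurable P"
      using hb by (auto simp only: has_bochner_integral_iff intro!: borel_measurable_integrable)
    show "AE \<omega> in P. ?Y \<omega> * X T \<omega> = ?R \<omega>"
      using XT
    proof eventually_elim
      case (elim \<omega>)
      show ?case
        unfolding elim by (simp only: right_diff_distrib distrib_left mult.commute[of x0])
    qed
  qed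
  also have "\<dots> = x0 * (\<integral>\<omega>. ?Y \<omega> \<partial>P) + (\<integral>\<omega>. ?Y \<omega> * ?A \<omega> \<partial>P) - (\<integral>\<omega>. ?Y \<omega> * ?B \<omega> \<partial>P)"
    by (rule has_bochner_integral_integral_eq[OF hb])
  also have "(\<integral>\<omega>. ?Y \<omega> * ?A \<omega> \<partial>P) = 0" by (rule d(3))
  also have "(\<integral>\<omega>. ?Y \<omega> * ?B \<omega> \<partial>P) = (\<integral>t. (\<integral>\<omega>. ?Y \<omega> * C t \<omega> \<partial>P) \<partial>time_measure T)"
    by (rule expectation_time_integral(2)[OF T C Y])
  also have "\<dots> = (\<integral>t. (\<integral>\<omega>. exp_mart l t \<omega> * C t \<omega> \<partial>P) \<partial>time_measure T)"
  proof (rule integral_cong_AE)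
    have i1: "integrable Q (\<lambda>(t, \<omega>). ?Y \<omega> * C t \<omega>)" by (rule expectation_time_integral(1)[OF T C Y])
    show "(\<lambda>t. \<integral>\<omega>. ?Y \<omega> * C t \<omega> \<partial>P) \<in> borel_measurable (time_measure T)"
      using Q.integrable_fst[OF i1] by auto
    have i2: "integrable Q (\<lambda>(t, \<omega>). exp_mart l t \<omega> * C t \<omega>)"
      using in_L2_mult[OF exp_mart_square_integrable_Q(1) C] by (simp add: case_prod_unfold)
    show "(\<lambda>t. \<integral>\<omega>. exp_mart l t \<omega> * C t \<omega> \<partial>P) \<in> borel_measurable (time_measure T)"
      using Q.integrable_fst[OF i2] by auto
    show "AE t in time_measure T. (\<integral>\<omega>. ?Y \<omega> * C t \<omega> \<partial>P) = (\<integral>\<omega>. exp_mart l t \<omega> * C t \<omega> \<partial>P)"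
      using in_L2_Q_sections(1)[OF C] AE_space
    proof eventually_elim
      case (elim t)
      then have t: "0 \<le> t" "t \<le> T" by auto
      show ?case
        by (rule exp_mart_martingale(2)[OF t order_refl adapted_C
              in_L2_mult[OF exp_mart_square_integrable(1)[OF t] elim(1)]]) (use t in auto)
    qed
  qed
  also have "\<dots> = (\<integral>x. (case x of (t, \<omega>) \<Rightarrow> exp_mart l t \<omega> * C t \<omega>) \<partial>Q)"
    using Q.integral_fst[of "\<lambda>t \<omega>. exp_mart l t \<omega> * C t \<omega>"]
      in_L2_mult[OF exp_mart_square_integrable_Q(1) C] by (simp add: case_prod_unfold)
  finally show "(\<integral>\<omega>. exp_mart l T \<omega> * X T \<omega> \<partial>P) + (\<integral>x. (case x of (t, \<omega>) \<Rightarrow> exp_mart l t \<omega> * C t \<omega>) \<partial>Q)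
       = x0 * (\<integral>\<omega>. exp_mart l T \<omega> \<partial>P)" by simp
qed

end

section \<open>The candidate wealth in closed form\<close>

text \<open>
  The excess of the candidate's consumption over \<open>\<theta>\<close> times the mean field habit, if the Brownian motion
  has the value \<open>w\<close> at time \<open>t\<close>.
\<close>

definition equilibrium_excess ::
  "real \<Rightarrow> real \<Rightarrow> agent_type \<Rightarrow> (real \<Rightarrow> real) \<Rightarrow> real \<Rightarrow> real \<Rightarrow> real \<Rightarrow> real" where
  "equilibrium_excess T x0 a Zb XbT t w =
     feedback_C T a Zb XbT 0 x0 - theta a * Zb 0 + beta a * (mu a / sigma a)\<^sup>2 / 2 * t + beta a * (mu a / sigma a) * w"

lemma set_integral_eq_integral_continuous:
  fixes f :: "real \<Rightarrow> real"
  assumes "continuous_on {a..b} f"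
  shows "(LINT s:{a..b}|lborel. f s) = integral {a..b} f"
  by (rule set_borel_integral_eq_integral(2)[OF borel_integrable_atLeastAtMost'[OF assms]])

lemma set_integral_has_real_derivative:
  fixes f :: "real \<Rightarrow> real"
  assumes f: "continuous_on {0..T} f" and t: "t \<in> {0..T}"
  shows "((\<lambda>u. LINT s:{0..u}|lborel. f s) has_real_derivative f t) (at t within {0..T})"
proof -
  have "((\<lambda>u. integral {0..u} f) has_real_derivative f t) (at t within {0..T})"
    by (rule integral_has_real_derivative[OF f t])
  moreover have "(LINT s:{0..u}|lborel. f s) = integral {0..u} f" if "u \<in> {0..T}" for u
    by (rule set_integral_eq_integral_continuous[OF continuous_on_subset[OF f]]) (use that in auto)
  ultimately show ?thesis
    unfolding has_field_derivative_def by (rule has_derivative_transform[OF t, rotated]) auto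
qed

lemma set_integral_tail:
  fixes f :: "real \<Rightarrow> real"
  assumes f: "continuous_on {0..T} f" and t: "t \<in> {0..T}"
  shows "(LINT s:{t..T}|lborel. f s) = (LINT s:{0..T}|lborel. f s) - (LINT s:{0..t}|lborel. f s)"
proof -
  have "integral {0..t} f + integral {t..T} f = integral {0..T} f"
    using t by (intro Henstock_Kurzweil_Integration.integral_combine integrable_continuous_real f) auto
  moreover have "continuous_on {t..T} f" "continuous_on {0..t} f"
    using t by (auto intro: continuous_on_subset[OF f])
  ultimately show ?thesis
    using f by (simp add: set_integral_eq_integral_continuous)
qed

lemma set_integral_singleton: "(LINT s:{a..a}|lborel. f s) = (0::real)" for a :: real
  unfolding set_lebesgue_integral_def
proof (rule integral_eq_zero_AE)
  show "AE s in lborel. indicator {a..a} s *\<^sub>R f s = 0"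
    using AE_lborel_singleton[of a] by eventually_elim (simp add: indicator_def)
qed

lemma feedback_C_at_T:
  "feedback_C T a Zb XbT T x = x - theta a * XbT + theta a * Zb T"
  by (simp add: feedback_C_def set_integral_singleton del: atLeastAtMost_singleton)

lemma feedback_C_continuous:
  assumes T: "T > 0" and Zb: "continuous_on {0..T} Zb" and x: "continuous_on {0..T} x"
  shows "continuous_on {0..T} (\<lambda>t. feedback_C T a Zb XbT t (x t))"
proof -
  have "continuous_on {0..T} (\<lambda>t. LINT s:{0..t}|lborel. Zb s)"
    using set_integral_has_real_derivative[OF Zb] by (intro DERIV_continuous_on) auto
  then have "continuous_on {0..T} (\<lambda>t. LINT s:{t..T}|lborel. Zb s)"
    by (subst continuous_on_cong[OF refl set_integral_tail[OF Zb]]) (auto intro!: continuous_intros)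
  then show ?thesis
    unfolding feedback_C_def using T by (auto intro!: continuous_intros Zb x)
qed

text \<open>
  The noise enters wealth as \<open>b (T + 1 - t) w t\<close> plus a differentiable function of time. Hence
  \<open>A t = x t - b (T + 1 - t) w t\<close> is differentiable, and so is the excess \<open>g\<close> left after subtracting \<open>b w t\<close> and
  the expected drift \<open>k t / 2\<close>. Its derivative is \<open>0\<close>. The argument is deterministic.
\<close>

lemma feedback_wealth_pathwise:
  fixes x w Zb :: "real \<Rightarrow> real"
  assumes T: "T > 0" and sig: "sigma a > 0"
    and Zb: "continuous_on {0..T} Zb" and x: "continuous_on {0..T} x" and w: "continuous_on {0..T} w"
    and w0: "w 0 = 0"
    and eq: "\<And>t. t \<in> {0..T} \<Longrightarrow> x t = x0 + (LINT s:{0..t}|lborel. feedback_pi T a s * mu a)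
        + beta a * (mu a / sigma a) * ((T + 1 - t) * w t + (LINT s:{0..t}|lborel. w s))
        - (LINT s:{0..t}|lborel. feedback_C T a Zb XbT s (x s))"
    and t: "t \<in> {0..T}"
  shows "feedback_C T a Zb XbT t (x t) - theta a * Zb t = equilibrium_excess T x0 a Zb XbT t (w t)"
proof -
  define \<theta> where "\<theta> = theta a"
  define l where "l = mu a / sigma a"
  define b where "b = beta a * l"
  define k where "k = beta a * l\<^sup>2"
  define C where "C t = feedback_C T a Zb XbT t (x t)" for t
  define IZ where "IZ t = (LINT s:{0..t}|lborel. Zb s)" for t
  define A where "A t = x0 + (LINT s:{0..t}|lborel. feedback_pi T a s * mu a)
     + b * (LINT s:{0..t}|lborel. w s) - (LINT s:{0..t}|lborel. C s)" for t
  define N where "N t = A t - \<theta> * XbT - \<theta> * (IZ T - IZ t)" for t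
  define g where "g t = N t / (T + 1 - t) + 1 / 4 * k * ((T + 1 - t) - 1 / (T + 1 - t)) - k / 2 * t" for t
  have pi: "feedback_pi T a s * mu a = k * (T + 1 - s)" for s
    using sig by (simp add: feedback_pi_def k_def l_def power2_eq_square field_simps)
  have C_cont: "continuous_on {0..T} C"
    unfolding C_def by (rule feedback_C_continuous[OF T Zb x])
  have x_eq: "x t = A t + b * (T + 1 - t) * w t" if "t \<in> {0..T}" for t
    using eq[OF that, folded l_def, folded b_def C_def] by (simp add: A_def algebra_simps)
  have C_eq: "C t = N t / (T + 1 - t) + b * w t + \<theta> * Zb t + 1 / 4 * k * ((T + 1 - t) - 1 / (T + 1 - t))"
    if "t \<in> {0..T}" for t
  proof -
    have "T + 1 - t \<noteq> 0" using that by auto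
    then show ?thesis
      unfolding C_def feedback_C_def set_integral_tail[OF Zb that] x_eq[OF that]
      by (simp add: N_def IZ_def \<theta>_def k_def l_def divide_simps)
  qed
  have g_eq: "C t - \<theta> * Zb t = g t + k / 2 * t + b * w t" if "t \<in> {0..T}" for t
    using C_eq[OF that] by (simp add: g_def)
  have "(g has_real_derivative 0) (at t within {0..T})" if t: "t \<in> {0..T}" for t
  proof -
    have r: "T + 1 - t \<noteq> 0" using t by auto
    have A': "(A has_real_derivative (k * (T + 1 - t) + b * w t - C t)) (at t within {0..T})"
    proof -
      have "continuous_on {0..T} (\<lambda>s. feedback_pi T a s * mu a)"
        unfolding pi by (intro continuous_intros)
      note d1 = set_integral_has_real_derivative[OF this t] and d2 = set_integral_has_real_derivative[OF w t]
        and d3 = set_integral_has_real_derivative[OF C_cont t]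
      have "(A has_real_derivative (0 + feedback_pi T a t * mu a + b * w t - C t)) (at t within {0..T})"
        unfolding A_def[abs_def] by (intro DERIV_add DERIV_diff DERIV_cmult DERIV_const d1 d2 d3)
      then show ?thesis by (simp add: pi)
    qed
    have N': "(N has_real_derivative (k * (T + 1 - t) + b * w t - C t + \<theta> * Zb t)) (at t within {0..T})"
      unfolding N_def[abs_def] IZ_def
      by (rule derivative_eq_intros A' set_integral_has_real_derivative[OF Zb t] refl | simp)+
    have N'': "k * (T + 1 - t) + b * w t - C t + \<theta> * Zb t =
       k * (T + 1 - t) - N t / (T + 1 - t) - 1 / 4 * k * ((T + 1 - t) - 1 / (T + 1 - t))"
      using C_eq[OF t] by simp
    have "(g has_real_derivative (((k * (T + 1 - t) - N t / (T + 1 - t) - 1 / 4 * k * ((T + 1 - t) - 1 / (T + 1 - t)))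
          * (T + 1 - t) - N t * (- 1)) / ((T + 1 - t) * (T + 1 - t))
        + 1 / 4 * k * (- 1 - (1 / ((T + 1 - t) * (T + 1 - t)))) - k / 2)) (at t within {0..T})"
      unfolding g_def[abs_def]
      by (rule derivative_eq_intros N'[unfolded N''] refl r | simp)+
    moreover have zero: "((k * r - n / r - 1 / 4 * k * (r - 1 / r)) * r - n * (- 1)) / (r * r)
        + 1 / 4 * k * (- 1 - (1 / (r * r))) - k / 2 = 0" if "r \<noteq> 0" for r n :: real
      using that by (simp add: field_simps)
    ultimately show ?thesis using zero[OF r, of "N t"] by (simp only:)
  qed
  then have "\<exists>c. \<forall>t\<in>{0..T}. g t = c"
    by (intro has_field_derivative_zero_constant) auto
  then have "g t = g 0" using t T by (metis atLeastAtMost_iff less_imp_le order_refl)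
  also have "g 0 = C 0 - \<theta> * Zb 0" using g_eq[of 0] T w0 by simp
  also have "C 0 = feedback_C T a Zb XbT 0 x0"
    using eq[of 0] T w0 by (simp add: C_def set_integral_singleton del: atLeastAtMost_singleton)
  finally show ?thesis
    using g_eq[OF t] by (simp add: equilibrium_excess_def C_def \<theta>_def k_def b_def l_def)
qed

context brownian
begin

lemma AE_all_times:
  assumes X: "continuous_paths P T X" and Y: "continuous_paths P T Y"
    and eq: "\<And>t. t \<in> {0..T} \<Longrightarrow> AE \<omega> in P. X t \<omega> = Y t \<omega>"
  shows "AE \<omega> in P. \<forall>t\<in>{0..T}. X t \<omega> = Y t \<omega>"
proof -
  define S where "S = {0<..<T} \<inter> \<rat>"
  have cl: "closure S = {0..T}"
    unfolding S_def using T_pos by (subst closure_open_Int_superset) (auto simp: Rats_closure_real)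
  have "countable S" unfolding S_def by (simp add: countable_rat)
  then have "AE \<omega> in P. \<forall>t\<in>S. X t \<omega> = Y t \<omega>"
    using eq by (subst AE_ball_countable) (auto simp: S_def)
  then show ?thesis using AE_space
  proof eventually_elim
    case (elim \<omega>)
    have "continuous_on (closure S) (\<lambda>t. X t \<omega> - Y t \<omega>)"
      unfolding cl using X Y elim(2) by (intro continuous_intros) (auto simp: continuous_paths_def)
    from continuous_constant_on_closure[OF this, of 0] elim(1) show ?case
      unfolding cl by auto
  qed
qed

lemma W_continuous_paths: "continuous_paths P T W"
  using brownian by (simp add: brownian_motion_def)

lemma ito_remaining_continuous_paths: "continuous_paths P T ito_remaining"
  unfolding continuous_paths_def
proof
  fix \<omega> assume "\<omega> \<in> space P"
  then have w: "continuous_on {0..T} (\<lambda>t. W t \<omega>)"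
    using W_continuous_paths by (auto simp: continuous_paths_def)
  have "continuous_on {0..T} (\<lambda>t. LINT s:{0..t}|lborel. W s \<omega>)"
    using set_integral_has_real_derivative[OF w] by (intro DERIV_continuous_on) auto
  then show "continuous_on {0..T} (\<lambda>t. ito_remaining t \<omega>)"
    unfolding ito_remaining_def by (intro continuous_intros w)
qed

text \<open>
  Continuity of the paths makes the formula for the Ito integral valid for all times at once, so that
  the wealth equation can be solved for each outcome separately. At time \<open>T\<close> the feedback consumes all
  wealth in excess of the benchmark, so the excesses of consumption and of wealth coincide.
\<close>

theorem feedback_wealth_excess:
  assumes wealth: "feedback_wealth P \<F> T x0 a Zb XbT W X" and sig: "sigma a > 0"
    and Zb: "continuous_on {0..T} Zb"
  shows "AE \<omega> in P. \<forall>t\<in>{0..T}. feedback_C T a Zb XbT t (X t \<omega>) - theta a * Zb t = equilibrium_excess T x0 a Zb XbT t (W t \<omega>)"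
    and "AE \<omega> in P. X T \<omega> - theta a * XbT = equilibrium_excess T x0 a Zb XbT T (W T \<omega>)"
proof -
  from wealth obtain I where ito: "ito_integral P \<F> T W (\<lambda>t \<omega>. feedback_pi T a t * sigma a) I"
    and X: "AE \<omega> in P. \<forall>t\<in>{0..T}. X t \<omega> = x0 + (LINT s:{0..t}|lborel. feedback_pi T a s * mu a) + I t \<omega>
        - (LINT s:{0..t}|lborel. feedback_C T a Zb XbT s (X s \<omega>))"
    and Xc: "continuous_paths P T X"
    by (auto simp: feedback_wealth_def wealth_process_def)
  let ?b = "beta a * (mu a / sigma a)"
  have "feedback_pi T a t * sigma a = ?b * (T + 1 - t)" for t
    using sig by (simp add: feedback_pi_def power2_eq_square field_simps)
  with ito have ito': "ito_integral P \<F> T W (\<lambda>t \<omega>. ?b * (T + 1 - t)) I" by simp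
  have "continuous_paths P T (\<lambda>t \<omega>. ?b * ito_remaining t \<omega>)"
    using ito_remaining_continuous_paths unfolding continuous_paths_def
    by (intro ballI continuous_on_mult_left) blast
  moreover have "continuous_paths P T I" using ito by (simp add: ito_integral_def)
  ultimately have I: "AE \<omega> in P. \<forall>t\<in>{0..T}. I t \<omega> = ?b * ito_remaining t \<omega>"
    by (intro AE_all_times ito_integral_remaining_time[OF ito']) auto
  show all: "AE \<omega> in P. \<forall>t\<in>{0..T}. feedback_C T a Zb XbT t (X t \<omega>) - theta a * Zb t = equilibrium_excess T x0 a Zb XbT t (W t \<omega>)"
    using X I W_0 AE_space
  proof eventually_elim
    case (elim \<omega>)
    show ?case
    proof
      fix t assume t: "t \<in> {0..T}"
      show "feedback_C T a Zb XbT t (X t \<omega>) - theta a * Zb t = equilibrium_excess T x0 a Zb XbT t (W t \<omega>)"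
        by (rule feedback_wealth_pathwise[OF T_pos sig Zb _ _ _ _ t])
          (use elim Xc W_continuous_paths in \<open>auto simp: continuous_paths_def ito_remaining_def\<close>)
    qed
  qed
  show "AE \<omega> in P. X T \<omega> - theta a * XbT = equilibrium_excess T x0 a Zb XbT T (W T \<omega>)"
    using all
  proof eventually_elim
    case (elim \<omega>)
    then show ?case using T_pos bspec[OF elim, of T] by (simp add: feedback_C_at_T)
  qed
qed

text \<open>
  Marginal utility along the candidate is a constant multiple of the exponential martingale. This is
  what makes the candidate optimal against the mean field.
\<close>

lemma exp_equilibrium_excess:
  assumes "beta a > 0"
  shows "exp (- equilibrium_excess T x0 a Zb XbT t (W t \<omega>) / beta a) =
    exp (- (feedback_C T a Zb XbT 0 x0 - theta a * Zb 0) / beta a) * exp_mart (mu a / sigma a) t \<omega>"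
proof -
  have "- equilibrium_excess T x0 a Zb XbT t (W t \<omega>) / beta a =
    - (feedback_C T a Zb XbT 0 x0 - theta a * Zb 0) / beta a + (- (mu a / sigma a) * W t \<omega> - (mu a / sigma a)\<^sup>2 * t / 2)"
    using assms unfolding equilibrium_excess_def by (simp add: field_simps)
  then show ?thesis
    by (simp only: exp_mart_def exp_add[symmetric])
qed

end

section \<open>Deviation of a single agent\<close>

text \<open>
  The summands are, in this order, the cost per unit of: the distance of the average habit from the
  mean field, the distance of the average wealth from the mean field, and the weight of the deviating
  agent in the average habit and in the average wealth. Measured against the mean field, the disutility
  of the candidate has norm at most \<open>U\<close> at time \<open>T\<close> and \<open>V\<close> on \<open>Q\<close>; \<open>R\<close> bounds the coefficients of candidate consumption and wealth.
\<close>

definition error_constant ::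
  "real \<Rightarrow> real \<Rightarrow> real \<Rightarrow> real \<Rightarrow> agent_type \<Rightarrow> (real \<Rightarrow> real) \<Rightarrow> real \<Rightarrow> real \<Rightarrow> real" where
  "error_constant T x0 \<delta> M a Zb XbT R =
     (let U = exp (- (feedback_C T a Zb XbT 0 x0 - theta a * Zb 0) / beta a) * exp ((mu a / sigma a)\<^sup>2 * T / 2);
          V = sqrt T * U
      in theta a / beta a * (sqrt M + V) + theta a / beta a * (sqrt M + U)
         + theta a / beta a * V * (T * \<delta> * (R * sqrt T + R * T + beta a * sqrt M))
         + theta a / beta a * U * (R + R * sqrt T + beta a * sqrt M))"

lemma equilibrium_excess_affine:
  "equilibrium_excess T x0 a Zb XbT t w =
     equilibrium_excess T x0 a Zb XbT t 0 + beta a * (mu a / sigma a) * w"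
  by (simp add: equilibrium_excess_def)

context usual_filtered_prob_space
begin

lemma AE_Q_of_AE_P:
  assumes "AE \<omega> in P. \<forall>t\<in>{0..T}. R t \<omega>"
  shows "AE x in Q. R (fst x) (snd x)"
proof -
  obtain N where N: "N \<in> null_sets P" "{\<omega> \<in> space P. \<not> (\<forall>t\<in>{0..T}. R t \<omega>)} \<subseteq> N"
    using assms by (auto simp: eventually_ae_filter)
  have "{0..T} \<times> N \<in> null_sets Q"
    using N(1) sets.top[of "time_measure T"] by (intro times_in_null_sets2) auto
  then show ?thesis
    by (rule AE_I') (use N(2) in \<open>force simp: space_pair_measure\<close>)
qed

lemma habit_time_measure:
  assumes "t \<in> {0..T}"
  shows "habit \<delta> z0 C t \<omega> =
    exp (- \<delta> * t) * (z0 + (\<integral>s. indicator {0..t} s * (\<delta> * exp (\<delta> * s) * C s \<omega>) \<partial>time_measure T))"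
  using assms by (simp add: habit_def set_integral_time_measure)

lemma habit_measurable:
  assumes "(\<lambda>(t, \<omega>). C t \<omega>) \<in> borel_measurable Q"
  shows "(\<lambda>(t, \<omega>). habit \<delta> z0 C t \<omega>) \<in> borel_measurable Q"
proof -
  let ?T = "time_measure T"
  have fst: "(\<lambda>x. fst x) \<in> borel_measurable Q"
    by (rule measurable_compose[OF measurable_fst ident_measurable_time_measure])
  have m: "(\<lambda>y. indicator {0..fst (fst y)} (snd y) * (\<delta> * exp (\<delta> * snd y) * C (snd y) (snd (fst y))))
      \<in> borel_measurable (Q \<Otimes>\<^sub>M ?T)"
  proof (intro borel_measurable_times)
    have s: "(\<lambda>y. snd y) \<in> borel_measurable (Q \<Otimes>\<^sub>M ?T)"
      by (rule measurable_compose[OF measurable_snd ident_measurable_time_measure])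
    have t: "(\<lambda>y. fst (fst y)) \<in> borel_measurable (Q \<Otimes>\<^sub>M ?T)"
      by (rule measurable_compose[OF measurable_fst fst])
    have "Measurable.pred (Q \<Otimes>\<^sub>M ?T) (\<lambda>y. 0 \<le> snd y \<and> snd y \<le> fst (fst y))"
      using s t by measurable
    then have "(\<lambda>y. if 0 \<le> snd y \<and> snd y \<le> fst (fst y) then 1 else 0 :: real) \<in> borel_measurable (Q \<Otimes>\<^sub>M ?T)"
      by (intro measurable_If) auto
    then show "(\<lambda>y. indicator {0..fst (fst y)} (snd y) :: real) \<in> borel_measurable (Q \<Otimes>\<^sub>M ?T)"
      by (simp add: indicator_def)
    show "(\<lambda>y. exp (\<delta> * snd y)) \<in> borel_measurable (Q \<Otimes>\<^sub>M ?T)" using s by simp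
    have "(\<lambda>y. (snd y, snd (fst y))) \<in> measurable (Q \<Otimes>\<^sub>M ?T) Q" by measurable
    from measurable_compose[OF this assms]
    show "(\<lambda>y. C (snd y) (snd (fst y))) \<in> borel_measurable (Q \<Otimes>\<^sub>M ?T)" by simp
  qed simp
  have "(\<lambda>x. \<integral>s. indicator {0..fst x} s * (\<delta> * exp (\<delta> * s) * C s (snd x)) \<partial>?T) \<in> borel_measurable Q"
    by (rule sigma_finite_measure.borel_measurable_lebesgue_integral[OF sigma_finite_time_measure])
      (use m in \<open>simp add: case_prod_unfold\<close>)
  then have "(\<lambda>x. exp (- \<delta> * fst x) * (z0 + (\<integral>s. indicator {0..fst x} s * (\<delta> * exp (\<delta> * s) * C s (snd x)) \<partial>?T)))
      \<in> borel_measurable Q"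
    using fst by simp
  then show ?thesis
    by (rule measurable_cong[THEN iffD1, rotated]) (auto simp: space_pair_measure habit_time_measure)
qed

lemma habit_kernel_integrable:
  fixes f :: "real \<Rightarrow> real"
  assumes f: "integrable (time_measure T) f"
  shows "integrable (time_measure T) (\<lambda>s. indicator {0..t} s * (\<delta> * exp (\<delta> * s) * f s))"
proof (rule Bochner_Integration.integrable_bound)
  show "integrable (time_measure T) (\<lambda>s. \<bar>\<delta>\<bar> * exp (\<bar>\<delta>\<bar> * T) * f s)" using f by simp
  have "(\<lambda>s. indicator {0..t} s * (\<delta> * exp (\<delta> * s))) \<in> borel_measurable (time_measure T)"
    by (rule measurable_time_measure_of_borel) simp
  then show "(\<lambda>s. indicator {0..t} s * (\<delta> * exp (\<delta> * s) * f s)) \<in> borel_measurable (time_measure T)"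
    using f by (simp add: mult.assoc[symmetric])
  show "AE s in time_measure T. norm (indicator {0..t} s * (\<delta> * exp (\<delta> * s) * f s)) \<le> norm (\<bar>\<delta>\<bar> * exp (\<bar>\<delta>\<bar> * T) * f s)"
  proof (rule AE_I2)
    fix s assume "s \<in> space (time_measure T)"
    then have "\<delta> * s \<le> \<bar>\<delta>\<bar> * T" by (intro mult_mono) auto
    then show "norm (indicator {0..t} s * (\<delta> * exp (\<delta> * s) * f s)) \<le> norm (\<bar>\<delta>\<bar> * exp (\<bar>\<delta>\<bar> * T) * f s)"
      by (auto simp: indicator_def abs_mult intro!: mult_right_mono mult_left_mono)
  qed
qed

text \<open>
  Consumption at time \<open>s\<close> enters the habit at time \<open>t\<close> with the weight \<open>\<delta> exp (- \<delta> (t - s))\<close>, which is at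
  most \<open>\<delta>\<close>; the initial habits cancel.
\<close>

lemma habit_diff_le:
  assumes t: "t \<in> {0..T}" and \<delta>: "\<delta> > 0"
    and C: "integrable (time_measure T) (\<lambda>s. C s \<omega>)" and D: "integrable (time_measure T) (\<lambda>s. D s \<omega>)"
    and m: "integrable (time_measure T) m" and le: "\<And>s. s \<in> {0..T} \<Longrightarrow> C s \<omega> - D s \<omega> \<le> m s" "\<And>s. s \<in> {0..T} \<Longrightarrow> 0 \<le> m s"
  shows "habit \<delta> z0 C t \<omega> - habit \<delta> z0 D t \<omega> \<le> \<delta> * (\<integral>s. m s \<partial>time_measure T)"
proof -
  let ?k = "\<lambda>s. indicator {0..t} s * (\<delta> * exp (\<delta> * s))"
  have k: "integrable (time_measure T) (\<lambda>s. ?k s * f s)" if "integrable (time_measure T) f" for f :: "real \<Rightarrow> real"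
    using habit_kernel_integrable[OF that, of t \<delta>] by (simp add: mult.assoc)
  have "habit \<delta> z0 C t \<omega> - habit \<delta> z0 D t \<omega> =
      exp (- \<delta> * t) * ((\<integral>s. ?k s * C s \<omega> \<partial>time_measure T) - (\<integral>s. ?k s * D s \<omega> \<partial>time_measure T))"
    by (simp add: habit_time_measure[OF t] mult.assoc right_diff_distrib distrib_left)
  also have "\<dots> = (\<integral>s. exp (- \<delta> * t) * (?k s * C s \<omega> - ?k s * D s \<omega>) \<partial>time_measure T)"
    using k[OF C] k[OF D] by simp
  also have "\<dots> \<le> (\<integral>s. \<delta> * m s \<partial>time_measure T)"
  proof (rule integral_mono)
    show "integrable (time_measure T) (\<lambda>s. exp (- \<delta> * t) * (?k s * C s \<omega> - ?k s * D s \<omega>))"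
      using k[OF C] k[OF D] by simp
    show "integrable (time_measure T) (\<lambda>s. \<delta> * m s)" using m by simp
    fix s assume "s \<in> space (time_measure T)"
    then have s: "s \<in> {0..T}" by simp
    show "exp (- \<delta> * t) * (?k s * C s \<omega> - ?k s * D s \<omega>) \<le> \<delta> * m s"
    proof (cases "s \<le> t")
      case True
      have "exp (- \<delta> * t) * (?k s * C s \<omega> - ?k s * D s \<omega>) = \<delta> * (exp (- \<delta> * (t - s)) * (C s \<omega> - D s \<omega>))"
        using True s by (simp add: exp_diff exp_minus algebra_simps divide_inverse)
      also have "exp (- \<delta> * (t - s)) * (C s \<omega> - D s \<omega>) \<le> exp (- \<delta> * (t - s)) * m s"
        by (intro mult_left_mono le(1) s) simp
      also have "\<dots> \<le> 1 * m s"
        using True \<delta> by (intro mult_right_mono le(2) s) simp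
      finally show ?thesis using \<delta> by simp
    next
      case False
      then show ?thesis using \<delta> le(2)[OF s] by simp
    qed
  qed
  finally show ?thesis by simp
qed

end

context brownian
begin

lemma feedback_consumption_measurable:
  assumes wealth: "feedback_wealth P \<F> T x0 a Zb XbT W X" and Zb: "continuous_on {0..T} Zb"
  shows "(\<lambda>(t, \<omega>). feedback_C T a Zb XbT t (X t \<omega>)) \<in> borel_measurable Q"
    and "\<And>t. t \<in> {0..T} \<Longrightarrow> (\<lambda>\<omega>. feedback_C T a Zb XbT t (X t \<omega>)) \<in> borel_measurable (\<F> t)"
proof -
  have X: "continuous_paths P T X" "\<And>t. t \<in> {0..T} \<Longrightarrow> X t \<in> borel_measurable (\<F> t)"
    using wealth by (auto simp: feedback_wealth_def wealth_process_def adapted_def)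
  show *: "(\<lambda>\<omega>. feedback_C T a Zb XbT t (X t \<omega>)) \<in> borel_measurable (\<F> t)" if "t \<in> {0..T}" for t
    using X(2)[OF that] by (simp add: feedback_C_def)
  show "(\<lambda>(t, \<omega>). feedback_C T a Zb XbT t (X t \<omega>)) \<in> borel_measurable Q"
  proof (rule continuous_process_measurable)
    show "continuous_paths P T (\<lambda>t \<omega>. feedback_C T a Zb XbT t (X t \<omega>))"
      using X(1) feedback_C_continuous[OF T_pos Zb] by (auto simp: continuous_paths_def)
    show "(\<lambda>\<omega>. feedback_C T a Zb XbT t (X t \<omega>)) \<in> borel_measurable P" if "t \<in> {0..T}" for t
      using F_measurable_P[OF *[OF that] that] .
  qed
qed

lemma feedback_consumption_norm:
  assumes wealth: "feedback_wealth P \<F> T x0 a Zb XbT W X" and sig: "sigma a > 0" and Zb: "continuous_on {0..T} Zb"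
    and R: "\<And>t. t \<in> {0..T} \<Longrightarrow> \<bar>equilibrium_excess T x0 a Zb XbT t 0 + theta a * Zb t\<bar> \<le> R"
      "\<bar>beta a * (mu a / sigma a)\<bar> \<le> R"
  shows "in_L2 Q (\<lambda>(t, \<omega>). feedback_C T a Zb XbT t (X t \<omega>))"
    and "L2norm Q (\<lambda>(t, \<omega>). feedback_C T a Zb XbT t (X t \<omega>)) \<le> R * sqrt T + R * T"
proof -
  let ?C = "\<lambda>(t, \<omega>). feedback_C T a Zb XbT t (X t \<omega>)" and ?W = "\<lambda>(t, \<omega>). W t \<omega>"
  let ?B = "\<lambda>x. (case x of (t, \<omega>) \<Rightarrow> R) + R * \<bar>?W x\<bar>"
  have R0: "0 \<le> R" using R(2) by linarith
  have c: "in_L2 P (\<lambda>\<omega>. R)" "L2norm P (\<lambda>\<omega>. R) = R"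
    using in_L2_const[OF finite_measure_axioms, of R] R0 prob_space by auto
  note cQ = in_L2_Q_const_in_time[OF less_imp_le[OF T_pos] c(1)]
  note aW = in_L2_cmult[OF in_L2_abs(1)[OF W_square_integrable_Q(1)], of R]
  note B = in_L2_add[OF cQ(1) aW(1)]
  have ae: "AE x in Q. \<bar>?C x\<bar> \<le> ?B x"
    using AE_Q_of_AE_P[OF feedback_wealth_excess(1)[OF wealth sig Zb]] AE_space
  proof eventually_elim
    case (elim x)
    obtain t \<omega> where x: "x = (t, \<omega>)" by (cases x)
    have t: "t \<in> {0..T}" using elim(2) x by (auto simp: space_pair_measure)
    have "feedback_C T a Zb XbT t (X t \<omega>) =
        (equilibrium_excess T x0 a Zb XbT t 0 + theta a * Zb t) + beta a * (mu a / sigma a) * W t \<omega>"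
      using elim(1) equilibrium_excess_affine[of T x0 a Zb XbT t "W t \<omega>"] by (simp add: x)
    also have "\<bar>\<dots>\<bar> \<le> R + \<bar>beta a * (mu a / sigma a)\<bar> * \<bar>W t \<omega>\<bar>"
      using R(1)[OF t] abs_triangle_ineq[of "equilibrium_excess T x0 a Zb XbT t 0 + theta a * Zb t" "beta a * (mu a / sigma a) * W t \<omega>"]
      by (simp only: abs_mult[of "beta a * (mu a / sigma a)" "W t \<omega>"])
    also have "\<dots> \<le> R + R * \<bar>W t \<omega>\<bar>"
      by (intro add_left_mono mult_right_mono R(2)) simp
    finally show ?case by (simp add: x)
  qed
  note bd = in_L2_bound[OF B(1) feedback_consumption_measurable(1)[OF wealth Zb] ae]
  show "in_L2 Q ?C" by (rule bd(1))
  have "L2norm Q (\<lambda>x. R * \<bar>?W x\<bar>) \<le> R * T"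
    using aW(2) in_L2_abs(2)[OF W_square_integrable_Q(1)] W_square_integrable_Q(2) R0
    by (simp add: mult_left_mono)
  then show "L2norm Q ?C \<le> R * sqrt T + R * T"
    using bd(2) B(2) cQ(2) c(2) by (simp add: mult.commute)
qed

lemma feedback_terminal_wealth_norm:
  assumes wealth: "feedback_wealth P \<F> T x0 a Zb XbT W X" and sig: "sigma a > 0" and Zb: "continuous_on {0..T} Zb"
    and R: "\<bar>equilibrium_excess T x0 a Zb XbT T 0 + theta a * XbT\<bar> \<le> R"
      "\<bar>beta a * (mu a / sigma a)\<bar> \<le> R"
  shows "in_L2 P (X T)" and "L2norm P (X T) \<le> R + R * sqrt T"
proof -
  have T: "0 \<le> T" using T_pos by simp
  have R0: "0 \<le> R" using R(2) by linarith
  have c: "in_L2 P (\<lambda>\<omega>. R)" "L2norm P (\<lambda>\<omega>. R) = R"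
    using in_L2_const[OF finite_measure_axioms, of R] R0 prob_space by auto
  have nW: "L2norm P (W T) = sqrt T"
    using W_square_integrable(3)[OF T order_refl] by (simp add: L2norm_def)
  note W = W_square_integrable(1)[OF T order_refl]
  note aW = in_L2_cmult[OF in_L2_abs(1)[OF W], of R]
  note B = in_L2_add[OF c(1) aW(1)]
  have Xm: "X T \<in> borel_measurable P"
    using wealth T by (auto simp: feedback_wealth_def wealth_process_def adapted_def intro!: F_measurable_P[of _ T])
  have ae: "AE \<omega> in P. \<bar>X T \<omega>\<bar> \<le> R + R * \<bar>W T \<omega>\<bar>"
    using feedback_wealth_excess(2)[OF wealth sig Zb]
  proof eventually_elim
    case (elim \<omega>)
    have "X T \<omega> = (equilibrium_excess T x0 a Zb XbT T 0 + theta a * XbT) + beta a * (mu a / sigma a) * W T \<omega>"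
      using elim equilibrium_excess_affine[of T x0 a Zb XbT T "W T \<omega>"] by simp
    also have "\<bar>\<dots>\<bar> \<le> R + \<bar>beta a * (mu a / sigma a)\<bar> * \<bar>W T \<omega>\<bar>"
      using R(1) abs_triangle_ineq[of "equilibrium_excess T x0 a Zb XbT T 0 + theta a * XbT" "beta a * (mu a / sigma a) * W T \<omega>"]
      by (simp only: abs_mult[of "beta a * (mu a / sigma a)" "W T \<omega>"])
    also have "\<dots> \<le> R + R * \<bar>W T \<omega>\<bar>"
      by (intro add_left_mono mult_right_mono R(2)) simp
    finally show ?case .
  qed
  note bd = in_L2_bound[OF B(1) Xm ae]
  show "in_L2 P (X T)" by (rule bd(1))
  show "L2norm P (X T) \<le> R + R * sqrt T"
    using bd(2) B(2) aW(2) in_L2_abs(2)[OF W] nW c(2) R0 by simp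
qed

lemma exp_candidate_excess:
  assumes wealth: "feedback_wealth P \<F> T x0 a Zb XbT W X" and sig: "sigma a > 0" and bet: "beta a > 0"
    and Zb: "continuous_on {0..T} Zb"
  defines "y0 \<equiv> exp (- (feedback_C T a Zb XbT 0 x0 - theta a * Zb 0) / beta a)" and "l \<equiv> mu a / sigma a"
  shows "AE x in Q. exp (- (case x of (t, \<omega>) \<Rightarrow> feedback_C T a Zb XbT t (X t \<omega>) - theta a * Zb t) / beta a)
      = y0 * (case x of (t, \<omega>) \<Rightarrow> exp_mart l t \<omega>)"
    and "AE \<omega> in P. exp (- (X T \<omega> - theta a * XbT) / beta a) = y0 * exp_mart l T \<omega>"
proof -
  show "AE x in Q. exp (- (case x of (t, \<omega>) \<Rightarrow> feedback_C T a Zb XbT t (X t \<omega>) - theta a * Zb t) / beta a)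
      = y0 * (case x of (t, \<omega>) \<Rightarrow> exp_mart l t \<omega>)"
    using AE_Q_of_AE_P[OF feedback_wealth_excess(1)[OF wealth sig Zb]]
    by eventually_elim (simp only: case_prod_unfold exp_equilibrium_excess[OF bet] y0_def l_def)
  show "AE \<omega> in P. exp (- (X T \<omega> - theta a * XbT) / beta a) = y0 * exp_mart l T \<omega>"
    using feedback_wealth_excess(2)[OF wealth sig Zb]
    by eventually_elim (simp only: exp_equilibrium_excess[OF bet] y0_def l_def)
qed

end

text \<open>
  Low consumption and low wealth are bounded by the disutility that they cause.
\<close>

lemma minus_le_exp: "\<beta> > 0 \<Longrightarrow> - x \<le> \<beta> * exp (- x / \<beta>)" for x \<beta> :: real
  using exp_ge_add_one_self[of "- x / \<beta>"] by (simp add: field_simps)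

text \<open>
  The negated utilities, as functions on \<open>Q\<close> and on \<open>P\<close>, with the benchmark as the last argument.
\<close>

definition running_cost :: "agent_type \<Rightarrow> (real \<Rightarrow> 'a \<Rightarrow> real) \<Rightarrow> (real \<Rightarrow> 'a \<Rightarrow> real) \<Rightarrow> real \<times> 'a \<Rightarrow> real" where
  "running_cost a C Z = (\<lambda>(t, \<omega>). exp (- (C t \<omega> - theta a * Z t \<omega>) / beta a))"

definition terminal_cost :: "agent_type \<Rightarrow> ('a \<Rightarrow> real) \<Rightarrow> ('a \<Rightarrow> real) \<Rightarrow> 'a \<Rightarrow> real" where
  "terminal_cost a X Y = (\<lambda>\<omega>. exp (- (X \<omega> - theta a * Y \<omega>) / beta a))"

context brownian
begin

text \<open>
  The averages are arbitrary processes here, in which the agent has the weight \<open>\<eta>\<close>. The cost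
  perturbation lemma is applied on \<open>Q\<close> to consumption and on \<open>P\<close> to terminal wealth. The two linear terms
  add up to a multiple of the difference between the duality identities of the deviation and of the
  candidate, which have the same initial wealth; hence they cancel.
\<close>

theorem deviation_bound:
  fixes Zn :: "real \<Rightarrow> 'a \<Rightarrow> real" and XnT :: "'a \<Rightarrow> real" and X :: "real \<Rightarrow> 'a \<Rightarrow> real"
    and a :: agent_type and Zb :: "real \<Rightarrow> real" and XbT z0 :: real
  defines "C \<equiv> \<lambda>t \<omega>. feedback_C T a Zb XbT t (X t \<omega>)"
  assumes sig: "sigma a > 0" and bet: "beta a > 0" and the: "theta a \<ge> 0"
    and \<delta>: "\<delta> > 0" and M: "M \<ge> 0" and \<eta>: "\<eta> \<ge> 0"
    and wealth: "feedback_wealth P \<F> T x0 a Zb XbT W X" and Zb: "continuous_on {0..T} Zb"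
    and R: "\<And>t. t \<in> {0..T} \<Longrightarrow> \<bar>equilibrium_excess T x0 a Zb XbT t 0 + theta a * Zb t\<bar> \<le> R"
      "\<bar>equilibrium_excess T x0 a Zb XbT T 0 + theta a * XbT\<bar> \<le> R" "\<bar>beta a * (mu a / sigma a)\<bar> \<le> R"
    and d: "in_L2 Q (\<lambda>(t, \<omega>). Zn t \<omega> - Zb t)" "in_L2 P (\<lambda>\<omega>. XnT \<omega> - XbT)"
    and v: "in_L2 Q (running_cost a C Zn)" "L2norm Q (running_cost a C Zn) \<le> sqrt M"
      "in_L2 P (terminal_cost a (X T) XnT)" "L2norm P (terminal_cost a (X T) XnT) \<le> sqrt M"
    and wealth': "wealth_process P \<F> T x0 a W \<pi>' C' X'" and C': "progressive \<F> T C'" "square_integrable P T C'"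
    and u: "in_L2 Q (running_cost a C' (\<lambda>_ _. 0))" "L2norm Q (running_cost a C' (\<lambda>_ _. 0)) \<le> sqrt M"
      "in_L2 P (terminal_cost a (X' T) (\<lambda>_. 0))" "L2norm P (terminal_cost a (X' T) (\<lambda>_. 0)) \<le> sqrt M"
  defines "Zn' \<equiv> \<lambda>t \<omega>. Zn t \<omega> + \<eta> * (habit \<delta> z0 C' t \<omega> - habit \<delta> z0 C t \<omega>)"
    and "XnT' \<equiv> \<lambda>\<omega>. XnT \<omega> + \<eta> * (X' T \<omega> - X T \<omega>)"
  assumes fin: "integrable Q (running_cost a C' Zn')" "integrable P (terminal_cost a (X' T) XnT')"
  shows "(\<integral>x. running_cost a C Zn x \<partial>Q) + (\<integral>\<omega>. terminal_cost a (X T) XnT \<omega> \<partial>P)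
    \<le> (\<integral>x. running_cost a C' Zn' x \<partial>Q) + (\<integral>\<omega>. terminal_cost a (X' T) XnT' \<omega> \<partial>P)
      + error_constant T x0 \<delta> M a Zb XbT R
        * (L2norm Q (\<lambda>(t, \<omega>). Zn t \<omega> - Zb t) + L2norm P (\<lambda>\<omega>. XnT \<omega> - XbT) + \<eta>)"
proof -
  have T: "0 \<le> T" using T_pos by simp
  define l where "l = mu a / sigma a"
  define y0 where "y0 = exp (- (feedback_C T a Zb XbT 0 x0 - theta a * Zb 0) / beta a)"
  define U where "U = y0 * exp (l\<^sup>2 * T / 2)"
  let ?\<theta> = "theta a" and ?\<beta> = "beta a"
  have U0: "0 \<le> U" "0 \<le> y0" by (auto simp: U_def y0_def)
  have R0: "0 \<le> R" using R(3) by linarith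
  have Csq: "in_L2 Q (\<lambda>(t, \<omega>). C t \<omega>)" "L2norm Q (\<lambda>(t, \<omega>). C t \<omega>) \<le> R * sqrt T + R * T"
    unfolding C_def using feedback_consumption_norm[OF wealth sig Zb _ R(3)] R(1) by blast+
  have Cm: "(\<lambda>(t, \<omega>). C t \<omega>) \<in> borel_measurable Q" "\<And>t. t \<in> {0..T} \<Longrightarrow> C t \<in> borel_measurable (\<F> t)"
    unfolding C_def using feedback_consumption_measurable[OF wealth Zb] by blast+
  note Xsq = feedback_terminal_wealth_norm[OF wealth sig Zb R(2,3)]
  have C'sq: "in_L2 Q (\<lambda>(t, \<omega>). C' t \<omega>)"
    by (rule square_integrable_Q[OF progressive_measurable[OF C'(1) T] C'(2)])
  have C'ad: "C' t \<in> borel_measurable (\<F> t)" if "t \<in> {0..T}" for t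
    by (rule progressive_section[OF C'(1) that])
  have wealth_C: "wealth_process P \<F> T x0 a W (\<lambda>t \<omega>. feedback_pi T a t) C X"
    using wealth by (simp add: feedback_wealth_def C_def)
  have sig0: "sigma a \<noteq> 0" using sig by simp
  have dual: "in_L2 P (X T)" "(\<integral>\<omega>. exp_mart l T \<omega> * X T \<omega> \<partial>P)
      + (\<integral>x. (case x of (t, \<omega>) \<Rightarrow> exp_mart l t \<omega> * C t \<omega>) \<partial>Q) = x0 * (\<integral>\<omega>. exp_mart l T \<omega> \<partial>P)"
    using wealth_duality[OF wealth_C sig0 Csq(1) _ l_def] Cm(2) by blast+
  have dual': "in_L2 P (X' T)" "(\<integral>\<omega>. exp_mart l T \<omega> * X' T \<omega> \<partial>P)
      + (\<integral>x. (case x of (t, \<omega>) \<Rightarrow> exp_mart l t \<omega> * C' t \<omega>) \<partial>Q) = x0 * (\<integral>\<omega>. exp_mart l T \<omega> \<partial>P)"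
    using wealth_duality[OF wealth' sig0 C'sq _ l_def] C'ad by blast+
  let ?g = "\<lambda>x. case x of (t, \<omega>) \<Rightarrow> C t \<omega> - ?\<theta> * Zb t" and ?gT = "\<lambda>\<omega>. X T \<omega> - ?\<theta> * XbT"
  let ?c = "\<lambda>x. case x of (t, \<omega>) \<Rightarrow> C' t \<omega> - C t \<omega>" and ?cT = "\<lambda>\<omega>. X' T \<omega> - X T \<omega>"
  let ?d = "\<lambda>x. case x of (t, \<omega>) \<Rightarrow> Zn t \<omega> - Zb t" and ?dT = "\<lambda>\<omega>. XnT \<omega> - XbT"
  let ?Y = "\<lambda>x. case x of (t, \<omega>) \<Rightarrow> exp_mart l t \<omega>" and ?YT = "exp_mart l T"
  have g_ae: "AE x in Q. exp (- ?g x / ?\<beta>) = y0 * ?Y x" "AE \<omega> in P. exp (- ?gT \<omega> / ?\<beta>) = y0 * ?YT \<omega>"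
    unfolding C_def y0_def l_def by (rule exp_candidate_excess[OF wealth sig bet Zb])+
  have Zbm: "(\<lambda>x. Zb (fst x)) \<in> borel_measurable Q"
    by (rule measurable_compose[OF measurable_fst continuous_on_measurable_time_measure[OF Zb]])
  have gm: "(\<lambda>x. exp (- ?g x / ?\<beta>)) \<in> borel_measurable Q"
    using Cm(1) Zbm by (simp add: case_prod_unfold)
  have gTm: "(\<lambda>\<omega>. exp (- ?gT \<omega> / ?\<beta>)) \<in> borel_measurable P"
    using in_L2D(1)[OF Xsq(1)] by simp
  note Ysq = exp_mart_square_integrable_Q[of l] and YTsq = exp_mart_square_integrable[OF T order_refl, of l]
  have g: "in_L2 Q (\<lambda>x. exp (- ?g x / ?\<beta>))" "L2norm Q (\<lambda>x. exp (- ?g x / ?\<beta>)) \<le> sqrt T * U"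
  proof -
    note cm = in_L2_cmult[OF Ysq(1), of y0]
    note cg = in_L2_AE_cong[OF cm(1) gm g_ae(1)]
    show "in_L2 Q (\<lambda>x. exp (- ?g x / ?\<beta>))" by (rule cg(1))
    have "y0 * L2norm Q ?Y \<le> y0 * (sqrt T * exp (l\<^sup>2 * T / 2))"
      using Ysq(2) U0 by (intro mult_left_mono) auto
    then show "L2norm Q (\<lambda>x. exp (- ?g x / ?\<beta>)) \<le> sqrt T * U"
      unfolding cg(2) cm(2) using U0 by (simp add: U_def mult_ac)
  qed
  have gT: "in_L2 P (\<lambda>\<omega>. exp (- ?gT \<omega> / ?\<beta>))" "L2norm P (\<lambda>\<omega>. exp (- ?gT \<omega> / ?\<beta>)) = U"
  proof -
    note cm = in_L2_cmult[OF YTsq(1), of y0]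
    note cg = in_L2_AE_cong[OF cm(1) gTm g_ae(2)]
    show "in_L2 P (\<lambda>\<omega>. exp (- ?gT \<omega> / ?\<beta>))" by (rule cg(1))
    show "L2norm P (\<lambda>\<omega>. exp (- ?gT \<omega> / ?\<beta>)) = U"
      unfolding cg(2) cm(2) YTsq(2) using U0 by (simp add: U_def)
  qed
  have c: "in_L2 Q ?c"
    using in_L2_diff[OF C'sq Csq(1)] by (simp add: case_prod_unfold)
  have cT: "in_L2 P ?cT" by (rule in_L2_diff[OF dual'(1) Xsq(1)])

  have cancel: "(\<integral>x. exp (- ?g x / ?\<beta>) * ?c x \<partial>Q) + (\<integral>\<omega>. exp (- ?gT \<omega> / ?\<beta>) * ?cT \<omega> \<partial>P) = 0"
  proof -
    have i: "integrable Q (\<lambda>x. ?Y x * (case x of (t, \<omega>) \<Rightarrow> C' t \<omega>))" "integrable Q (\<lambda>x. ?Y x * (case x of (t, \<omega>) \<Rightarrow> C t \<omega>))"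
      by (rule in_L2_mult[OF Ysq(1) C'sq], rule in_L2_mult[OF Ysq(1) Csq(1)])
    have iT: "integrable P (\<lambda>\<omega>. ?YT \<omega> * X' T \<omega>)" "integrable P (\<lambda>\<omega>. ?YT \<omega> * X T \<omega>)"
      by (rule in_L2_mult[OF YTsq(1) dual'(1)], rule in_L2_mult[OF YTsq(1) dual(1)])
    have "(\<integral>x. exp (- ?g x / ?\<beta>) * ?c x \<partial>Q) =
       (\<integral>x. y0 * (?Y x * (case x of (t, \<omega>) \<Rightarrow> C' t \<omega>) - ?Y x * (case x of (t, \<omega>) \<Rightarrow> C t \<omega>)) \<partial>Q)"
    proof (rule integral_cong_AE)
      show "(\<lambda>x. exp (- ?g x / ?\<beta>) * ?c x) \<in> borel_measurable Q"
        by (intro borel_measurable_times gm in_L2D(1)[OF c])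
      show "(\<lambda>x. y0 * (?Y x * (case x of (t, \<omega>) \<Rightarrow> C' t \<omega>) - ?Y x * (case x of (t, \<omega>) \<Rightarrow> C t \<omega>))) \<in> borel_measurable Q"
        by (intro borel_measurable_times borel_measurable_diff borel_measurable_const
            in_L2D(1)[OF Ysq(1)] in_L2D(1)[OF C'sq] in_L2D(1)[OF Csq(1)])
      show "AE x in Q. exp (- ?g x / ?\<beta>) * ?c x =
          y0 * (?Y x * (case x of (t, \<omega>) \<Rightarrow> C' t \<omega>) - ?Y x * (case x of (t, \<omega>) \<Rightarrow> C t \<omega>))"
        using g_ae(1) by eventually_elim (simp add: case_prod_unfold right_diff_distrib)
    qed
    also have "\<dots> = y0 * ((\<integral>x. ?Y x * (case x of (t, \<omega>) \<Rightarrow> C' t \<omega>) \<partial>Q) - (\<integral>x. ?Y x * (case x of (t, \<omega>) \<Rightarrow> C t \<omega>) \<partial>Q))"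
      using i by simp
    finally have 1: "(\<integral>x. exp (- ?g x / ?\<beta>) * ?c x \<partial>Q) = \<dots>" .
    have "(\<integral>\<omega>. exp (- ?gT \<omega> / ?\<beta>) * ?cT \<omega> \<partial>P) = (\<integral>\<omega>. y0 * (?YT \<omega> * X' T \<omega> - ?YT \<omega> * X T \<omega>) \<partial>P)"
    proof (rule integral_cong_AE)
      show "(\<lambda>\<omega>. exp (- ?gT \<omega> / ?\<beta>) * ?cT \<omega>) \<in> borel_measurable P"
        by (intro borel_measurable_times gTm in_L2D(1)[OF cT])
      show "(\<lambda>\<omega>. y0 * (?YT \<omega> * X' T \<omega> - ?YT \<omega> * X T \<omega>)) \<in> borel_measurable P"
        by (intro borel_measurable_times borel_measurable_diff borel_measurable_const
            in_L2D(1)[OF YTsq(1)] in_L2D(1)[OF dual'(1)] in_L2D(1)[OF dual(1)])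
      show "AE \<omega> in P. exp (- ?gT \<omega> / ?\<beta>) * ?cT \<omega> = y0 * (?YT \<omega> * X' T \<omega> - ?YT \<omega> * X T \<omega>)"
        using g_ae(2) by eventually_elim (simp add: right_diff_distrib)
    qed
    also have "\<dots> = y0 * ((\<integral>\<omega>. ?YT \<omega> * X' T \<omega> \<partial>P) - (\<integral>\<omega>. ?YT \<omega> * X T \<omega> \<partial>P))"
      using iT by simp
    finally have 2: "(\<integral>\<omega>. exp (- ?gT \<omega> / ?\<beta>) * ?cT \<omega> \<partial>P) = \<dots>" .
    have "(\<integral>x. ?Y x * (case x of (t, \<omega>) \<Rightarrow> C' t \<omega>) \<partial>Q) + (\<integral>\<omega>. ?YT \<omega> * X' T \<omega> \<partial>P) =
       (\<integral>x. ?Y x * (case x of (t, \<omega>) \<Rightarrow> C t \<omega>) \<partial>Q) + (\<integral>\<omega>. ?YT \<omega> * X T \<omega> \<partial>P)"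
      using dual(2) dual'(2) by (simp add: case_prod_unfold)
    then have "y0 * (((\<integral>x. ?Y x * (case x of (t, \<omega>) \<Rightarrow> C' t \<omega>) \<partial>Q) - (\<integral>x. ?Y x * (case x of (t, \<omega>) \<Rightarrow> C t \<omega>) \<partial>Q))
      + ((\<integral>\<omega>. ?YT \<omega> * X' T \<omega> \<partial>P) - (\<integral>\<omega>. ?YT \<omega> * X T \<omega> \<partial>P))) = 0"
      by simp
    then show ?thesis unfolding 1 2 by (simp only: distrib_left)
  qed

  \<comment> \<open>By how much the deviation can lower the average habit and the average wealth: the bounds must not
    depend on the deviation, so its contribution is estimated by its disutility.\<close>
  let ?u = "running_cost a C' (\<lambda>_ _. 0)" and ?uT = "terminal_cost a (X' T) (\<lambda>_. 0)"
  let ?w = "\<lambda>s \<omega>. \<bar>C s \<omega>\<bar> + ?\<beta> * exp (- C' s \<omega> / ?\<beta>)"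
  let ?m = "\<lambda>\<omega>. \<delta> * (\<integral>s. ?w s \<omega> \<partial>time_measure T)" and ?mT = "\<lambda>\<omega>. \<bar>X T \<omega>\<bar> + ?\<beta> * exp (- X' T \<omega> / ?\<beta>)"
  have w: "in_L2 Q (\<lambda>(s, \<omega>). ?w s \<omega>)" "L2norm Q (\<lambda>(s, \<omega>). ?w s \<omega>) \<le> R * sqrt T + R * T + ?\<beta> * sqrt M"
  proof -
    note A = in_L2_abs[OF Csq(1)] and B = in_L2_cmult[OF u(1), of ?\<beta>]
    show "in_L2 Q (\<lambda>(s, \<omega>). ?w s \<omega>)"
      using in_L2_add(1)[OF A(1) B(1)] by (simp add: running_cost_def case_prod_unfold)
    have "L2norm Q (\<lambda>(s, \<omega>). ?w s \<omega>) \<le> L2norm Q (\<lambda>(t, \<omega>). C t \<omega>) + ?\<beta> * L2norm Q ?u"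
      using in_L2_add(2)[OF A(1) B(1)] A(2) B(2) bet by (simp add: running_cost_def case_prod_unfold)
    also have "\<dots> \<le> R * sqrt T + R * T + ?\<beta> * sqrt M"
      using Csq(2) u(2) bet by (intro add_mono mult_left_mono) auto
    finally show "L2norm Q (\<lambda>(s, \<omega>). ?w s \<omega>) \<le> R * sqrt T + R * T + ?\<beta> * sqrt M" .
  qed
  have mP: "in_L2 P ?m"
    by (rule in_L2_cmult(1)[OF time_integral_square_integrable(1)[OF T w(1)]])
  have m: "in_L2 Q (\<lambda>(t, \<omega>). ?m \<omega>)"
    "L2norm Q (\<lambda>(t, \<omega>). ?m \<omega>) \<le> T * \<delta> * (R * sqrt T + R * T + ?\<beta> * sqrt M)"
  proof -
    show "in_L2 Q (\<lambda>(t, \<omega>). ?m \<omega>)"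
      by (rule in_L2_Q_const_in_time(1)[OF T mP])
    have "L2norm Q (\<lambda>(t, \<omega>). ?m \<omega>) = sqrt T * (\<delta> * L2norm P (\<lambda>\<omega>. \<integral>s. ?w s \<omega> \<partial>time_measure T))"
      using in_L2_Q_const_in_time(2)[OF T mP]
        in_L2_cmult(2)[OF time_integral_square_integrable(1)[OF T w(1)], of \<delta>] \<delta> by simp
    also have "\<dots> \<le> sqrt T * (\<delta> * (sqrt T * (R * sqrt T + R * T + ?\<beta> * sqrt M)))"
    proof (intro mult_left_mono)
      have "L2norm P (\<lambda>\<omega>. \<integral>s. ?w s \<omega> \<partial>time_measure T) \<le> sqrt T * L2norm Q (\<lambda>(s, \<omega>). ?w s \<omega>)"
        by (rule time_integral_square_integrable(2)[OF T w(1)])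
      also have "\<dots> \<le> sqrt T * (R * sqrt T + R * T + ?\<beta> * sqrt M)"
        using w(2) T by (intro mult_left_mono) auto
      finally show "L2norm P (\<lambda>\<omega>. \<integral>s. ?w s \<omega> \<partial>time_measure T) \<le> sqrt T * (R * sqrt T + R * T + ?\<beta> * sqrt M)" .
    qed (use \<delta> T in auto)
    also have "\<dots> = (sqrt T * sqrt T) * \<delta> * (R * sqrt T + R * T + ?\<beta> * sqrt M)" by (simp only: mult_ac)
    also have "sqrt T * sqrt T = T" using T by simp
    finally show "L2norm Q (\<lambda>(t, \<omega>). ?m \<omega>) \<le> T * \<delta> * (R * sqrt T + R * T + ?\<beta> * sqrt M)" .
  qed
  have mT: "in_L2 P ?mT" "L2norm P ?mT \<le> R + R * sqrt T + ?\<beta> * sqrt M"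
  proof -
    note A = in_L2_abs[OF Xsq(1)] and B = in_L2_cmult[OF u(3), of ?\<beta>]
    show "in_L2 P ?mT"
      using in_L2_add(1)[OF A(1) B(1)] by (simp add: terminal_cost_def)
    have "L2norm P ?mT \<le> L2norm P (X T) + ?\<beta> * L2norm P ?uT"
      using in_L2_add(2)[OF A(1) B(1)] A(2) B(2) bet by (simp add: terminal_cost_def)
    also have "\<dots> \<le> R + R * sqrt T + ?\<beta> * sqrt M"
      using Xsq(2) u(4) bet by (intro add_mono mult_left_mono) auto
    finally show "L2norm P ?mT \<le> R + R * sqrt T + ?\<beta> * sqrt M" .
  qed

  let ?y = "\<lambda>x. case x of (t, \<omega>) \<Rightarrow> C' t \<omega> - ?\<theta> * Zn' t \<omega>" and ?yT = "\<lambda>\<omega>. X' T \<omega> - ?\<theta> * XnT' \<omega>"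
  have le: "AE x in Q. ?y x \<le> ?g x + ?c x - ?\<theta> * ?d x + ?\<theta> * \<eta> * (case x of (t, \<omega>) \<Rightarrow> ?m \<omega>)"
  proof -
    have "AE \<omega> in P. \<forall>t\<in>{0..T}. habit \<delta> z0 C t \<omega> - habit \<delta> z0 C' t \<omega> \<le> ?m \<omega>"
      using in_L2_Q_sections(2)[OF Csq(1)] in_L2_Q_sections(2)[OF C'sq]
        in_L2_Q_sections(2)[OF w(1)]
    proof eventually_elim
      case (elim \<omega>)
      note int = elim[THEN in_L2_imp_integrable[OF finite_measure_time_measure]]
      show ?case
      proof
        fix t assume t: "t \<in> {0..T}"
        show "habit \<delta> z0 C t \<omega> - habit \<delta> z0 C' t \<omega> \<le> ?m \<omega>"
        proof (rule habit_diff_le[where C = C and D = C' and m = "\<lambda>s. ?w s \<omega>", OF t \<delta> int])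
          fix s
          show "C s \<omega> - C' s \<omega> \<le> ?w s \<omega>"
            using minus_le_exp[OF bet, of "C' s \<omega>"] abs_ge_self[of "C s \<omega>"] by linarith
          show "0 \<le> ?w s \<omega>" using bet by simp
        qed
      qed
    qed
    from AE_Q_of_AE_P[OF this] show ?thesis
    proof eventually_elim
      case (elim x)
      obtain t \<omega> where x: "x = (t, \<omega>)" by (cases x)
      have "?\<theta> * \<eta> * (habit \<delta> z0 C t \<omega> - habit \<delta> z0 C' t \<omega>) \<le> ?\<theta> * \<eta> * ?m \<omega>"
        using elim the \<eta> by (intro mult_left_mono) (auto simp: x)
      then show ?case by (simp add: x Zn'_def algebra_simps)
    qed
  qed
  have leT: "AE \<omega> in P. ?yT \<omega> \<le> ?gT \<omega> + ?cT \<omega> - ?\<theta> * ?dT \<omega> + ?\<theta> * \<eta> * ?mT \<omega>"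
  proof (rule AE_I2)
    fix \<omega>
    have "X T \<omega> - X' T \<omega> \<le> ?mT \<omega>"
      using minus_le_exp[OF bet, of "X' T \<omega>"] abs_ge_self[of "X T \<omega>"] by linarith
    then have "?\<theta> * \<eta> * (X T \<omega> - X' T \<omega>) \<le> ?\<theta> * \<eta> * ?mT \<omega>"
      using the \<eta> by (intro mult_left_mono) auto
    then show "?yT \<omega> \<le> ?gT \<omega> + ?cT \<omega> - ?\<theta> * ?dT \<omega> + ?\<theta> * \<eta> * ?mT \<omega>"
      by (simp add: XnT'_def algebra_simps)
  qed
  let ?v = "running_cost a C Zn" and ?vT = "terminal_cost a (X T) XnT"
  have gd: "(\<lambda>x. exp (- (?g x - ?\<theta> * ?d x) / ?\<beta>)) = ?v" "(\<lambda>x. exp (- ?y x / ?\<beta>)) = running_cost a C' Zn'"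
    "(\<lambda>\<omega>. exp (- (?gT \<omega> - ?\<theta> * ?dT \<omega>) / ?\<beta>)) = ?vT" "(\<lambda>\<omega>. exp (- ?yT \<omega> / ?\<beta>)) = terminal_cost a (X' T) XnT'"
    by (simp_all add: running_cost_def terminal_cost_def case_prod_unfold right_diff_distrib)
  define dQ dP where "dQ = L2norm Q ?d" and "dP = L2norm P ?dT"
  have dd: "0 \<le> dQ" "0 \<le> dP" by (auto simp: dQ_def dP_def)
  have run: "(\<integral>x. ?v x \<partial>Q) \<le> (\<integral>x. running_cost a C' Zn' x \<partial>Q) + (1 / ?\<beta>) * (\<integral>x. exp (- ?g x / ?\<beta>) * ?c x \<partial>Q)
      + ?\<theta> / ?\<beta> * (L2norm Q ?v + L2norm Q (\<lambda>x. exp (- ?g x / ?\<beta>))) * dQ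
      + ?\<theta> * \<eta> / ?\<beta> * L2norm Q (\<lambda>x. exp (- ?g x / ?\<beta>)) * L2norm Q (\<lambda>(t, \<omega>). ?m \<omega>)"
    unfolding dQ_def
    by (rule exponential_cost_perturbation[OF bet the \<eta> g(1) _ c d(1) m(1) _ le finite_measure_Q, unfolded gd, OF v(1) fin(1)])
  have terminal: "(\<integral>\<omega>. ?vT \<omega> \<partial>P) \<le> (\<integral>\<omega>. terminal_cost a (X' T) XnT' \<omega> \<partial>P) + (1 / ?\<beta>) * (\<integral>\<omega>. exp (- ?gT \<omega> / ?\<beta>) * ?cT \<omega> \<partial>P)
      + ?\<theta> / ?\<beta> * (L2norm P ?vT + L2norm P (\<lambda>\<omega>. exp (- ?gT \<omega> / ?\<beta>))) * dP
      + ?\<theta> * \<eta> / ?\<beta> * L2norm P (\<lambda>\<omega>. exp (- ?gT \<omega> / ?\<beta>)) * L2norm P ?mT"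
    unfolding dP_def
    by (rule exponential_cost_perturbation[OF bet the \<eta> gT(1) _ cT d(2) mT(1) _ leT finite_measure_axioms, unfolded gd, OF v(3) fin(2)])
  define E1 E2 E3 E4 where "E1 = ?\<theta> / ?\<beta> * (sqrt M + sqrt T * U)" and "E2 = ?\<theta> / ?\<beta> * (sqrt M + U)"
    and "E3 = ?\<theta> / ?\<beta> * (sqrt T * U) * (T * \<delta> * (R * sqrt T + R * T + ?\<beta> * sqrt M))"
    and "E4 = ?\<theta> / ?\<beta> * U * (R + R * sqrt T + ?\<beta> * sqrt M)"
  have E0: "0 \<le> E1" "0 \<le> E2" "0 \<le> E3" "0 \<le> E4"
    unfolding E1_def E2_def E3_def E4_def using the bet U0 R0 M T \<delta> by (auto intro!: mult_nonneg_nonneg add_nonneg_nonneg)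
  have b1: "?\<theta> / ?\<beta> * (L2norm Q ?v + L2norm Q (\<lambda>x. exp (- ?g x / ?\<beta>))) * dQ \<le> E1 * dQ"
    unfolding E1_def using v(2) g(2) the bet dd by (intro mult_right_mono mult_left_mono add_mono) auto
  have b2: "?\<theta> / ?\<beta> * (L2norm P ?vT + L2norm P (\<lambda>\<omega>. exp (- ?gT \<omega> / ?\<beta>))) * dP \<le> E2 * dP"
    unfolding E2_def gT(2) using v(4) the bet dd by (intro mult_right_mono mult_left_mono add_mono) auto
  have b3: "?\<theta> * \<eta> / ?\<beta> * L2norm Q (\<lambda>x. exp (- ?g x / ?\<beta>)) * L2norm Q (\<lambda>(t, \<omega>). ?m \<omega>) \<le> E3 * \<eta>"
  proof -
    have "?\<theta> / ?\<beta> * L2norm Q (\<lambda>x. exp (- ?g x / ?\<beta>)) * L2norm Q (\<lambda>(t, \<omega>). ?m \<omega>) \<le> E3"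
      unfolding E3_def using g(2) m(2) the bet U0 T by (intro mult_mono mult_left_mono) auto
    then have "(?\<theta> / ?\<beta> * L2norm Q (\<lambda>x. exp (- ?g x / ?\<beta>)) * L2norm Q (\<lambda>(t, \<omega>). ?m \<omega>)) * \<eta> \<le> E3 * \<eta>"
      using \<eta> by (intro mult_right_mono)
    then show ?thesis by (simp add: mult_ac)
  qed
  have b4: "?\<theta> * \<eta> / ?\<beta> * L2norm P (\<lambda>\<omega>. exp (- ?gT \<omega> / ?\<beta>)) * L2norm P ?mT \<le> E4 * \<eta>"
  proof -
    have "?\<theta> / ?\<beta> * L2norm P (\<lambda>\<omega>. exp (- ?gT \<omega> / ?\<beta>)) * L2norm P ?mT \<le> E4"
      unfolding E4_def gT(2) using mT(2) the bet U0 by (intro mult_left_mono) auto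
    then have "(?\<theta> / ?\<beta> * L2norm P (\<lambda>\<omega>. exp (- ?gT \<omega> / ?\<beta>)) * L2norm P ?mT) * \<eta> \<le> E4 * \<eta>"
      using \<eta> by (intro mult_right_mono)
    then show ?thesis by (simp add: mult_ac)
  qed
  have cancel': "(1 / ?\<beta>) * (\<integral>x. exp (- ?g x / ?\<beta>) * ?c x \<partial>Q) + (1 / ?\<beta>) * (\<integral>\<omega>. exp (- ?gT \<omega> / ?\<beta>) * ?cT \<omega> \<partial>P) = 0"
    using cancel by (simp only: distrib_left[symmetric] mult_zero_right)
  have total: "E1 * dQ + E2 * dP + E3 * \<eta> + E4 * \<eta> \<le> (E1 + E2 + E3 + E4) * (dQ + dP + \<eta>)"
    using E0 dd \<eta> by (simp add: algebra_simps add_increasing add_increasing2)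
  have err: "error_constant T x0 \<delta> M a Zb XbT R = E1 + E2 + E3 + E4"
    by (simp add: error_constant_def Let_def E1_def E2_def E3_def E4_def U_def y0_def l_def)
  show ?thesis
    unfolding err dQ_def[symmetric] dP_def[symmetric] using run terminal b1 b2 b3 b4 cancel' total by linarith
qed

end

section \<open>The population averages\<close>

context usual_filtered_prob_space
begin

text \<open>
  Independence of the processes is stated for random paths; evaluation at time \<open>s\<close> is a measurable
  function of the path.
\<close>

lemma independent_processes_uncorrelated:
  assumes ind: "independent_processes P T W I" and ij: "i \<in> I" "j \<in> I" "i \<noteq> j" and s: "s \<in> {0..T}"
    and int: "integrable P (W i s)" "integrable P (W j s)" and zero: "(\<integral>\<omega>. W i s \<omega> \<partial>P) = 0"
  shows "(\<integral>\<omega>. W i s \<omega> * W j s \<omega> \<partial>P) = 0"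
proof -
  have "indep_vars (\<lambda>_. borel) (\<lambda>i \<omega>. (\<lambda>t\<in>{0..T}. W i t \<omega>) s) I"
    by (rule indep_vars_compose2[OF ind[unfolded independent_processes_def]])
      (rule measurable_component_singleton[OF s])
  then have "indep_vars (\<lambda>_. borel) (\<lambda>i \<omega>. W i s \<omega>) I" using s by simp
  then have "indep_vars (\<lambda>_. borel) (\<lambda>i \<omega>. W i s \<omega>) {i, j}"
    by (rule indep_vars_subset) (use ij in auto)
  from indep_vars_lebesgue_integral[OF _ this] int ij zero
  show ?thesis by auto
qed

lemma average_of_uncorrelated:
  assumes n: "n \<ge> 1" and W: "\<And>j. j \<in> {1..n} \<Longrightarrow> in_L2 P (W j)"
    and var: "\<And>j. j \<in> {1..n} \<Longrightarrow> (\<integral>\<omega>. (W j \<omega>)\<^sup>2 \<partial>P) \<le> s"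
    and cov: "\<And>i j. i \<in> {1..n} \<Longrightarrow> j \<in> {1..n} \<Longrightarrow> i \<noteq> j \<Longrightarrow> (\<integral>\<omega>. W i \<omega> * W j \<omega> \<partial>P) = 0"
    and b: "\<And>j. j \<in> {1..n} \<Longrightarrow> \<bar>b j\<bar> \<le> R"
  shows "in_L2 P (\<lambda>\<omega>. pop_mean n (\<lambda>j. b j * W j \<omega>))"
    and "L2norm P (\<lambda>\<omega>. pop_mean n (\<lambda>j. b j * W j \<omega>)) \<le> R * sqrt s / sqrt (real n)"
proof -
  have R: "0 \<le> R" using b[of 1] n by auto
  have "0 \<le> (\<integral>\<omega>. (W 1 \<omega>)\<^sup>2 \<partial>P)" by simp
  then have s: "0 \<le> s" using order_trans[OF _ var[of 1]] n by simp
  have bW: "in_L2 P (\<lambda>\<omega>. b j * W j \<omega>)" if "j \<in> {1..n}" for j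
    by (rule in_L2_cmult(1)[OF W[OF that]])
  have sq: "in_L2 P (\<lambda>\<omega>. (1 / real n) * (\<Sum>j=1..n. b j * W j \<omega>))"
    by (intro in_L2_cmult(1) in_L2_sum bW)
  then show "in_L2 P (\<lambda>\<omega>. pop_mean n (\<lambda>j. b j * W j \<omega>))"
    by (simp add: pop_mean_def)
  have hb: "has_bochner_integral P (\<lambda>\<omega>. (b i * W i \<omega>) * (b j * W j \<omega>))
      (if i = j then (b i)\<^sup>2 * (\<integral>\<omega>. (W i \<omega>)\<^sup>2 \<partial>P) else 0)" if "i \<in> {1..n}" "j \<in> {1..n}" for i j
  proof -
    have "integrable P (\<lambda>\<omega>. (b i * W i \<omega>) * (b j * W j \<omega>))"
      by (rule in_L2_mult[OF bW bW]) (use that in auto)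
    moreover have "(\<integral>\<omega>. (b i * W i \<omega>) * (b j * W j \<omega>) \<partial>P) = b i * b j * (\<integral>\<omega>. W i \<omega> * W j \<omega> \<partial>P)"
      by (subst integral_mult_right_zero[symmetric]) (simp add: mult_ac)
    ultimately show ?thesis
      using cov[OF that] by (auto simp: has_bochner_integral_iff power2_eq_square)
  qed
  have "has_bochner_integral P (\<lambda>\<omega>. \<Sum>i=1..n. \<Sum>j=1..n. (b i * W i \<omega>) * (b j * W j \<omega>))
     (\<Sum>i=1..n. \<Sum>j=1..n. if i = j then (b i)\<^sup>2 * (\<integral>\<omega>. (W i \<omega>)\<^sup>2 \<partial>P) else 0)"
    by (intro has_bochner_integral_sum hb)
  then have "(\<integral>\<omega>. (\<Sum>j=1..n. b j * W j \<omega>)\<^sup>2 \<partial>P) = (\<Sum>i=1..n. (b i)\<^sup>2 * (\<integral>\<omega>. (W i \<omega>)\<^sup>2 \<partial>P))"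
    by (simp add: has_bochner_integral_iff power2_eq_square sum_product)
  also have "\<dots> \<le> (\<Sum>i=1..n. R\<^sup>2 * s)"
  proof (intro sum_mono mult_mono)
    fix i assume "i \<in> {1..n}"
    then show "(b i)\<^sup>2 \<le> R\<^sup>2" using b[of i] R by (simp add: abs_le_square_iff[symmetric])
  qed (use var in auto)
  also have "\<dots> = real n * (R\<^sup>2 * s)" by simp
  finally have var_sum: "(\<integral>\<omega>. (\<Sum>j=1..n. b j * W j \<omega>)\<^sup>2 \<partial>P) \<le> real n * (R\<^sup>2 * s)" .
  have "(L2norm P (\<lambda>\<omega>. pop_mean n (\<lambda>j. b j * W j \<omega>)))\<^sup>2 = (\<integral>\<omega>. (\<Sum>j=1..n. b j * W j \<omega>)\<^sup>2 \<partial>P) / (real n)\<^sup>2"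
    by (simp add: L2norm_power2 pop_mean_def power_divide)
  also have "\<dots> \<le> real n * (R\<^sup>2 * s) / (real n)\<^sup>2"
    by (intro divide_right_mono var_sum) simp
  also have "\<dots> = (R * sqrt s / sqrt (real n))\<^sup>2"
    using n s by (simp add: power_divide power_mult_distrib power2_eq_square)
  finally show "L2norm P (\<lambda>\<omega>. pop_mean n (\<lambda>j. b j * W j \<omega>)) \<le> R * sqrt s / sqrt (real n)"
    by (rule power2_le_imp_le) (use R s in auto)
qed

lemma nn_integral_run_plus_terminal:
  assumes f: "(\<lambda>(t, \<omega>). f t \<omega>) \<in> borel_measurable Q" and h: "h \<in> borel_measurable P"
  shows "(\<integral>\<^sup>+\<omega>. ((\<integral>\<^sup>+t\<in>{0..T}. f t \<omega> \<partial>lborel) + h \<omega>) \<partial>P) =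
    (\<integral>\<^sup>+x. (case x of (t, \<omega>) \<Rightarrow> f t \<omega>) \<partial>Q) + (\<integral>\<^sup>+\<omega>. h \<omega> \<partial>P)"
proof -
  have "(\<lambda>(\<omega>, t). f t \<omega>) \<in> borel_measurable (P \<Otimes>\<^sub>M time_measure T)"
    using measurable_pair_swap[OF f] by (simp add: case_prod_unfold)
  then have "(\<lambda>\<omega>. \<integral>\<^sup>+t. f t \<omega> \<partial>time_measure T) \<in> borel_measurable P"
    by (rule sigma_finite_measure.borel_measurable_nn_integral[OF sigma_finite_time_measure])
  then show ?thesis
    using h nn_integral_Q[OF f] by (simp add: nn_integral_add nn_integral_time_measure)
qed

end

lemma abs_utility_power2: "\<bar>utility b y\<bar>\<^sup>2 = (exp (- y / b))\<^sup>2"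
  by (simp add: utility_def)

text \<open>
  With the integrating factor \<open>exp (\<delta> t)\<close>. The mean field habit is thus the habit generated by mean
  consumption, and comparing it with the empirical average is comparing two habits.
\<close>

lemma habit_fixed_point:
  fixes Zb m :: "real \<Rightarrow> real"
  assumes m: "continuous_on {0..T} m"
    and ode: "\<And>t. t \<in> {0..T} \<Longrightarrow> (Zb has_real_derivative - \<delta> * (Zb t - m t)) (at t within {0..T})"
    and z0: "Zb 0 = z0" and t: "t \<in> {0..T}"
  shows "Zb t = habit \<delta> z0 (\<lambda>s _. m s) t \<omega>"
proof -
  have sub: "{0..t} \<subseteq> {0..T}" using t by auto
  have "((\<lambda>s. exp (\<delta> * s) * Zb s) has_real_derivative \<delta> * exp (\<delta> * s) * m s) (at s within {0..t})"
    if "0 \<le> s" "s \<le> t" for s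
    by (rule derivative_eq_intros DERIV_subset[OF ode sub] refl | use that t in \<open>simp add: algebra_simps\<close>)+
  moreover have "continuous_on {0..t} (\<lambda>s. \<delta> * exp (\<delta> * s) * m s)"
    by (intro continuous_intros continuous_on_subset[OF m sub])
  ultimately have "(LINT s:{0..t}|lborel. \<delta> * exp (\<delta> * s) * m s) = exp (\<delta> * t) * Zb t - exp (\<delta> * 0) * Zb 0"
    using t by (intro FTC_indicator_Icc(2)[where F = "\<lambda>s. exp (\<delta> * s) * Zb s"]) auto
  then show ?thesis
    by (simp add: habit_def z0 exp_minus)
qed

context brownian
begin

lemma feedback_expectations:
  assumes wealth: "feedback_wealth P \<F> T x0 a Zb XbT W X" and sig: "sigma a > 0" and Zb: "continuous_on {0..T} Zb"
  shows "t \<in> {0..T} \<Longrightarrow> (\<integral>\<omega>. feedback_C T a Zb XbT t (X t \<omega>) \<partial>P) = equilibrium_excess T x0 a Zb XbT t 0 + theta a * Zb t"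
    and "(\<integral>\<omega>. X T \<omega> \<partial>P) = equilibrium_excess T x0 a Zb XbT T 0 + theta a * XbT"
proof -
  let ?b = "beta a * (mu a / sigma a)"
  have E: "(\<integral>\<omega>. Y \<omega> \<partial>P) = equilibrium_excess T x0 a Zb XbT t 0 + c"
    if t: "t \<in> {0..T}" and m: "Y \<in> borel_measurable P" and ae: "AE \<omega> in P. Y \<omega> - c = equilibrium_excess T x0 a Zb XbT t (W t \<omega>)"
    for Y t c
  proof -
    note W = W_square_integrable(1,2)[of t]
    have Wi: "integrable P (W t)"
      using in_L2_imp_integrable[OF finite_measure_axioms W(1)] t by auto
    have "(\<integral>\<omega>. Y \<omega> \<partial>P) = (\<integral>\<omega>. (equilibrium_excess T x0 a Zb XbT t 0 + c) + ?b * W t \<omega> \<partial>P)"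
    proof (rule integral_cong_AE[OF m])
      show "(\<lambda>\<omega>. (equilibrium_excess T x0 a Zb XbT t 0 + c) + ?b * W t \<omega>) \<in> borel_measurable P"
        using Wi by auto
      show "AE \<omega> in P. Y \<omega> = (equilibrium_excess T x0 a Zb XbT t 0 + c) + ?b * W t \<omega>"
        using ae
      proof eventually_elim
        case (elim \<omega>)
        then show ?case using equilibrium_excess_affine[of T x0 a Zb XbT t "W t \<omega>"] by linarith
      qed
    qed
    also have "\<dots> = equilibrium_excess T x0 a Zb XbT t 0 + c"
      using Wi W(2) t by (simp add: prob_space)
    finally show ?thesis .
  qed
  show "(\<integral>\<omega>. feedback_C T a Zb XbT t (X t \<omega>) \<partial>P) = equilibrium_excess T x0 a Zb XbT t 0 + theta a * Zb t"
    if t: "t \<in> {0..T}"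
  proof (rule E[OF t])
    show "(\<lambda>\<omega>. feedback_C T a Zb XbT t (X t \<omega>)) \<in> borel_measurable P"
      by (rule F_measurable_P[OF feedback_consumption_measurable(2)[OF wealth Zb t] t])
    show "AE \<omega> in P. feedback_C T a Zb XbT t (X t \<omega>) - theta a * Zb t = equilibrium_excess T x0 a Zb XbT t (W t \<omega>)"
      using feedback_wealth_excess(1)[OF wealth sig Zb] by eventually_elim (use t in auto)
  qed
  show "(\<integral>\<omega>. X T \<omega> \<partial>P) = equilibrium_excess T x0 a Zb XbT T 0 + theta a * XbT"
  proof (rule E)
    show "T \<in> {0..T}" using T_pos by simp
    then show "X T \<in> borel_measurable P"
      using wealth by (auto simp: feedback_wealth_def wealth_process_def adapted_def intro!: F_measurable_P[of _ T])
    show "AE \<omega> in P. X T \<omega> - theta a * XbT = equilibrium_excess T x0 a Zb XbT T (W T \<omega>)"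
      by (rule feedback_wealth_excess(2)[OF wealth sig Zb])
  qed
qed

end

context usual_filtered_prob_space
begin

lemma mean_habit_eq_habit_mean:
  assumes n: "n \<ge> 1" and t: "t \<in> {0..T}"
    and C: "\<And>j. j \<in> {1..n} \<Longrightarrow> integrable (time_measure T) (\<lambda>s. C j s \<omega>)"
  shows "mean_habit \<delta> z0 n C t \<omega> = habit \<delta> z0 (\<lambda>s \<omega>. pop_mean n (\<lambda>j. C j s \<omega>)) t \<omega>"
proof -
  define I where "I j = (\<integral>s. indicator {0..t} s * (\<delta> * exp (\<delta> * s) * C j s \<omega>) \<partial>time_measure T)" for j
  have "(\<integral>s. indicator {0..t} s * (\<delta> * exp (\<delta> * s) * pop_mean n (\<lambda>j. C j s \<omega>)) \<partial>time_measure T) =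
    (\<integral>s. (\<Sum>j=1..n. indicator {0..t} s * (\<delta> * exp (\<delta> * s) * C j s \<omega>)) / real n \<partial>time_measure T)"
    by (simp add: pop_mean_def sum_distrib_left)
  also have "\<dots> = (\<Sum>j=1..n. I j) / real n"
    unfolding I_def
    by (subst integral_divide_zero, subst Bochner_Integration.integral_sum) (use habit_kernel_integrable[OF C] in auto)
  finally have "habit \<delta> z0 (\<lambda>s \<omega>. pop_mean n (\<lambda>j. C j s \<omega>)) t \<omega> = exp (- \<delta> * t) * (z0 + (\<Sum>j=1..n. I j) / real n)"
    by (simp add: habit_time_measure[OF t])
  moreover have "mean_habit \<delta> z0 n C t \<omega> = (\<Sum>j=1..n. exp (- \<delta> * t) * (z0 + I j)) / real n"
    by (simp add: mean_habit_def pop_mean_def habit_time_measure[OF t] I_def)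
  moreover have "(\<Sum>j=1..n. exp (- \<delta> * t) * (z0 + I j)) = exp (- \<delta> * t) * (real n * z0 + (\<Sum>j=1..n. I j))"
    by (simp add: sum_distrib_left[symmetric] sum.distrib)
  ultimately have "real n * mean_habit \<delta> z0 n C t \<omega> =
      real n * habit \<delta> z0 (\<lambda>s \<omega>. pop_mean n (\<lambda>j. C j s \<omega>)) t \<omega>"
    using n by (simp add: field_simps)
  then show ?thesis using n by simp
qed

end

lemma pop_mean_add: "pop_mean n (\<lambda>j. f j + g j) = pop_mean n f + pop_mean n g"
  by (simp add: pop_mean_def sum.distrib add_divide_distrib)

lemma pop_mean_fun_upd:
  assumes "i \<in> {1..n}"
  shows "pop_mean n (f(i := y)) = pop_mean n f + 1 / real n * (y - f i)"
proof -
  have "(\<Sum>j=1..n. (f(i := y)) j) = y + (\<Sum>j\<in>{1..n} - {i}. f j)"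
    using assms by (subst sum.remove[of _ i]) auto
  moreover have "(\<Sum>j=1..n. f j) = f i + (\<Sum>j\<in>{1..n} - {i}. f j)"
    using assms by (subst sum.remove[of _ i]) auto
  ultimately show ?thesis by (simp add: pop_mean_def diff_divide_distrib add_divide_distrib)
qed

lemma pop_mean_classes:
  assumes "\<And>i. i \<ge> 1 \<Longrightarrow> \<alpha> i \<in> {1..K}"
  shows "pop_mean n (\<lambda>j. f (\<alpha> j)) = (\<Sum>k=1..K. class_freq \<alpha> n k * f k)"
proof -
  have "(\<Sum>j=1..n. f (\<alpha> j)) = (\<Sum>j=1..n. \<Sum>k=1..K. of_bool (\<alpha> j = k) * f k)"
  proof (rule sum.cong[OF refl])
    fix j assume "j \<in> {1..n}"
    then have "\<alpha> j \<in> {1..K}" using assms by auto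
    then show "f (\<alpha> j) = (\<Sum>k=1..K. of_bool (\<alpha> j = k) * f k)"
      by (subst sum.remove[of _ "\<alpha> j"]) (auto intro!: sum.neutral)
  qed
  also have "\<dots> = (\<Sum>k=1..K. (\<Sum>j=1..n. of_bool (\<alpha> j = k)) * f k)"
    by (subst sum.swap) (simp add: sum_distrib_right)
  finally show ?thesis
    by (simp add: pop_mean_def class_freq_def sum_divide_distrib)
qed

text \<open>
  The data of the game and its candidate strategies, fixed for the estimates at a given population
  size.
\<close>

locale mean_field_candidates = usual_filtered_prob_space P \<F> T
  for P :: "'a measure" and \<F> T +
  fixes x0 z0 \<delta> M :: real
    and K :: nat and ty :: "nat \<Rightarrow> agent_type" and \<alpha> :: "nat \<Rightarrow> nat" and F :: "nat pmf"
    and W Xs :: "nat \<Rightarrow> real \<Rightarrow> 'a \<Rightarrow> real" and B :: "real \<Rightarrow> 'a \<Rightarrow> real"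
    and Zb :: "real \<Rightarrow> real" and XbT :: real
  assumes T_pos: "T > 0" and delta_pos: "\<delta> > 0"
    and types: "\<And>k. k \<in> {1..K} \<Longrightarrow> sigma (ty k) > 0 \<and> beta (ty k) > 0 \<and> 0 < theta (ty k)"
    and classes: "\<And>i. i \<ge> 1 \<Longrightarrow> \<alpha> i \<in> {1..K}"
    and BM: "\<And>i. i \<ge> 1 \<Longrightarrow> brownian_motion P \<F> T (W i)"
    and BM_indep: "independent_processes P T W {1..}"
    and BM_representative: "brownian_motion P \<F> T B"
    and fixed_point: "mean_field_fixed_point P \<F> T x0 z0 \<delta> K ty F B Zb XbT"
    and candidate_wealth: "\<And>i. i \<ge> 1 \<Longrightarrow> feedback_wealth P \<F> T x0 (ty (\<alpha> i)) Zb XbT (W i) (Xs i)"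
    and candidate_bounds: "\<And>n i. i \<in> {1..n} \<Longrightarrow>
          utility_bounds P T \<delta> z0 M (ty (\<alpha> i)) n
            (candidate_C T (ty \<circ> \<alpha>) Zb XbT Xs) Xs (candidate_C T (ty \<circ> \<alpha>) Zb XbT Xs i) (Xs i)"
begin

abbreviation "Cs \<equiv> candidate_C T (ty \<circ> \<alpha>) Zb XbT Xs"

text \<open>
  Candidates of class \<open>k\<close> consume \<open>mean_C k t + vol k * W t\<close> and end up with wealth
  \<open>mean_X k + vol k * W T\<close>, where \<open>W\<close> is their own Brownian motion.
\<close>

definition mean_C :: "nat \<Rightarrow> real \<Rightarrow> real" where
  "mean_C k t = equilibrium_excess T x0 (ty k) Zb XbT t 0 + theta (ty k) * Zb t"

definition mean_X :: "nat \<Rightarrow> real" where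
  "mean_X k = equilibrium_excess T x0 (ty k) Zb XbT T 0 + theta (ty k) * XbT"

definition vol :: "nat \<Rightarrow> real" where
  "vol k = beta (ty k) * (mu (ty k) / sigma (ty k))"

definition freq_error :: "nat \<Rightarrow> real" where
  "freq_error n = (SUP k\<in>{1..K}. \<bar>class_freq \<alpha> n k - pmf F k\<bar>)"

lemma T_nonneg: "0 \<le> T" using T_pos by simp

lemma brownian_W: "i \<ge> 1 \<Longrightarrow> brownian P \<F> T (W i)"
  using usual_filtered_prob_space_axioms T_pos BM by (simp add: brownian_def brownian_axioms_def)

lemma brownian_B: "brownian P \<F> T B"
  using usual_filtered_prob_space_axioms T_pos BM_representative by (simp add: brownian_def brownian_axioms_def)

lemma Zb_continuous: "continuous_on {0..T} Zb"
  using fixed_point by (simp add: mean_field_fixed_point_def)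

lemma mean_C_continuous: "continuous_on {0..T} (mean_C k)"
  unfolding mean_C_def equilibrium_excess_def by (intro continuous_intros Zb_continuous) simp_all

text \<open>
  The Brownian part has mean zero, so the expectations in the fixed point equations are \<open>mean_C\<close> and
  \<open>mean_X\<close>.
\<close>

lemma fixed_point_equations:
  shows "t \<in> {0..T} \<Longrightarrow> Zb t = habit \<delta> z0 (\<lambda>s _. \<Sum>k=1..K. pmf F k * mean_C k s) t \<omega>"
    and "XbT = (\<Sum>k=1..K. pmf F k * mean_X k)"
proof -
  interpret B: brownian P \<F> T B by (rule brownian_B)
  from fixed_point obtain Xh where Xh: "\<And>k. k \<in> {1..K} \<Longrightarrow> feedback_wealth P \<F> T x0 (ty k) Zb XbT B (Xh k)"
    and ode: "\<And>t. t \<in> {0..T} \<Longrightarrow> (Zb has_real_derivative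
            - \<delta> * (Zb t - (\<Sum>k=1..K. pmf F k * (\<integral>\<omega>. feedback_C T (ty k) Zb XbT t (Xh k t \<omega>) \<partial>P)))) (at t within {0..T})"
    and z0: "Zb 0 = z0" and X: "XbT = (\<Sum>k=1..K. pmf F k * (\<integral>\<omega>. Xh k T \<omega> \<partial>P))"
    unfolding mean_field_fixed_point_def by blast
  have EC: "(\<integral>\<omega>. feedback_C T (ty k) Zb XbT t (Xh k t \<omega>) \<partial>P) = mean_C k t" if "k \<in> {1..K}" "t \<in> {0..T}" for k t
    unfolding mean_C_def by (rule B.feedback_expectations(1)[OF Xh[OF that(1)] _ Zb_continuous that(2)]) (use types that in auto)
  have EX: "(\<integral>\<omega>. Xh k T \<omega> \<partial>P) = mean_X k" if "k \<in> {1..K}" for k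
    unfolding mean_X_def by (rule B.feedback_expectations(2)[OF Xh[OF that] _ Zb_continuous]) (use types that in auto)
  show "XbT = (\<Sum>k=1..K. pmf F k * mean_X k)"
    using X EX by simp
  have ode': "(Zb has_real_derivative - \<delta> * (Zb t - (\<Sum>k=1..K. pmf F k * mean_C k t))) (at t within {0..T})"
    if "t \<in> {0..T}" for t
    using ode[OF that] EC that by simp
  show "Zb t = habit \<delta> z0 (\<lambda>s _. \<Sum>k=1..K. pmf F k * mean_C k s) t \<omega>" if "t \<in> {0..T}"
    by (rule habit_fixed_point[OF _ ode' z0 that]) (intro continuous_intros mean_C_continuous)
qed

lemma candidates_affine:
  shows "AE \<omega> in P. \<forall>j\<in>{1..n}. (\<forall>t\<in>{0..T}. Cs j t \<omega> = mean_C (\<alpha> j) t + vol (\<alpha> j) * W j t \<omega>)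
     \<and> Xs j T \<omega> = mean_X (\<alpha> j) + vol (\<alpha> j) * W j T \<omega>"
proof (rule AE_finite_allI)
  fix j assume j: "j \<in> {1..n}"
  then have j1: "j \<ge> 1" by simp
  interpret W: brownian P \<F> T "W j" by (rule brownian_W[OF j1])
  have sig: "sigma (ty (\<alpha> j)) > 0" using types[OF classes[OF j1]] by simp
  show "AE \<omega> in P. (\<forall>t\<in>{0..T}. Cs j t \<omega> = mean_C (\<alpha> j) t + vol (\<alpha> j) * W j t \<omega>)
     \<and> Xs j T \<omega> = mean_X (\<alpha> j) + vol (\<alpha> j) * W j T \<omega>"
    using W.feedback_wealth_excess[OF candidate_wealth[OF j1] sig Zb_continuous]
  proof eventually_elim
    case (elim \<omega>)
    note aff = equilibrium_excess_affine[of T x0 "ty (\<alpha> j)" Zb XbT]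
    show ?case
    proof (intro conjI ballI)
      fix t assume "t \<in> {0..T}"
      then show "Cs j t \<omega> = mean_C (\<alpha> j) t + vol (\<alpha> j) * W j t \<omega>"
        using bspec[OF elim(1), of t] aff[of t "W j t \<omega>"]
        by (simp add: candidate_C_def mean_C_def vol_def)
    next
      show "Xs j T \<omega> = mean_X (\<alpha> j) + vol (\<alpha> j) * W j T \<omega>"
        using elim(2) aff[of T "W j T \<omega>"] by (simp add: mean_X_def vol_def)
    qed
  qed
qed simp

lemma Cs_measurable:
  assumes "j \<ge> 1"
  shows "(\<lambda>(t, \<omega>). Cs j t \<omega>) \<in> borel_measurable Q"
proof -
  interpret W: brownian P \<F> T "W j" by (rule brownian_W[OF assms])
  show ?thesis
    using W.feedback_consumption_measurable(1)[OF candidate_wealth[OF assms] Zb_continuous]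
    by (simp add: candidate_C_def)
qed

lemma Xs_measurable: "j \<ge> 1 \<Longrightarrow> Xs j T \<in> borel_measurable P"
  using candidate_wealth[of j] T_nonneg
  by (auto simp: feedback_wealth_def wealth_process_def adapted_def intro!: F_measurable_P[of _ T])

lemma mean_habit_measurable: "(\<lambda>(t, \<omega>). mean_habit \<delta> z0 n Cs t \<omega>) \<in> borel_measurable Q"
proof -
  have "(\<lambda>x. habit \<delta> z0 (Cs j) (fst x) (snd x)) \<in> borel_measurable Q" if "j \<in> {1..n}" for j
    using habit_measurable[OF Cs_measurable[of j], of \<delta> z0] that by (simp add: case_prod_unfold)
  then show ?thesis by (simp add: mean_habit_def pop_mean_def case_prod_unfold)
qed

lemma pop_mean_Xs_measurable: "(\<lambda>\<omega>. pop_mean n (\<lambda>j. Xs j T \<omega>)) \<in> borel_measurable P"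
  using Xs_measurable by (simp add: pop_mean_def)

definition noise :: "nat \<Rightarrow> real \<Rightarrow> 'a \<Rightarrow> real" where
  "noise n t \<omega> = pop_mean n (\<lambda>j. vol (\<alpha> j) * W j t \<omega>)"

lemma noise_norm:
  assumes n: "n \<ge> 1" and R: "\<And>k. k \<in> {1..K} \<Longrightarrow> \<bar>vol k\<bar> \<le> R"
  shows "t \<in> {0..T} \<Longrightarrow> in_L2 P (noise n t)"
    and "t \<in> {0..T} \<Longrightarrow> L2norm P (noise n t) \<le> R * sqrt T / sqrt (real n)"
    and "in_L2 Q (\<lambda>(t, \<omega>). noise n t \<omega>)"
    and "L2norm Q (\<lambda>(t, \<omega>). noise n t \<omega>) \<le> R * T / sqrt (real n)"
proof -
  have W: "in_L2 P (W j t)" "(\<integral>\<omega>. W j t \<omega> \<partial>P) = 0" "(\<integral>\<omega>. (W j t \<omega>)\<^sup>2 \<partial>P) = t"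
    if "j \<ge> 1" "t \<in> {0..T}" for j t
    using brownian.W_square_integrable[OF brownian_W[OF that(1)], of t] that(2) by auto
  have sec: "in_L2 P (noise n t) \<and> L2norm P (noise n t) \<le> R * sqrt T / sqrt (real n)"
    if t: "t \<in> {0..T}" for t
  proof -
    have "(\<integral>\<omega>. W i t \<omega> * W j t \<omega> \<partial>P) = 0" if "i \<in> {1..n}" "j \<in> {1..n}" "i \<noteq> j" for i j
      by (rule independent_processes_uncorrelated[OF BM_indep _ _ that(3) t])
        (use that W t in \<open>auto intro: in_L2_imp_integrable[OF finite_measure_axioms]\<close>)
    then show ?thesis
      using average_of_uncorrelated[of n "\<lambda>j. W j t" T "\<lambda>j. vol (\<alpha> j)" R] n W t R classes
      by (auto simp: noise_def[abs_def])
  qed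
  then show "t \<in> {0..T} \<Longrightarrow> in_L2 P (noise n t)"
    "t \<in> {0..T} \<Longrightarrow> L2norm P (noise n t) \<le> R * sqrt T / sqrt (real n)" by auto
  have "(\<lambda>x. W j (fst x) (snd x)) \<in> borel_measurable Q" if "j \<in> {1..n}" for j
    using in_L2D(1)[OF brownian.W_square_integrable_Q(1)[OF brownian_W[of j]]] that
    by (simp add: case_prod_unfold)
  then have m: "(\<lambda>(t, \<omega>). noise n t \<omega>) \<in> borel_measurable Q"
    by (simp add: noise_def pop_mean_def case_prod_unfold)
  note Qs = in_L2_Q_of_sections[OF T_nonneg m, of "R * sqrt T / sqrt (real n)"]
  show "in_L2 Q (\<lambda>(t, \<omega>). noise n t \<omega>)" using Qs(1) sec by auto
  have "L2norm Q (\<lambda>(t, \<omega>). noise n t \<omega>) \<le> sqrt T * (R * sqrt T / sqrt (real n))" using Qs(2) sec by auto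
  also have "\<dots> = R * (sqrt T * sqrt T) / sqrt (real n)" by (simp only: mult_ac times_divide_eq_right)
  finally show "L2norm Q (\<lambda>(t, \<omega>). noise n t \<omega>) \<le> R * T / sqrt (real n)" using T_nonneg by simp
qed

lemma freq_error_bound:
  assumes "k \<in> {1..K}"
  shows "\<bar>class_freq \<alpha> n k - pmf F k\<bar> \<le> freq_error n"
  unfolding freq_error_def by (rule cSUP_upper[OF assms]) simp

lemma freq_error_nonneg: "0 \<le> freq_error n"
  using order_trans[OF abs_ge_zero freq_error_bound[OF classes[of 1]]] by simp

lemma class_average_error:
  assumes "\<And>k. k \<in> {1..K} \<Longrightarrow> \<bar>f k\<bar> \<le> R"
  shows "\<bar>pop_mean n (\<lambda>j. f (\<alpha> j)) - (\<Sum>k=1..K. pmf F k * f k)\<bar> \<le> real K * R * freq_error n"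
proof -
  have "pop_mean n (\<lambda>j. f (\<alpha> j)) - (\<Sum>k=1..K. pmf F k * f k) = (\<Sum>k=1..K. (class_freq \<alpha> n k - pmf F k) * f k)"
    by (subst pop_mean_classes[OF classes]) (auto simp: left_diff_distrib sum_subtractf)
  also have "\<bar>\<dots>\<bar> \<le> (\<Sum>k=1..K. \<bar>(class_freq \<alpha> n k - pmf F k) * f k\<bar>)" by (rule sum_abs)
  also have "\<dots> \<le> (\<Sum>k=1..K. freq_error n * R)"
    unfolding abs_mult by (intro sum_mono mult_mono freq_error_bound assms freq_error_nonneg) auto
  finally show ?thesis by (simp add: mult_ac)
qed

text \<open>
  At each time, average consumption differs from mean consumption by a frequency error of at most \<open>q\<close>
  and by the averaged noise. The habits generated by them are compared by \<open>habit_diff_le\<close>, used in both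
  directions.
\<close>

lemma mean_deviations:
  assumes n: "n \<ge> 1"
    and R: "\<And>k t. k \<in> {1..K} \<Longrightarrow> t \<in> {0..T} \<Longrightarrow> \<bar>mean_C k t\<bar> \<le> R"
      "\<And>k. k \<in> {1..K} \<Longrightarrow> \<bar>mean_X k\<bar> \<le> R" "\<And>k. k \<in> {1..K} \<Longrightarrow> \<bar>vol k\<bar> \<le> R"
  shows "in_L2 Q (\<lambda>(t, \<omega>). mean_habit \<delta> z0 n Cs t \<omega> - Zb t)"
    and "L2norm Q (\<lambda>(t, \<omega>). mean_habit \<delta> z0 n Cs t \<omega> - Zb t) \<le>
      T * \<delta> * (sqrt T * (real K * R * freq_error n) + R * T / sqrt (real n))"
    and "in_L2 P (\<lambda>\<omega>. pop_mean n (\<lambda>j. Xs j T \<omega>) - XbT)"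
    and "L2norm P (\<lambda>\<omega>. pop_mean n (\<lambda>j. Xs j T \<omega>) - XbT) \<le>
      real K * R * freq_error n + R * sqrt T / sqrt (real n)"
proof -
  define q where "q = real K * R * freq_error n"
  have R0: "0 \<le> R" using order_trans[OF abs_ge_zero R(2)[OF classes[of 1]]] by simp
  have q0: "0 \<le> q" using R0 freq_error_nonneg by (simp add: q_def)
  have noise: "t \<in> {0..T} \<Longrightarrow> in_L2 P (noise n t)"
    "t \<in> {0..T} \<Longrightarrow> L2norm P (noise n t) \<le> R * sqrt T / sqrt (real n)"
    "in_L2 Q (\<lambda>(t, \<omega>). noise n t \<omega>)" "L2norm Q (\<lambda>(t, \<omega>). noise n t \<omega>) \<le> R * T / sqrt (real n)" for t
    using noise_norm[OF n, of R] R(3) by blast+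
  have constP: "in_L2 P (\<lambda>\<omega>. q)" "L2norm P (\<lambda>\<omega>. q) = q"
    using in_L2_const[OF finite_measure_axioms, of q] q0 prob_space by auto
  let ?w = "\<lambda>s \<omega>. q + \<bar>noise n s \<omega>\<bar>" and ?m = "\<lambda>s. \<Sum>k=1..K. pmf F k * mean_C k s"
  note aN = in_L2_abs[OF noise(3)]
  note cQ = in_L2_Q_const_in_time[OF T_nonneg constP(1)]
  have w: "in_L2 Q (\<lambda>(s, \<omega>). ?w s \<omega>)"
    "L2norm Q (\<lambda>(s, \<omega>). ?w s \<omega>) \<le> sqrt T * q + R * T / sqrt (real n)"
    using in_L2_add[OF cQ(1) aN(1)] cQ(2) aN(2) constP(2) noise(4) by (simp_all add: case_prod_unfold)
  have wP: "in_L2 P (\<lambda>\<omega>. \<integral>s. ?w s \<omega> \<partial>time_measure T)"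
    "L2norm P (\<lambda>\<omega>. \<integral>s. ?w s \<omega> \<partial>time_measure T) \<le> sqrt T * (sqrt T * q + R * T / sqrt (real n))"
    using time_integral_square_integrable[OF T_nonneg w(1)] mult_left_mono[OF w(2), of "sqrt T"] T_nonneg
    by auto
  note dP = in_L2_cmult[OF wP(1), of \<delta>]
  note dQ = in_L2_Q_const_in_time[OF T_nonneg dP(1)]

  have ae: "AE \<omega> in P. \<forall>t\<in>{0..T}. \<bar>mean_habit \<delta> z0 n Cs t \<omega> - Zb t\<bar> \<le> \<delta> * (\<integral>s. ?w s \<omega> \<partial>time_measure T)"
    using candidates_affine[of n] in_L2_Q_sections(2)[OF w(1)]
      in_L2_Q_sections(2)[OF noise(3)] AE_space
  proof eventually_elim
    case (elim \<omega>)
    have wi: "integrable (time_measure T) (\<lambda>s. ?w s \<omega>)" and Ni: "integrable (time_measure T) (\<lambda>s. noise n s \<omega>)"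
      using elim(2,3) by (auto intro: in_L2_imp_integrable[OF finite_measure_time_measure])
    have Wc: "continuous_on {0..T} (\<lambda>t. W j t \<omega>)" if "j \<in> {1..n}" for j
      using BM[of j] elim(4) that by (auto simp: brownian_motion_def continuous_paths_def)
    have Ci: "integrable (time_measure T) (\<lambda>s. Cs j s \<omega>)" if j: "j \<in> {1..n}" for j
    proof -
      have "integrable (time_measure T) (\<lambda>s. mean_C (\<alpha> j) s + vol (\<alpha> j) * W j s \<omega>)"
        by (intro continuous_on_integrable_time_measure continuous_intros mean_C_continuous Wc j T_nonneg)
      then show ?thesis
        using elim(1) j by (subst Bochner_Integration.integrable_cong[OF refl]) auto
    qed
    let ?avg = "\<lambda>s \<omega>. pop_mean n (\<lambda>j. Cs j s \<omega>)"
    have avg_i: "integrable (time_measure T) (\<lambda>s. ?avg s \<omega>)"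
      unfolding pop_mean_def by (intro integrable_divide Bochner_Integration.integrable_sum Ci)
    have m_i: "integrable (time_measure T) ?m"
      by (intro continuous_on_integrable_time_measure continuous_intros mean_C_continuous T_nonneg)
    have dist: "\<bar>?avg s \<omega> - ?m s\<bar> \<le> ?w s \<omega>" if s: "s \<in> {0..T}" for s
    proof -
      have "?avg s \<omega> = pop_mean n (\<lambda>j. mean_C (\<alpha> j) s + vol (\<alpha> j) * W j s \<omega>)"
        unfolding pop_mean_def using elim(1) s by simp
      also have "\<dots> = pop_mean n (\<lambda>j. mean_C (\<alpha> j) s) + noise n s \<omega>"
        by (simp add: pop_mean_add noise_def)
      finally show ?thesis
        using class_average_error[of "\<lambda>k. mean_C k s" R n] R(1) s by (simp add: q_def)
    qed
    show ?case
    proof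
      fix t assume t: "t \<in> {0..T}"
      have 1: "mean_habit \<delta> z0 n Cs t \<omega> = habit \<delta> z0 ?avg t \<omega>"
        by (rule mean_habit_eq_habit_mean[OF n t]) (rule Ci)
      have 2: "Zb t = habit \<delta> z0 (\<lambda>s _. ?m s) t \<omega>" by (rule fixed_point_equations(1)[OF t])
      have "habit \<delta> z0 ?avg t \<omega> - habit \<delta> z0 (\<lambda>s _. ?m s) t \<omega> \<le> \<delta> * (\<integral>s. ?w s \<omega> \<partial>time_measure T)"
        by (rule habit_diff_le[where C = ?avg and D = "\<lambda>s _. ?m s" and m = "\<lambda>s. ?w s \<omega>", OF t delta_pos avg_i m_i wi])
          (use dist q0 in \<open>auto simp: abs_le_iff\<close>)
      moreover have "habit \<delta> z0 (\<lambda>s _. ?m s) t \<omega> - habit \<delta> z0 ?avg t \<omega> \<le> \<delta> * (\<integral>s. ?w s \<omega> \<partial>time_measure T)"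
        by (rule habit_diff_le[where D = ?avg and C = "\<lambda>s _. ?m s" and m = "\<lambda>s. ?w s \<omega>", OF t delta_pos m_i avg_i wi])
          (use dist q0 in \<open>auto simp: abs_le_iff\<close>)
      ultimately show "\<bar>mean_habit \<delta> z0 n Cs t \<omega> - Zb t\<bar> \<le> \<delta> * (\<integral>s. ?w s \<omega> \<partial>time_measure T)"
        unfolding 1 2 by linarith
    qed
  qed
  have ms: "(\<lambda>(t, \<omega>). mean_habit \<delta> z0 n Cs t \<omega> - Zb t) \<in> borel_measurable Q"
    using borel_measurable_diff[OF mean_habit_measurable[of n]
        measurable_compose[OF measurable_fst continuous_on_measurable_time_measure[OF Zb_continuous]]]
    by (simp add: case_prod_unfold)
  have aeQ: "AE x in Q. \<bar>case x of (t, \<omega>) \<Rightarrow> mean_habit \<delta> z0 n Cs t \<omega> - Zb t\<bar>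
      \<le> (case x of (t, \<omega>) \<Rightarrow> \<delta> * (\<integral>s. ?w s \<omega> \<partial>time_measure T))"
    using AE_Q_of_AE_P[OF ae] by (simp add: case_prod_unfold)
  note bQ = in_L2_bound[OF dQ(1) ms aeQ]
  show "in_L2 Q (\<lambda>(t, \<omega>). mean_habit \<delta> z0 n Cs t \<omega> - Zb t)" by (rule bQ(1))
  have "L2norm Q (\<lambda>(t, \<omega>). mean_habit \<delta> z0 n Cs t \<omega> - Zb t) \<le>
      sqrt T * (\<delta> * L2norm P (\<lambda>\<omega>. \<integral>s. ?w s \<omega> \<partial>time_measure T))"
    using bQ(2) dQ(2) dP(2) delta_pos by simp
  also have "\<dots> \<le> sqrt T * (\<delta> * (sqrt T * (sqrt T * q + R * T / sqrt (real n))))"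
    using wP(2) delta_pos T_nonneg by (intro mult_left_mono) auto
  also have "\<dots> = (sqrt T * sqrt T) * \<delta> * (sqrt T * q + R * T / sqrt (real n))" by (simp only: mult_ac)
  finally show "L2norm Q (\<lambda>(t, \<omega>). mean_habit \<delta> z0 n Cs t \<omega> - Zb t) \<le>
      T * \<delta> * (sqrt T * (real K * R * freq_error n) + R * T / sqrt (real n))"
    using T_nonneg by (simp add: q_def)

  have T_mem: "T \<in> {0..T}" using T_nonneg by simp
  note aT = in_L2_abs[OF noise(1)[OF T_mem]]
  note sT = in_L2_add[OF constP(1) aT(1)]
  have mT: "(\<lambda>\<omega>. pop_mean n (\<lambda>j. Xs j T \<omega>) - XbT) \<in> borel_measurable P"
    using pop_mean_Xs_measurable by simp
  have aeT: "AE \<omega> in P. \<bar>pop_mean n (\<lambda>j. Xs j T \<omega>) - XbT\<bar> \<le> q + \<bar>noise n T \<omega>\<bar>"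
    using candidates_affine[of n]
  proof eventually_elim
    case (elim \<omega>)
    have "pop_mean n (\<lambda>j. Xs j T \<omega>) = pop_mean n (\<lambda>j. mean_X (\<alpha> j) + vol (\<alpha> j) * W j T \<omega>)"
      unfolding pop_mean_def using elim by simp
    also have "\<dots> = pop_mean n (\<lambda>j. mean_X (\<alpha> j)) + noise n T \<omega>"
      by (simp add: pop_mean_add noise_def)
    finally show ?case
      using class_average_error[of mean_X R n, folded fixed_point_equations(2)] R(2) by (simp add: q_def)
  qed
  note bT = in_L2_bound[OF sT(1) mT aeT]
  show "in_L2 P (\<lambda>\<omega>. pop_mean n (\<lambda>j. Xs j T \<omega>) - XbT)" by (rule bT(1))
  show "L2norm P (\<lambda>\<omega>. pop_mean n (\<lambda>j. Xs j T \<omega>) - XbT) \<le>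
      real K * R * freq_error n + R * sqrt T / sqrt (real n)"
    using bT(2) sT(2) aT(2) noise(2)[OF T_mem] constP(2) by (simp add: q_def)
qed

end

section \<open>The approximate Nash equilibrium\<close>

lemma error_constant_nonneg:
  assumes "0 \<le> theta a" "0 < beta a" "0 \<le> M" "0 \<le> R" "0 \<le> \<delta>" "0 \<le> T"
  shows "0 \<le> error_constant T x0 \<delta> M a Zb XbT R"
  unfolding error_constant_def Let_def using assms
  by (intro add_nonneg_nonneg mult_nonneg_nonneg divide_nonneg_nonneg) auto

context mean_field_candidates
begin

lemma M_nonneg: "0 \<le> M"
proof (rule ccontr)
  assume "\<not> 0 \<le> M"
  then have "ennreal M = 0" by (simp add: ennreal_neg)
  then show False using candidate_bounds[of 1 1] by (simp add: utility_bounds_def)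
qed

text \<open>
  There are finitely many classes, so one constant serves for all of them.
\<close>

lemma class_functions_bounded:
  obtains R where "\<And>k t. k \<in> {1..K} \<Longrightarrow> t \<in> {0..T} \<Longrightarrow> \<bar>mean_C k t\<bar> \<le> R"
    "\<And>k. k \<in> {1..K} \<Longrightarrow> \<bar>mean_X k\<bar> \<le> R" "\<And>k. k \<in> {1..K} \<Longrightarrow> \<bar>vol k\<bar> \<le> R"
proof -
  have "\<exists>r. \<forall>t\<in>{0..T}. \<bar>mean_C k t\<bar> \<le> r" for k
  proof -
    have "bounded (mean_C k ` {0..T})"
      by (intro compact_imp_bounded compact_continuous_image mean_C_continuous) simp
    then show ?thesis by (auto simp: bounded_iff)
  qed
  then obtain r where r: "\<And>k t. t \<in> {0..T} \<Longrightarrow> \<bar>mean_C k t\<bar> \<le> r k" by metis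
  define R where "R = (\<Sum>k=1..K. r k + \<bar>mean_X k\<bar> + \<bar>vol k\<bar>)"
  have r0: "0 \<le> r k" for k
    using order_trans[OF abs_ge_zero r[of 0 k]] T_nonneg by simp
  have "r k + \<bar>mean_X k\<bar> + \<bar>vol k\<bar> \<le> R" if "k \<in> {1..K}" for k
    unfolding R_def by (rule member_le_sum[OF that]) (use r0 in auto)
  then have R: "r k \<le> R" "\<bar>mean_X k\<bar> \<le> R" "\<bar>vol k\<bar> \<le> R" if "k \<in> {1..K}" for k
    using that r0[of k] abs_ge_zero[of "mean_X k"] abs_ge_zero[of "vol k"] by fastforce+
  show ?thesis
  proof (rule that[of R])
    fix k t assume "k \<in> {1..K}" "t \<in> {0..T}"
    then show "\<bar>mean_C k t\<bar> \<le> R" using r[of t k] R(1)[of k] by linarith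
  qed (use R in auto)
qed

lemma running_cost_measurable:
  assumes "(\<lambda>(t, \<omega>). C t \<omega>) \<in> borel_measurable Q" "(\<lambda>(t, \<omega>). Z t \<omega>) \<in> borel_measurable Q"
  shows "running_cost a C Z \<in> borel_measurable Q"
  using assms by (simp add: running_cost_def case_prod_unfold)

lemma terminal_cost_measurable:
  assumes "X \<in> borel_measurable P" "Y \<in> borel_measurable P"
  shows "terminal_cost a X Y \<in> borel_measurable P"
  using assms by (simp add: terminal_cost_def)

lemma utility_bound_L2norm:
  assumes r: "running_cost a C Z \<in> borel_measurable Q" and s: "terminal_cost a X Y \<in> borel_measurable P"
    and lt: "(\<integral>\<^sup>+\<omega>. ((\<integral>\<^sup>+t\<in>{0..T}. ennreal (\<bar>utility (beta a) (C t \<omega> - theta a * Z t \<omega>)\<bar>\<^sup>2) \<partial>lborel)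
         + ennreal (\<bar>utility (beta a) (X \<omega> - theta a * Y \<omega>)\<bar>\<^sup>2)) \<partial>P) < ennreal M"
  shows "in_L2 Q (running_cost a C Z)" "L2norm Q (running_cost a C Z) \<le> sqrt M"
    and "in_L2 P (terminal_cost a X Y)" "L2norm P (terminal_cost a X Y) \<le> sqrt M"
proof -
  have r2: "(\<lambda>(t, \<omega>). ennreal ((running_cost a C Z (t, \<omega>))\<^sup>2)) \<in> borel_measurable Q"
    and s2: "(\<lambda>\<omega>. ennreal ((terminal_cost a X Y \<omega>)\<^sup>2)) \<in> borel_measurable P"
    using r s by (simp_all add: case_prod_unfold)
  have "(\<integral>\<^sup>+x. ennreal ((running_cost a C Z x)\<^sup>2) \<partial>Q) + (\<integral>\<^sup>+\<omega>. ennreal ((terminal_cost a X Y \<omega>)\<^sup>2) \<partial>P) < ennreal M"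
    using lt nn_integral_run_plus_terminal[OF r2 s2]
    unfolding abs_utility_power2 by (simp add: case_prod_unfold running_cost_def terminal_cost_def)
  then have "(\<integral>\<^sup>+x. ennreal ((running_cost a C Z x)\<^sup>2) \<partial>Q) \<le> ennreal M"
    "(\<integral>\<^sup>+\<omega>. ennreal ((terminal_cost a X Y \<omega>)\<^sup>2) \<partial>P) \<le> ennreal M"
    by (meson add_increasing add_increasing2 dual_order.strict_trans1 less_imp_le order_refl order_trans zero_le)+
  then show "in_L2 Q (running_cost a C Z)" "L2norm Q (running_cost a C Z) \<le> sqrt M"
    "in_L2 P (terminal_cost a X Y)" "L2norm P (terminal_cost a X Y) \<le> sqrt M"
    using in_L2I_nn_integral[OF r _ M_nonneg] in_L2I_nn_integral[OF s _ M_nonneg] by blast+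
qed

lemma utility_bounds_L2norm:
  assumes bounds: "utility_bounds P T \<delta> z0 M a n Cs Xs C X"
    and C: "(\<lambda>(t, \<omega>). C t \<omega>) \<in> borel_measurable Q" and X: "X T \<in> borel_measurable P"
  defines "Z \<equiv> mean_habit \<delta> z0 n Cs" and "Y \<equiv> \<lambda>\<omega>. pop_mean n (\<lambda>j. Xs j T \<omega>)"
  shows "in_L2 Q (running_cost a C Z)" "L2norm Q (running_cost a C Z) \<le> sqrt M"
    and "in_L2 P (terminal_cost a (X T) Y)" "L2norm P (terminal_cost a (X T) Y) \<le> sqrt M"
    and "in_L2 Q (running_cost a C (\<lambda>_ _. 0))" "L2norm Q (running_cost a C (\<lambda>_ _. 0)) \<le> sqrt M"
    and "in_L2 P (terminal_cost a (X T) (\<lambda>_. 0))" "L2norm P (terminal_cost a (X T) (\<lambda>_. 0)) \<le> sqrt M"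
proof -
  have "running_cost a C Z \<in> borel_measurable Q" "terminal_cost a (X T) Y \<in> borel_measurable P"
    unfolding Z_def Y_def
    by (intro running_cost_measurable terminal_cost_measurable C X mean_habit_measurable pop_mean_Xs_measurable)+
  from utility_bound_L2norm[OF this]
  show "in_L2 Q (running_cost a C Z)" "L2norm Q (running_cost a C Z) \<le> sqrt M"
    "in_L2 P (terminal_cost a (X T) Y)" "L2norm P (terminal_cost a (X T) Y) \<le> sqrt M"
    using bounds by (simp_all add: utility_bounds_def Z_def Y_def)
  have "running_cost a C (\<lambda>_ _. 0) \<in> borel_measurable Q" "terminal_cost a (X T) (\<lambda>_. 0) \<in> borel_measurable P"
    by (intro running_cost_measurable terminal_cost_measurable C X; simp)+
  from utility_bound_L2norm[OF this]
  show "in_L2 Q (running_cost a C (\<lambda>_ _. 0))" "L2norm Q (running_cost a C (\<lambda>_ _. 0)) \<le> sqrt M"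
    "in_L2 P (terminal_cost a (X T) (\<lambda>_. 0))" "L2norm P (terminal_cost a (X T) (\<lambda>_. 0)) \<le> sqrt M"
    using bounds by (simp_all add: utility_bounds_def)
qed

text \<open>
  A deviation of infinite cost has the objective \<open>-\<infinity>\<close> and cannot be an improvement. For all others the
  objectives are real integrals, for which the inequality is assumed.
\<close>

lemma objective_le:
  fixes ag :: "nat \<Rightarrow> agent_type" and i n :: nat and C C' X X' :: "nat \<Rightarrow> real \<Rightarrow> 'a \<Rightarrow> real"
  defines "a \<equiv> ag i"
  defines "r \<equiv> \<lambda>C. running_cost a (C i) (mean_habit \<delta> z0 n C)"
    and "s \<equiv> \<lambda>X. terminal_cost a (X i T) (\<lambda>\<omega>. pop_mean n (\<lambda>j. X j T \<omega>))"
  assumes m: "r C' \<in> borel_measurable Q" "s X' \<in> borel_measurable P"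
    and i: "integrable Q (r C)" "integrable P (s X)"
    and le: "integrable Q (r C') \<Longrightarrow> integrable P (s X') \<Longrightarrow>
      (\<integral>x. r C x \<partial>Q) + (\<integral>\<omega>. s X \<omega> \<partial>P) \<le> (\<integral>x. r C' x \<partial>Q) + (\<integral>\<omega>. s X' \<omega> \<partial>P) + \<epsilon>"
  shows "objective P T \<delta> z0 ag n i C' X' \<le> objective P T \<delta> z0 ag n i C X + ereal \<epsilon>"
proof -
  have obj: "objective P T \<delta> z0 ag n i C X = - enn2ereal ((\<integral>\<^sup>+x. ennreal (r C x) \<partial>Q) + (\<integral>\<^sup>+\<omega>. ennreal (s X \<omega>) \<partial>P))"
    if "r C \<in> borel_measurable Q" "s X \<in> borel_measurable P" for C X
  proof -
    have "(\<lambda>(t, \<omega>). ennreal (r C (t, \<omega>))) \<in> borel_measurable Q" "(\<lambda>\<omega>. ennreal (s X \<omega>)) \<in> borel_measurable P"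
      using that by (simp_all add: case_prod_unfold)
    from nn_integral_run_plus_terminal[OF this] show ?thesis
      by (simp add: objective_def utility_def r_def s_def a_def running_cost_def terminal_cost_def case_prod_unfold)
  qed
  have nonneg: "0 \<le> r C x" "0 \<le> s X \<omega>" for C X x \<omega>
    by (simp_all add: r_def s_def running_cost_def terminal_cost_def case_prod_unfold)
  have fin: "- enn2ereal ((\<integral>\<^sup>+x. ennreal (r C x) \<partial>Q) + (\<integral>\<^sup>+\<omega>. ennreal (s X \<omega>) \<partial>P)) =
      - ereal ((\<integral>x. r C x \<partial>Q) + (\<integral>\<omega>. s X \<omega> \<partial>P))"
    if "integrable Q (r C)" "integrable P (s X)" for C X
  proof -
    have "0 \<le> (\<integral>x. r C x \<partial>Q)" "0 \<le> (\<integral>\<omega>. s X \<omega> \<partial>P)"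
      using nonneg by (auto intro!: Bochner_Integration.integral_nonneg)
    then show ?thesis
      using nn_integral_eq_integral[OF that(1)] nn_integral_eq_integral[OF that(2)] nonneg
      by (simp add: ennreal_plus[symmetric] enn2ereal_ennreal del: ennreal_plus)
  qed
  show ?thesis
  proof (cases "(\<integral>\<^sup>+x. ennreal (r C' x) \<partial>Q) + (\<integral>\<^sup>+\<omega>. ennreal (s X' \<omega>) \<partial>P) = \<infinity>")
    case True
    then show ?thesis unfolding obj[OF m] True by simp
  next
    case False
    have i': "integrable Q (r C')" "integrable P (s X')"
      by (rule integrableI_nonneg; use m nonneg False in \<open>auto simp: less_top\<close>)+
    show ?thesis
      unfolding obj[OF borel_measurable_integrable[OF i(1)] borel_measurable_integrable[OF i(2)]] obj[OF m]
        fin[OF i] fin[OF i'] using le[OF i'] by simp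
  qed
qed

text \<open>
  The constants are summed over the classes, so that the bound depends on the population only through \<open>n\<close> and the frequency error.
\<close>

lemma candidates_eps_nash:
  assumes n: "n \<ge> 1"
    and R: "\<And>k t. k \<in> {1..K} \<Longrightarrow> t \<in> {0..T} \<Longrightarrow> \<bar>mean_C k t\<bar> \<le> R"
      "\<And>k. k \<in> {1..K} \<Longrightarrow> \<bar>mean_X k\<bar> \<le> R" "\<And>k. k \<in> {1..K} \<Longrightarrow> \<bar>vol k\<bar> \<le> R"
  defines "A \<equiv> \<Sum>k=1..K. error_constant T x0 \<delta> M (ty k) Zb XbT R"
    and "D \<equiv> (T * \<delta> * sqrt T + 1) * (real K * R) * freq_error n + (T * \<delta> * T + sqrt T) * R / sqrt (real n)"
  shows "eps_nash_equilibrium P \<F> T x0 z0 \<delta> M (ty \<circ> \<alpha>) W n (candidate_pi T (ty \<circ> \<alpha>)) Cs Xs (A * (D + 1 / real n))"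
  unfolding eps_nash_equilibrium_def
proof (intro conjI ballI allI impI)
  fix j assume "j \<in> {1..n}"
  then show "wealth_process P \<F> T x0 ((ty \<circ> \<alpha>) j) (W j) (candidate_pi T (ty \<circ> \<alpha>) j) (Cs j) (Xs j)"
    using candidate_wealth[of j] by (simp add: feedback_wealth_def candidate_pi_def[abs_def] candidate_C_def[abs_def])
next
  fix i \<pi>' C' X'
  assume i: "i \<in> {1..n}" and adm: "admissible P \<F> T x0 z0 \<delta> M ((ty \<circ> \<alpha>) i) (W i) n Cs Xs \<pi>' C' X'"
  then have i1: "i \<ge> 1" by simp
  let ?k = "\<alpha> i" and ?a = "ty (\<alpha> i)"
  have k: "?k \<in> {1..K}" by (rule classes[OF i1])
  interpret W: brownian P \<F> T "W i" by (rule brownian_W[OF i1])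
  have a: "sigma ?a > 0" "beta ?a > 0" "theta ?a \<ge> 0" using types[OF k] by auto
  have R0: "0 \<le> R" using order_trans[OF abs_ge_zero R(2)[OF k]] .
  have err0: "0 \<le> error_constant T x0 \<delta> M (ty k) Zb XbT R" if "k \<in> {1..K}" for k
    using types[OF that] M_nonneg R0 delta_pos T_nonneg by (intro error_constant_nonneg) auto
  have C'p: "progressive \<F> T C'" "square_integrable P T C'" and wealth': "wealth_process P \<F> T x0 ?a (W i) \<pi>' C' X'"
    and ub: "utility_bounds P T \<delta> z0 M ?a n Cs Xs C' X'"
    using adm by (auto simp: admissible_def)
  have C'm: "(\<lambda>(t, \<omega>). C' t \<omega>) \<in> borel_measurable Q" by (rule progressive_measurable[OF C'p(1) T_nonneg])
  have X'm: "X' T \<in> borel_measurable P"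
    using wealth' T_nonneg by (auto simp: wealth_process_def adapted_def intro!: F_measurable_P[of _ T])
  note dev = utility_bounds_L2norm[OF ub C'm X'm]
  note cand = utility_bounds_L2norm[OF candidate_bounds[OF i] Cs_measurable[OF i1] Xs_measurable[OF i1]]
  have md: "in_L2 Q (\<lambda>(t, \<omega>). mean_habit \<delta> z0 n Cs t \<omega> - Zb t)"
    "L2norm Q (\<lambda>(t, \<omega>). mean_habit \<delta> z0 n Cs t \<omega> - Zb t) \<le>
      T * \<delta> * (sqrt T * (real K * R * freq_error n) + R * T / sqrt (real n))"
    "in_L2 P (\<lambda>\<omega>. pop_mean n (\<lambda>j. Xs j T \<omega>) - XbT)"
    "L2norm P (\<lambda>\<omega>. pop_mean n (\<lambda>j. Xs j T \<omega>) - XbT) \<le>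
      real K * R * freq_error n + R * sqrt T / sqrt (real n)"
    using mean_deviations[OF n, of R] R by blast+
  let ?C = "Cs(i := C')" and ?X = "Xs(i := X')"
  have Zdev: "mean_habit \<delta> z0 n ?C t \<omega> =
      mean_habit \<delta> z0 n Cs t \<omega> + 1 / real n * (habit \<delta> z0 C' t \<omega> - habit \<delta> z0 (Cs i) t \<omega>)" for t \<omega>
  proof -
    have "(\<lambda>j. habit \<delta> z0 (?C j) t \<omega>) = (\<lambda>j. habit \<delta> z0 (Cs j) t \<omega>)(i := habit \<delta> z0 C' t \<omega>)" by auto
    then show ?thesis unfolding mean_habit_def by (simp add: pop_mean_fun_upd[OF i] del: fun_upd_apply)
  qed
  have Xdev: "pop_mean n (\<lambda>j. ?X j T \<omega>) = pop_mean n (\<lambda>j. Xs j T \<omega>) + 1 / real n * (X' T \<omega> - Xs i T \<omega>)" for \<omega>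
  proof -
    have "(\<lambda>j. ?X j T \<omega>) = (\<lambda>j. Xs j T \<omega>)(i := X' T \<omega>)" by auto
    then show ?thesis by (simp add: pop_mean_fun_upd[OF i] del: fun_upd_apply)
  qed
  have "A * (D + 1 / real n) \<ge> error_constant T x0 \<delta> M ?a Zb XbT R
      * (L2norm Q (\<lambda>(t, \<omega>). mean_habit \<delta> z0 n Cs t \<omega> - Zb t) + L2norm P (\<lambda>\<omega>. pop_mean n (\<lambda>j. Xs j T \<omega>) - XbT) + 1 / real n)"
  proof (rule mult_mono)
    show "error_constant T x0 \<delta> M ?a Zb XbT R \<le> A"
      unfolding A_def by (rule member_le_sum[OF k]) (use err0 in auto)
    show "0 \<le> A" unfolding A_def by (intro sum_nonneg err0)
    have "T * \<delta> * (sqrt T * (real K * R * freq_error n) + R * T / sqrt (real n))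
      + (real K * R * freq_error n + R * sqrt T / sqrt (real n)) = D"
      by (simp add: D_def algebra_simps add_divide_distrib)
    then show "L2norm Q (\<lambda>(t, \<omega>). mean_habit \<delta> z0 n Cs t \<omega> - Zb t)
        + L2norm P (\<lambda>\<omega>. pop_mean n (\<lambda>j. Xs j T \<omega>) - XbT) + 1 / real n \<le> D + 1 / real n"
      using md(2,4) by linarith
  qed (auto intro: add_nonneg_nonneg)
  note eps = this
  have Csi: "Cs i = (\<lambda>t \<omega>. feedback_C T ?a Zb XbT t (Xs i t \<omega>))"
    by (simp add: candidate_C_def[abs_def])
  have Csi_m: "(\<lambda>(t, \<omega>). habit \<delta> z0 (Cs i) t \<omega>) \<in> borel_measurable Q"
    "(\<lambda>(t, \<omega>). habit \<delta> z0 C' t \<omega>) \<in> borel_measurable Q"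
    by (intro habit_measurable Cs_measurable i1 C'm)+
  have Zm: "(\<lambda>(t, \<omega>). mean_habit \<delta> z0 n ?C t \<omega>) \<in> borel_measurable Q"
    using mean_habit_measurable[of n] Csi_m by (simp add: Zdev case_prod_unfold)
  have Xm: "(\<lambda>\<omega>. pop_mean n (\<lambda>j. ?X j T \<omega>)) \<in> borel_measurable P"
    unfolding Xdev using X'm Xs_measurable[OF i1] pop_mean_Xs_measurable by simp
  let ?run = "\<lambda>C. running_cost ?a (C i) (mean_habit \<delta> z0 n C)"
  let ?end = "\<lambda>X. terminal_cost ?a (X i T) (\<lambda>\<omega>. pop_mean n (\<lambda>j. X j T \<omega>))"
  have bound: "(\<integral>x. ?run Cs x \<partial>Q) + (\<integral>\<omega>. ?end Xs \<omega> \<partial>P) \<le>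
      (\<integral>x. ?run ?C x \<partial>Q) + (\<integral>\<omega>. ?end ?X \<omega> \<partial>P) + A * (D + 1 / real n)"
    if fin: "integrable Q (?run ?C)" "integrable P (?end ?X)"
  proof -
    have eq: "?run ?C = running_cost ?a C' (\<lambda>t \<omega>. mean_habit \<delta> z0 n Cs t \<omega>
        + 1 / real n * (habit \<delta> z0 C' t \<omega> - habit \<delta> z0 (\<lambda>t \<omega>. feedback_C T ?a Zb XbT t (Xs i t \<omega>)) t \<omega>))"
      "?end ?X = terminal_cost ?a (X' T) (\<lambda>\<omega>. pop_mean n (\<lambda>j. Xs j T \<omega>) + 1 / real n * (X' T \<omega> - Xs i T \<omega>))"
      using Zdev Xdev by (simp_all add: running_cost_def terminal_cost_def Csi)
    have "(\<integral>x. ?run Cs x \<partial>Q) + (\<integral>\<omega>. ?end Xs \<omega> \<partial>P) \<le> (\<integral>x. ?run ?C x \<partial>Q) + (\<integral>\<omega>. ?end ?X \<omega> \<partial>P)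
      + error_constant T x0 \<delta> M ?a Zb XbT R
        * (L2norm Q (\<lambda>(t, \<omega>). mean_habit \<delta> z0 n Cs t \<omega> - Zb t) + L2norm P (\<lambda>\<omega>. pop_mean n (\<lambda>j. Xs j T \<omega>) - XbT) + 1 / real n)"
      unfolding eq Csi
    proof (rule W.deviation_bound)
      show "\<bar>equilibrium_excess T x0 ?a Zb XbT t 0 + theta ?a * Zb t\<bar> \<le> R" if "t \<in> {0..T}" for t
        using R(1)[OF k that] by (simp add: mean_C_def)
      show "\<bar>equilibrium_excess T x0 ?a Zb XbT T 0 + theta ?a * XbT\<bar> \<le> R"
        using R(2)[OF k] by (simp add: mean_X_def)
      show "\<bar>beta ?a * (mu ?a / sigma ?a)\<bar> \<le> R"
        using R(3)[OF k] by (simp add: vol_def)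
    qed (rule a delta_pos M_nonneg Zb_continuous candidate_wealth[OF i1] wealth' md(1,3) dev(5-8)
        cand(1-4)[unfolded Csi] C'p fin[unfolded eq] | simp)+
    then show ?thesis using eps by linarith
  qed
  have "?run ?C \<in> borel_measurable Q" "?end ?X \<in> borel_measurable P"
    using running_cost_measurable[of C', OF C'm Zm] terminal_cost_measurable[OF X'm Xm] by simp_all
  moreover have "integrable Q (?run Cs)" "integrable P (?end Xs)"
    by (rule in_L2_imp_integrable[OF finite_measure_Q cand(1)]
      in_L2_imp_integrable[OF finite_measure_axioms cand(3)])+
  ultimately show "objective P T \<delta> z0 (ty \<circ> \<alpha>) n i ?C ?X \<le> objective P T \<delta> z0 (ty \<circ> \<alpha>) n i Cs Xs + ereal (A * (D + 1 / real n))"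
    using objective_le[where ag = "ty \<circ> \<alpha>" and i = i and n = n and C' = ?C and X' = ?X and C = Cs and X = Xs
        and \<epsilon> = "A * (D + 1 / real n)"] bound by (simp only: comp_apply)
qed

end

theorem theorem4p2:
  fixes P :: "'a measure" and \<F> :: "real \<Rightarrow> 'a measure"
    and T x0 z0 \<delta> M :: real
    and K :: nat and ty :: "nat \<Rightarrow> agent_type" and \<alpha> :: "nat \<Rightarrow> nat" and F :: "nat pmf"
    and W Xs :: "nat \<Rightarrow> real \<Rightarrow> 'a \<Rightarrow> real" and B :: "real \<Rightarrow> 'a \<Rightarrow> real"
    and Zb :: "real \<Rightarrow> real" and XbT :: real
  assumes "T > 0" "x0 > 0" "z0 > 0" "\<delta> > 0"
    and types: "\<And>k. k \<in> {1..K} \<Longrightarrow>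
          mu (ty k) > 0 \<and> sigma (ty k) > 0 \<and> beta (ty k) > 0 \<and> 0 < theta (ty k) \<and> theta (ty k) \<le> 1"
    and classes: "\<And>i. i \<ge> 1 \<Longrightarrow> \<alpha> i \<in> {1..K}"
    and F_support: "set_pmf F \<subseteq> {1..K}"
    and freq_limit: "\<And>k. k \<in> {1..K} \<Longrightarrow> (\<lambda>n. class_freq \<alpha> n k) \<longlonglongrightarrow> pmf F k"
    and freq_rate: "(\<lambda>n. SUP k\<in>{1..K}. \<bar>class_freq \<alpha> n k - pmf F k\<bar>) \<in> O(\<lambda>n. real n powr (-1/2))"
    and space: "usual_filtered_prob_space P \<F> T"
    and BM: "\<And>i. i \<ge> 1 \<Longrightarrow> brownian_motion P \<F> T (W i)"
    and BM_indep: "independent_processes P T W {1..}"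
    and BM_representative: "brownian_motion P \<F> T B"
    and fixed_point: "mean_field_fixed_point P \<F> T x0 z0 \<delta> K ty F B Zb XbT"
    and candidate_wealth: "\<And>i. i \<ge> 1 \<Longrightarrow> feedback_wealth P \<F> T x0 (ty (\<alpha> i)) Zb XbT (W i) (Xs i)"
    and candidate_bounds: "\<And>n i. i \<in> {1..n} \<Longrightarrow>
          utility_bounds P T \<delta> z0 M (ty (\<alpha> i)) n
            (candidate_C T (ty \<circ> \<alpha>) Zb XbT Xs) Xs (candidate_C T (ty \<circ> \<alpha>) Zb XbT Xs i) (Xs i)"
  shows "\<exists>\<epsilon> :: nat \<Rightarrow> real. \<epsilon> \<in> O(\<lambda>n. real n powr (-1/2)) \<and>
          (\<forall>n\<ge>1. eps_nash_equilibrium P \<F> T x0 z0 \<delta> M (ty \<circ> \<alpha>) W n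
             (candidate_pi T (ty \<circ> \<alpha>)) (candidate_C T (ty \<circ> \<alpha>) Zb XbT Xs) Xs (\<epsilon> n))"
proof -
  interpret space: usual_filtered_prob_space P \<F> T by (rule space)
  interpret G: mean_field_candidates P \<F> T x0 z0 \<delta> M K ty \<alpha> F W Xs B Zb XbT
    using assms(1,4) types classes BM BM_indep BM_representative fixed_point candidate_wealth candidate_bounds
    by unfold_locales auto
  obtain R where R: "\<And>k t. k \<in> {1..K} \<Longrightarrow> t \<in> {0..T} \<Longrightarrow> \<bar>G.mean_C k t\<bar> \<le> R"
    "\<And>k. k \<in> {1..K} \<Longrightarrow> \<bar>G.mean_X k\<bar> \<le> R" "\<And>k. k \<in> {1..K} \<Longrightarrow> \<bar>G.vol k\<bar> \<le> R"
    using G.class_functions_bounded by blast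
  let ?r = "\<lambda>n. real n powr (-1/2)"
  define A where "A = (\<Sum>k=1..K. error_constant T x0 \<delta> M (ty k) Zb XbT R)"
  define c1 where "c1 = (T * \<delta> * sqrt T + 1) * (real K * R)"
  define c2 where "c2 = (T * \<delta> * T + sqrt T) * R"
  \<comment> \<open>The frequency error itself is part of \<open>\<epsilon>\<close>, so its rate is inherited from the assumption and the
    bound holds for every \<open>n \<ge> 1\<close>.\<close>
  define \<epsilon> where "\<epsilon> n = A * (c1 * G.freq_error n + c2 / sqrt (real n) + 1 / real n)" for n
  have rate: "?r n = 1 / sqrt (real n)" for n :: nat
    using powr_minus_divide[of "real n" "1/2"] powr_half_sqrt[of "real n"] by simp
  have sqrt_eq: "(\<lambda>n. 1 / sqrt (real n)) \<in> O(?r)" unfolding rate by simp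
  have inv: "(\<lambda>n. 1 / real n) \<in> O(?r)" unfolding rate
  proof (rule bigoI[of _ 1])
    show "eventually (\<lambda>n. norm (1 / real n) \<le> 1 * norm (1 / sqrt (real n))) sequentially"
      using eventually_gt_at_top[of 0]
    proof eventually_elim
      case (elim n)
      then have "1 * sqrt (real n) \<le> sqrt (real n) * sqrt (real n)" by (intro mult_right_mono) auto
      then have "sqrt (real n) \<le> real n" by simp
      then show ?case using elim by (simp add: frac_le)
    qed
  qed
  have const_mult: "(\<lambda>n. c * f n) \<in> O(?r)" if "f \<in> O(?r)" for c :: real and f :: "nat \<Rightarrow> real"
    using that by (cases "c = 0") simp_all
  have "G.freq_error \<in> O(?r)" using freq_rate by (simp add: G.freq_error_def[abs_def])
  then have "\<epsilon> \<in> O(?r)"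
    unfolding \<epsilon>_def[abs_def] using const_mult[OF sqrt_eq, of c2] inv
    by (intro const_mult sum_in_bigo) auto
  moreover have "eps_nash_equilibrium P \<F> T x0 z0 \<delta> M (ty \<circ> \<alpha>) W n
             (candidate_pi T (ty \<circ> \<alpha>)) (candidate_C T (ty \<circ> \<alpha>) Zb XbT Xs) Xs (\<epsilon> n)" if n: "n \<ge> 1" for n
    using G.candidates_eps_nash[OF n, of R] R by (simp add: \<epsilon>_def A_def c1_def c2_def)
  ultimately show ?thesis by blast
qed

end
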